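(* Fix an integer $n\ge3$ and real numbers $\nu>0$, $K>1$. Let $\rho_{\epsilon,n}=(1-\delta_\epsilon)|\psi_{\epsilon,n}\rangle\langle\psi_{\epsilon,n}|+\delta_\epsilon\tau_\nu$ be the operators defined in the context. Then for all sufficiently small $\epsilon>0$ one has $0<\delta_\epsilon<1$, so $\rho_{\epsilon,n}$ is a quantum state, and $W_{\rho_{\epsilon,n}}(\boldsymbol r)\ge0$ for all $\boldsymbol r\in\mathbb R^2$. Moreover, for every $\alpha\in(0,2)$ there exists $\epsilon_0(\alpha)>0$ (depending also on $n,\nu,K$) such that $$0<\epsilon<\epsilon_0(\alpha)\ \Longrightarrow\ h_\alpha(W_{\rho_{\epsilon,n}})<h_\alpha(W_0),$$ where $h_\alpha$ is the Wigner–Rényi entropy and $W_0$ is the vacuum Wigner function.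
   Context: Units $\hbar=1$. $|k\rangle$ ($k\ge0$) are the harmonic-oscillator Fock states (normalized Hermite functions) in $L^2(\mathbb R)$. The Wigner function of a state $\rho$ is $W_\rho(q,p)=\frac1\pi\int_{-\infty}^\infty e^{2ipy}\langle q-y|\rho|q+y\rangle\,dy$; the vacuum has $W_0(\boldsymbol r)=\pi^{-1}e^{-|\boldsymbol r|^2}$. For $0<\epsilon<1$ let $|\psi_{\epsilon,n}\rangle=\sqrt{1-\epsilon^2}\,|0\rangle+\epsilon|n\rangle$, and let $\tau_\nu=\sum_{k\ge0}\frac{\nu^k}{(\nu+1)^{k+1}}|k\rangle\langle k|$ be the thermal state of mean photon number $\nu$. Let $P_n(x)=(-1)^nL_n(2x)$ ($L_n$ the Laguerre polynomial), $M_n=\max\{0,-\min_{x\ge0}P_n(x)\}$, $\beta_n=2^{n/2}/\sqrt{n!}$, $s_\nu=2\nu+1$, $c=1-s_\nu^{-1}$. For $\epsilon>0$ with $(1+M_n)\epsilon^2<1$ put $$x_-(\epsilon)=\left[\frac{1-(1+M_n)\epsilon^2}{2\epsilon\beta_n}\right]^{2/n},\qquad \delta_\epsilon=K\cdot 2\epsilon\beta_n s_\nu\,x_-(\epsilon)^{n/2}e^{-c\,x_-(\epsilon)}.$$ For a non-negative Wigner function $W$ and $\alpha>0$, $\alpha\ne1$: $h_\alpha(W)=\frac{1}{1-\alpha}\ln\int_{\mathbb R^2}W(\boldsymbol r)^\alpha\,d^2\boldsymbol r$; for $\alpha=1$, $h_1(W)=-\int_{\mathbb R^2} W\ln W\,d^2\boldsymbol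 r$. *)

theory Defs
  imports "HOL-Analysis.Analysis"
begin

section \<open>Wave functions and the Hilbert space of square-integrable functions\<close>

text \<open>Elements of the Hilbert space are represented by Borel measurable functions, not by their
  classes modulo null sets; properties that only make sense for classes are stated almost
  everywhere.\<close>

definition L2 :: "(real \<Rightarrow> complex) set" where
  "L2 = {f. f \<in> borel_measurable borel \<and> integrable lborel (\<lambda>x. (cmod (f x))\<^sup>2)}"

definition cinner :: "(real \<Rightarrow> complex) \<Rightarrow> (real \<Rightarrow> complex) \<Rightarrow> complex" where
  "cinner f g = (LINT x|lborel. cnj (f x) * g x)"

definition l2norm :: "(real \<Rightarrow> complex) \<Rightarrow> real" where
  "l2norm f = sqrt (LINT x|lborel. (cmod (f x))\<^sup>2)"

text \<open>Orthonormal sequence whose finite linear combinations are dense.\<close>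

definition orthonormal_basis :: "(nat \<Rightarrow> real \<Rightarrow> complex) \<Rightarrow> bool" where
  "orthonormal_basis e \<longleftrightarrow>
     (\<forall>j. e j \<in> L2) \<and>
     (\<forall>j k. cinner (e j) (e k) = (if j = k then 1 else 0)) \<and>
     (\<forall>f\<in>L2. \<forall>\<eta>>0. \<exists>N. \<exists>c :: nat \<Rightarrow> complex. l2norm (\<lambda>x. f x - (\<Sum>k<N. c k * e k x)) < \<eta>)"

section \<open>Quantum states\<close>

text \<open>Bounded positive operators of trace one. On a complex Hilbert space positivity entails
  self-adjointness, and a bounded positive operator is of trace class iff its diagonal matrix
  elements in an orthonormal basis are summable. Linearity and boundedness together make \<open>T\<close>
  compatible with almost-everywhere equality.\<close>

definition density_operator :: "((real \<Rightarrow> complex) \<Rightarrow> (real \<Rightarrow> complex)) \<Rightarrow> bool" where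
  "density_operator T \<longleftrightarrow>
     (\<forall>f\<in>L2. T f \<in> L2) \<and>
     (\<forall>f\<in>L2. \<forall>g\<in>L2. \<forall>a b :: complex.
        AE x in lborel. T (\<lambda>y. a * f y + b * g y) x = a * T f x + b * T g x) \<and>
     (\<exists>C. \<forall>f\<in>L2. l2norm (T f) \<le> C * l2norm f) \<and>
     (\<forall>f\<in>L2. cinner f (T f) \<in> \<real>\<^sub>\<ge>\<^sub>0) \<and>
     (\<forall>e. orthonormal_basis e \<longrightarrow> (\<lambda>k. cinner (e k) (T (e k))) sums 1)"

text \<open>Operators are given by their position-space kernels: \<open>\<rho> x y\<close> stands for
  \<open>\<langle>x|\<rho>|y\<rangle>\<close>. All kernels below are continuous, so their values on the antidiagonals that
  enter the Wigner function are unambiguous.\<close>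

type_synonym op_kernel = "real \<Rightarrow> real \<Rightarrow> complex"

definition integral_operator :: "op_kernel \<Rightarrow> (real \<Rightarrow> complex) \<Rightarrow> (real \<Rightarrow> complex)" where
  "integral_operator \<rho> f = (\<lambda>x. LINT y|lborel. \<rho> x y * f y)"

definition quantum_state :: "op_kernel \<Rightarrow> bool" where
  "quantum_state \<rho> \<longleftrightarrow> density_operator (integral_operator \<rho>)"

definition projector :: "(real \<Rightarrow> complex) \<Rightarrow> op_kernel" where
  "projector \<psi> = (\<lambda>x y. \<psi> x * cnj (\<psi> y))"

definition wigner :: "op_kernel \<Rightarrow> real \<times> real \<Rightarrow> complex" where
  "wigner \<rho> = (\<lambda>(q, p). complex_of_real (1 / pi) *
     (LINT y|lborel. exp (2 * \<i> * complex_of_real p * complex_of_real y) * \<rho> (q - y) (q + y)))"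

section \<open>Fock states and thermal states\<close>

text \<open>Physicists' Hermite polynomials.\<close>

fun hermite :: "nat \<Rightarrow> real \<Rightarrow> real" where
  "hermite 0 x = 1"
| "hermite (Suc 0) x = 2 * x"
| "hermite (Suc (Suc k)) x = 2 * x * hermite (Suc k) x - 2 * real (Suc k) * hermite k x"

definition fock :: "nat \<Rightarrow> real \<Rightarrow> complex" where
  "fock k x = complex_of_real (hermite k x * exp (- x\<^sup>2 / 2) / sqrt (2 ^ k * fact k * sqrt pi))"

text \<open>The Hermite functions are uniformly bounded, so the series converges absolutely and
  uniformly in \<open>(x, y)\<close> for \<open>\<nu> > 0\<close>.\<close>

definition thermal :: "real \<Rightarrow> op_kernel" where
  "thermal \<nu> = (\<lambda>x y. \<Sum>k. complex_of_real (\<nu> ^ k / (\<nu> + 1) ^ (k + 1)) * projector (fock k) x y)"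

section \<open>The family of states\<close>

definition psi :: "nat \<Rightarrow> real \<Rightarrow> real \<Rightarrow> complex" where
  "psi n \<epsilon> = (\<lambda>x. complex_of_real (sqrt (1 - \<epsilon>\<^sup>2)) * fock 0 x + complex_of_real \<epsilon> * fock n x)"

definition laguerre :: "nat \<Rightarrow> real \<Rightarrow> real" where
  "laguerre n x = (\<Sum>k\<le>n. real (n choose k) * (-1) ^ k / fact k * x ^ k)"

definition poly_P :: "nat \<Rightarrow> real \<Rightarrow> real" where
  "poly_P n x = (-1) ^ n * laguerre n (2 * x)"

text \<open>\<open>poly_P n\<close> has positive leading coefficient, so the infimum below is an attained minimum.\<close>

definition const_M :: "nat \<Rightarrow> real" where
  "const_M n = max 0 (- (INF x\<in>{0..}. poly_P n x))"

definition beta_coeff :: "nat \<Rightarrow> real" where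
  "beta_coeff n = 2 powr (real n / 2) / sqrt (fact n)"

definition s_par :: "real \<Rightarrow> real" where
  "s_par \<nu> = 2 * \<nu> + 1"

definition c_par :: "real \<Rightarrow> real" where
  "c_par \<nu> = 1 - 1 / s_par \<nu>"

text \<open>\<open>x_minus\<close> and \<open>delta\<close> are meaningful only for \<open>\<epsilon> > 0\<close> with \<open>(1 + const_M n) * \<epsilon>\<^sup>2 < 1\<close>, which holds
  for all sufficiently small \<open>\<epsilon> > 0\<close>.\<close>

definition x_minus :: "nat \<Rightarrow> real \<Rightarrow> real" where
  "x_minus n \<epsilon> = ((1 - (1 + const_M n) * \<epsilon>\<^sup>2) / (2 * \<epsilon> * beta_coeff n)) powr (2 / real n)"

definition delta :: "nat \<Rightarrow> real \<Rightarrow> real \<Rightarrow> real \<Rightarrow> real" where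
  "delta n \<nu> K \<epsilon> =
     K * (2 * \<epsilon> * beta_coeff n * s_par \<nu> * x_minus n \<epsilon> powr (real n / 2) * exp (- c_par \<nu> * x_minus n \<epsilon>))"

definition rho :: "nat \<Rightarrow> real \<Rightarrow> real \<Rightarrow> real \<Rightarrow> op_kernel" where
  "rho n \<nu> K \<epsilon> = (\<lambda>x y. complex_of_real (1 - delta n \<nu> K \<epsilon>) * projector (psi n \<epsilon>) x y
                      + complex_of_real (delta n \<nu> K \<epsilon>) * thermal \<nu> x y)"

section \<open>Wigner--Renyi entropy\<close>

definition renyi_entropy :: "real \<Rightarrow> (real \<times> real \<Rightarrow> real) \<Rightarrow> real" where
  "renyi_entropy \<alpha> W =
     (if \<alpha> = 1 then - (LINT r|lborel. W r * ln (W r))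
      else 1 / (1 - \<alpha>) * ln (LINT r|lborel. W r powr \<alpha>))"

text \<open>The Bochner integral of a non-integrable function and \<open>ln 0\<close> are both \<open>0\<close>; the following
  condition rules out that these conventions determine the value of \<open>renyi_entropy\<close>.
  The convention \<open>0 * ln 0 = 0\<close> in the case \<open>\<alpha> = 1\<close> is the intended one.\<close>

definition renyi_well_defined :: "real \<Rightarrow> (real \<times> real \<Rightarrow> real) \<Rightarrow> bool" where
  "renyi_well_defined \<alpha> W \<longleftrightarrow>
     (if \<alpha> = 1 then integrable lborel (\<lambda>r. W r * ln (W r))
      else integrable lborel (\<lambda>r. W r powr \<alpha>) \<and> 0 < (LINT r|lborel. W r powr \<alpha>))"

end

theory Submission
  imports Defs "HOL-Probability.Characteristic_Functions" "HOL-Real_Asymp.Real_Asymp"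
begin

text \<open>Relative to the vacuum the Wigner function of \<open>\<rho>\<close> is \<open>1 + v + t\<close>. The part \<open>v\<close> comes from the pure
  state; it is a polynomial in the phase-space variables of size \<open>\<epsilon>\<close>, with first-order term
  \<open>\<epsilon> g\<close>, \<open>g = 2 \<beta> Re z\<^sup>n\<close>, of mean zero, and second-order term \<open>\<epsilon>\<^sup>2 (P - 1)\<close>. The thermal part \<open>t\<close> is
  positive, it compensates the negativity of \<open>1 + v\<close> beyond \<open>x_minus\<close>, and its weight \<open>delta\<close> is
  smaller than every power of \<open>\<epsilon>\<close>. Expanding the entropy to second order in \<open>\<epsilon>\<close> leaves the Gaussian
  moments of \<open>P - 1\<close> and of \<open>g\<^sup>2\<close>. With \<open>u = (2 - \<alpha>) / \<alpha>\<close> their combination is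
  \<open>(u - 1) (1 + u + \<dots> + u\<^bsup>n - 1\<^esup> - (1 + u)\<^bsup>n - 1\<^esup>)\<close>, whose last factor is negative for \<open>n \<ge> 3\<close>; at
  \<open>\<alpha> = 1\<close> the coefficient is \<open>2 n - 2\<^sup>n\<close>. The expansion cannot be done pointwise where \<open>v\<close> is large, but in
  each range of \<open>\<alpha>\<close> only a one-sided bound is needed, and those hold for all real \<open>v\<close> with an error of
  order \<open>\<bar>v\<bar>\<^sup>3\<close>.\<close>

text \<open>The sign of \<open>1 / (1 - \<alpha>)\<close> decides which side is bounded: the
  integral of \<open>W powr \<alpha>\<close> from above for \<alpha> < 1 and from below for \<alpha>
  > 1, and that of \<open>W * ln W\<close> from below at \<alpha> = 1. A lower bound can discard the
  thermal part, by monotonicity or, at \<alpha> = 1, by a tangent of nonnegative slope. The upper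
  bound cannot: subadditivity leaves a term of order \<open>\<delta> powr \<alpha>\<close>, which
  for small \<alpha> is negligible only because \<delta> is below every power of \<epsilon>. The
  condition \<alpha> < 2 makes u positive. For n = 2 the last factor of the coefficient would be
  zero, so the second order would decide nothing. A kernel needs values at every pair of points, and
  a state needs trace one in every orthonormal basis. Countable mixtures of unit vectors with
  pointwise convergent kernel series meet both demands, through Tonelli's theorem and Parseval's
  identity. Up to base cases, Hermite orthogonality, the Wigner functions of the matrix units and
  the planar moments all come from one integration by parts of a Gaussian times a
  polynomial.\<close>

lemma integrable_gauss_abs_power:
  fixes a :: real
  assumes "a > 0"
  shows "integrable lborel (\<lambda>y. exp (- a * y\<^sup>2) * \<bar>y\<bar> ^ k)"
proof -
  define \<sigma> where "\<sigma> = 1 / sqrt (2 * a)"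
  have s: "\<sigma> > 0" "\<sigma>\<^sup>2 = 1 / (2 * a)" using assms by (auto simp: \<sigma>_def power_divide)
  have "integrable lborel (\<lambda>y. normal_density 0 \<sigma> y * \<bar>y - 0\<bar> ^ k)"
    by (rule integrable_normal_moment_abs) (fact s)
  then have "integrable lborel (\<lambda>y. sqrt (2 * pi * \<sigma>\<^sup>2) * (normal_density 0 \<sigma> y * \<bar>y - 0\<bar> ^ k))"
    by (rule integrable_mult_right)
  also have "(\<lambda>y. sqrt (2 * pi * \<sigma>\<^sup>2) * (normal_density 0 \<sigma> y * \<bar>y - 0\<bar> ^ k)) =
      (\<lambda>y. exp (- a * y\<^sup>2) * \<bar>y\<bar> ^ k)"
    using s assms by (auto simp: normal_density_def fun_eq_iff)
  finally show ?thesis .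
qed

lemma integrable_gauss:
  fixes a :: real
  assumes "a > 0"
  shows "integrable lborel (\<lambda>y. exp (- a * y\<^sup>2))"
  using integrable_gauss_abs_power[OF assms, of 0] by simp

lemma integral_gauss:
  fixes a :: real
  assumes "a > 0"
  shows "(LINT y|lborel. exp (- a * y\<^sup>2)) = sqrt (pi / a)"
proof -
  define \<sigma> where "\<sigma> = 1 / sqrt (2 * a)"
  have s: "\<sigma> > 0" "\<sigma>\<^sup>2 = 1 / (2 * a)" using assms by (auto simp: \<sigma>_def power_divide)
  have "(\<lambda>y. exp (- a * y\<^sup>2)) = (\<lambda>y. sqrt (2 * pi * \<sigma>\<^sup>2) * normal_density 0 \<sigma> y)"
    using s assms by (auto simp: normal_density_def fun_eq_iff)
  then have "(LINT y|lborel. exp (- a * y\<^sup>2)) = sqrt (2 * pi * \<sigma>\<^sup>2) * (LINT y|lborel. normal_density 0 \<sigma> y)"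
    by simp
  also have "\<dots> = sqrt (pi / a)" using s by simp
  finally show ?thesis .
qed

section \<open>Integration by parts against a Gaussian with linear phase\<close>

definition gauss :: "real \<Rightarrow> real \<Rightarrow> real \<Rightarrow> complex" where
  "gauss b a y = exp (\<i> * complex_of_real (b * y)) * complex_of_real (exp (- a * y\<^sup>2))"

lemma norm_gauss: "cmod (gauss b a y) = exp (- a * y\<^sup>2)"
  by (simp add: gauss_def norm_mult)

lemma continuous_on_gauss: "continuous_on A (gauss b a)"
  unfolding gauss_def by (intro continuous_intros)

lemma measurable_gauss [measurable]: "gauss b a \<in> borel_measurable borel"
  by (intro borel_measurable_continuous_onI continuous_on_gauss)

lemma measurable_poly_of_real [measurable]:
  "(\<lambda>y::real. poly F (complex_of_real y)) \<in> borel_measurable borel"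
  by (intro borel_measurable_continuous_onI continuous_intros)

lemma integrable_gauss_poly:
  fixes F :: "complex poly"
  assumes "a > 0"
  shows "integrable lborel (\<lambda>y. gauss b a y * poly F (complex_of_real y))"
proof -
  have "integrable lborel (\<lambda>y. \<Sum>i\<le>degree F. coeff F i * (gauss b a y * (complex_of_real y) ^ i))"
  proof (intro Bochner_Integration.integrable_sum integrable_mult_right)
    fix i
    show "integrable lborel (\<lambda>y. gauss b a y * (complex_of_real y) ^ i)"
      by (rule Bochner_Integration.integrable_bound[OF integrable_gauss_abs_power[OF assms, of i]])
         (auto simp: norm_mult norm_gauss norm_power)
  qed
  then show ?thesis
    by (simp add: poly_altdef sum_distrib_left mult_ac)
qed

lemma gauss_poly_tendsto_0:
  fixes F :: "complex poly"
  assumes "a > 0" "G = at_top \<or> G = at_bot"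
  shows "((\<lambda>y. gauss b a y * poly F (complex_of_real y)) \<longlongrightarrow> 0) G"
proof -
  have "((\<lambda>y. \<Sum>i\<le>degree F. coeff F i * (gauss b a y * (complex_of_real y) ^ i)) \<longlongrightarrow> (\<Sum>i\<le>degree F. coeff F i * 0)) G"
  proof (intro tendsto_sum tendsto_mult_left)
    fix i :: nat
    have "((\<lambda>y::real. exp (- a * y\<^sup>2) * \<bar>y\<bar> ^ i) \<longlongrightarrow> 0) at_top"
      "((\<lambda>y::real. exp (- a * y\<^sup>2) * \<bar>y\<bar> ^ i) \<longlongrightarrow> 0) at_bot"
      using assms(1) by real_asymp+
    then have "((\<lambda>y::real. exp (- a * y\<^sup>2) * \<bar>y\<bar> ^ i) \<longlongrightarrow> 0) G"
      using assms(2) by auto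
    then show "((\<lambda>y. gauss b a y * (complex_of_real y) ^ i) \<longlongrightarrow> 0) G"
      by (rule Lim_null_comparison[rotated]) (auto simp: norm_mult norm_gauss norm_power)
  qed
  then show ?thesis
    by (simp add: poly_altdef sum_distrib_left mult_ac)
qed

lemma gauss_has_vector_derivative:
  "((\<lambda>y. gauss b a y * poly F (complex_of_real y)) has_vector_derivative
     gauss b a y * (poly F (complex_of_real y) * (\<i> * complex_of_real b - 2 * complex_of_real (a * y))
       + poly (pderiv F) (complex_of_real y))) (at y)"
proof -
  have e: "gauss b a x = exp (\<i> * complex_of_real b * complex_of_real x - complex_of_real a * (complex_of_real x)\<^sup>2)" for x
    by (simp add: gauss_def exp_diff exp_minus divide_inverse exp_of_real[symmetric] mult.assoc)
  \<comment> \<open>The weight extends to an entire function of z, so complex differentiation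
    applies; restriction to the real line comes afterwards.\<close>
  have "((\<lambda>z. exp (\<i> * complex_of_real b * z - complex_of_real a * z\<^sup>2) * poly F z) has_field_derivative
     exp (\<i> * complex_of_real b * z - complex_of_real a * z\<^sup>2) * (poly F z * (\<i> * complex_of_real b - 2 * complex_of_real a * z)
       + poly (pderiv F) z)) (at z)" for z
    by (auto intro!: derivative_eq_intros simp: algebra_simps)
  from has_vector_derivative_real_field[OF this[of "complex_of_real y"], of UNIV]
  show ?thesis unfolding e by (simp add: mult.assoc)
qed

text \<open>The integrand is the derivative of a Gaussian times \<open>F\<close>, which vanishes at
  both ends of the line. The case b = 0, a = 1 serves Hermite orthogonality, b = 2 p, a = 1 the
  Wigner integrals, and b = 0 with any a > 0 the planar moments.\<close>

lemma integral_gauss_by_parts: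
  fixes F :: "complex poly"
  assumes "a > 0"
  shows "(LINT y|lborel. gauss b a y * (poly F (complex_of_real y) * (\<i> * complex_of_real b - 2 * complex_of_real (a * y))
       + poly (pderiv F) (complex_of_real y))) = 0"
proof -
  let ?G = "\<lambda>y. gauss b a y * (poly F (complex_of_real y) * (\<i> * complex_of_real b - 2 * complex_of_real (a * y))
       + poly (pderiv F) (complex_of_real y))"
  have G: "?G = (\<lambda>y. gauss b a y * poly (F * [:\<i> * complex_of_real b, - 2 * complex_of_real a:] + pderiv F) (complex_of_real y))"
    by (auto simp: fun_eq_iff algebra_simps)
  have "(LBINT y=-\<infinity>..\<infinity>. ?G y) = 0 - 0"
  proof (rule interval_integral_FTC_integrable)
    show "((\<lambda>y. gauss b a y * poly F (complex_of_real y)) has_vector_derivative ?G x) (at x)" for x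
      by (rule gauss_has_vector_derivative)
    show "isCont ?G x" for x
      using continuous_on_gauss[of UNIV b a]
      by (auto intro!: continuous_intros simp: continuous_on_eq_continuous_at)
    show "set_integrable lborel (einterval (-\<infinity>) \<infinity>) ?G"
      using integrable_gauss_poly[OF assms, of b "(F * [:\<i> * complex_of_real b, - 2 * complex_of_real a:] + pderiv F)"]
      unfolding G by (simp add: set_integrable_def)
    show "(((\<lambda>y. gauss b a y * poly F (complex_of_real y)) \<circ> real_of_ereal) \<longlongrightarrow> 0) (at_right (-\<infinity>))"
      by (simp add: ereal_tendsto_simps gauss_poly_tendsto_0[OF assms])
    show "(((\<lambda>y. gauss b a y * poly F (complex_of_real y)) \<circ> real_of_ereal) \<longlongrightarrow> 0) (at_left \<infinity>)"
      by (simp add: ereal_tendsto_simps gauss_poly_tendsto_0[OF assms])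
  qed auto
  then show ?thesis
    by (simp add: interval_lebesgue_integral_def set_lebesgue_integral_def)
qed

text \<open>Substitution of x = sqrt 2 * y in the characteristic function of the standard normal
  distribution. The phase 2 p is that of the Wigner integral.\<close>

lemma integral_gauss_fourier:
  "(LINT y|lborel. gauss (2 * p) 1 y) = complex_of_real (sqrt pi * exp (- p\<^sup>2))"
proof -
  have "complex_of_real (exp (- p\<^sup>2)) = char std_normal_distribution (sqrt 2 * p)"
    by (simp add: char_std_normal_distribution power_mult_distrib)
  also have "\<dots> = (LINT x|lborel. std_normal_density x *\<^sub>R iexp (sqrt 2 * p * x))"
    unfolding char_def by (subst integral_density) auto
  also have "\<dots> = \<bar>sqrt 2\<bar> *\<^sub>R (LINT x|lborel. std_normal_density (0 + sqrt 2 * x) *\<^sub>R iexp (sqrt 2 * p * (0 + sqrt 2 * x)))"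
    by (rule lborel_integral_real_affine) auto
  also have "\<dots> = (LINT x|lborel. \<bar>sqrt 2\<bar> *\<^sub>R (std_normal_density (0 + sqrt 2 * x) *\<^sub>R iexp (sqrt 2 * p * (0 + sqrt 2 * x))))"
    by (simp only: integral_scaleR_right)
  also have "\<dots> = (LINT x|lborel. complex_of_real (1 / sqrt pi) * gauss (2 * p) 1 x)"
  proof (rule Bochner_Integration.integral_cong[OF refl])
    fix x
    have "sqrt 2 * p * (sqrt 2 * x) = 2 * p * x"
      by (metis (no_types, opaque_lifting) mult.assoc mult.commute real_sqrt_mult_self abs_numeral)
    then have e: "iexp (sqrt 2 * p * (0 + sqrt 2 * x)) = iexp (2 * p * x)" by (simp only: add_0)
    show "\<bar>sqrt 2\<bar> *\<^sub>R (std_normal_density (0 + sqrt 2 * x) *\<^sub>R iexp (sqrt 2 * p * (0 + sqrt 2 * x)))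
       = complex_of_real (1 / sqrt pi) * gauss (2 * p) 1 x"
      unfolding e by (simp add: gauss_def normal_density_def scaleR_conv_of_real power_mult_distrib real_sqrt_mult)
  qed
  finally have "complex_of_real (exp (- p\<^sup>2)) = complex_of_real (1 / sqrt pi) * (LINT x|lborel. gauss (2 * p) 1 x)"
    by simp
  then show ?thesis by (simp add: field_simps)
qed

text \<open>As a linear functional on polynomials, the integral turns each recurrence below into an
  identity in the polynomial ring, and integrability need not be checked again.\<close>

definition gauss_int :: "real \<Rightarrow> real \<Rightarrow> complex poly \<Rightarrow> complex" where
  "gauss_int b a F = (LINT y|lborel. gauss b a y * poly F (complex_of_real y))"

lemma gauss_int_add: "a > 0 \<Longrightarrow> gauss_int b a (F + G) = gauss_int b a F + gauss_int b a G"
  unfolding gauss_int_def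
  by (subst Bochner_Integration.integral_add[symmetric]) (auto simp: distrib_left intro: integrable_gauss_poly)

lemma gauss_int_diff: "a > 0 \<Longrightarrow> gauss_int b a (F - G) = gauss_int b a F - gauss_int b a G"
  unfolding gauss_int_def
  by (subst Bochner_Integration.integral_diff[symmetric]) (auto simp: right_diff_distrib intro: integrable_gauss_poly)

lemma gauss_int_smult: "gauss_int b a (smult c F) = c * gauss_int b a F"
  unfolding gauss_int_def by (simp add: mult.left_commute flip: integral_mult_right_zero)

text \<open>The linear polynomial is the logarithmic derivative of the weight, so under the
  functional multiplication by it amounts to differentiation, up to sign.\<close>

lemma gauss_int_by_parts:
  assumes "a > 0"
  shows "gauss_int b a (F * [:\<i> * complex_of_real b, - 2 * complex_of_real a:]) = - gauss_int b a (pderiv F)"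
proof -
  have "gauss_int b a (F * [:\<i> * complex_of_real b, - 2 * complex_of_real a:] + pderiv F) = 0"
    unfolding gauss_int_def by (rule trans[OF _ integral_gauss_by_parts[OF assms, of b F]])
       (auto simp: algebra_simps intro!: Bochner_Integration.integral_cong)
  then show ?thesis by (simp add: gauss_int_add[OF assms] eq_neg_iff_add_eq_0)
qed

text \<open>The polynomial version of \<open>hermite\<close>, over the complex numbers, so that
  \<open>pderiv\<close> and \<open>pcompose\<close> are available and coefficients such as \<i> * p
  can enter.\<close>

fun hermite_poly :: "nat \<Rightarrow> complex poly" where
  "hermite_poly 0 = 1"
| "hermite_poly (Suc 0) = [:0, 2:]"
| "hermite_poly (Suc (Suc k)) = [:0, 2:] * hermite_poly (Suc k) - smult (2 * of_nat (Suc k)) (hermite_poly k)"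

lemma poly_hermite_poly: "poly (hermite_poly k) (complex_of_real x) = complex_of_real (hermite k x)"
  by (induction k rule: hermite_poly.induct) auto

text \<open>At k = 0 the truncated index \<open>k - 1\<close> is harmless because its coefficient is
  zero. All lowered indices below rely on this.\<close>

lemma hermite_poly_Suc:
  "hermite_poly (Suc k) = [:0, 2:] * hermite_poly k - smult (2 * of_nat k) (hermite_poly (k - 1))"
  by (cases k) auto

lemma pderiv_hermite_poly: "pderiv (hermite_poly k) = smult (2 * of_nat k) (hermite_poly (k - 1))"
proof (induction k rule: hermite_poly.induct)
  case (3 k)
  have "pderiv (hermite_poly (Suc (Suc k))) = smult 2 (hermite_poly (Suc k)) +
      [:0,2:] * smult (2 * of_nat (Suc k)) (hermite_poly k)
      - smult (2 * of_nat (Suc k)) (smult (2 * of_nat k) (hermite_poly (k - 1)))"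
    using 3 by (simp add: pderiv_diff pderiv_mult pderiv_smult pderiv_pCons del: of_nat_Suc)
  also have "\<dots> = smult 2 (hermite_poly (Suc k)) + smult (2 * of_nat (Suc k)) (hermite_poly (Suc k))"
    by (simp add: hermite_poly_Suc[of k] smult_diff_right mult_ac del: of_nat_Suc)
  also have "\<dots> = smult (2 * of_nat (Suc (Suc k))) (hermite_poly (Suc k))"
    by (simp add: algebra_simps flip: smult_add_left)
  finally show ?case by simp
qed (auto simp: pderiv_pCons)

section \<open>Orthogonality of the Hermite functions\<close>

text \<open>Raising k means passing from H to 2 x H - H', which under the weight exp (-x^2) is the
  adjoint of differentiation; the derivative then falls on the other Hermite polynomial.\<close>

lemma gauss_int_hermite_Suc:
  "gauss_int 0 1 (hermite_poly m * hermite_poly (Suc k)) =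
     2 * of_nat m * gauss_int 0 1 (hermite_poly (m - 1) * hermite_poly k)"
proof -
  let ?F = "hermite_poly m * hermite_poly k"
  have "hermite_poly m * hermite_poly (Suc k) =
      smult (-1) (?F * [:\<i> * complex_of_real 0, - 2 * complex_of_real 1:]) - smult (2 * of_nat k) (hermite_poly m * hermite_poly (k - 1))"
    by (simp add: hermite_poly_Suc algebra_simps)
  then have "gauss_int 0 1 (hermite_poly m * hermite_poly (Suc k)) =
     gauss_int 0 1 (pderiv ?F) - 2 * of_nat k * gauss_int 0 1 (hermite_poly m * hermite_poly (k - 1))"
    by (simp only: gauss_int_diff gauss_int_smult gauss_int_by_parts zero_less_one) simp
  also have "pderiv ?F = smult (2 * of_nat m) (hermite_poly (m - 1) * hermite_poly k)
       + smult (2 * of_nat k) (hermite_poly m * hermite_poly (k - 1))"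
    by (simp add: pderiv_mult pderiv_hermite_poly algebra_simps)
  finally show ?thesis by (simp add: gauss_int_add gauss_int_smult)
qed

lemma gauss_int_hermite_0:
  assumes "k > 0"
  shows "gauss_int 0 1 (hermite_poly 0 * hermite_poly k) = 0"
  using gauss_int_hermite_Suc[of 0 "k - 1"] assms by simp

lemma gauss_int_hermite_same:
  "gauss_int 0 1 (hermite_poly k * hermite_poly k) = complex_of_real (2 ^ k * fact k * sqrt pi)"
proof (induction k)
  case 0
  have "gauss_int 0 1 1 = complex_of_real (sqrt pi)"
    using integral_gauss_fourier[of 0] by (simp add: gauss_int_def)
  then show ?case by simp
next
  case (Suc k)
  then show ?case by (simp add: gauss_int_hermite_Suc)
qed

definition fock_norm :: "nat \<Rightarrow> real" where
  "fock_norm k = sqrt (2 ^ k * fact k * sqrt pi)"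

lemma fock_norm_pos: "fock_norm k > 0" by (simp add: fock_norm_def)

lemma fock_norm_sq: "fock_norm k * fock_norm k = 2 ^ k * fact k * sqrt pi" 
  by (simp add: fock_norm_def)

lemma fock_eq: "fock k x = complex_of_real (hermite k x * exp (- x\<^sup>2 / 2) / fock_norm k)"
  by (simp add: fock_def fock_norm_def)

lemma continuous_on_hermite: "continuous_on A (hermite k)"
  by (induction k rule: hermite_poly.induct) (auto simp: continuous_on_mult continuous_on_const continuous_on_diff continuous_on_id)

lemma continuous_on_fock: "continuous_on A (fock k)"
proof -
  have "continuous_on A (\<lambda>x. complex_of_real (hermite k x * exp (- x\<^sup>2 / 2) / fock_norm k))"
    using fock_norm_pos[of k] by (intro continuous_intros continuous_on_hermite) auto
  then show ?thesis by (simp only: fock_eq[abs_def])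
qed

lemma measurable_fock [measurable]: "fock k \<in> borel_measurable borel"
  by (intro borel_measurable_continuous_onI continuous_on_fock)

lemma fock_times_fock:
  "fock m x * fock k x =
     1 / complex_of_real (fock_norm m * fock_norm k) * (gauss 0 1 x * poly (hermite_poly m * hermite_poly k) (complex_of_real x))"
  by (auto simp: fock_eq gauss_def poly_hermite_poly mult_ac simp flip: of_real_mult exp_add)

lemma integrable_fock_fock: "integrable lborel (\<lambda>x. fock m x * fock k x)"
  unfolding fock_times_fock by (intro integrable_mult_right integrable_gauss_poly) auto

lemma cnj_fock [simp]: "cnj (fock k x) = fock k x"
  by (simp add: fock_def)

lemma cinner_fock:
  "cinner (fock m) (fock k) = gauss_int 0 1 (hermite_poly m * hermite_poly k) / complex_of_real (fock_norm m * fock_norm k)"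
  unfolding cinner_def cnj_fock fock_times_fock gauss_int_def by simp

lemma cinner_fock_same: "cinner (fock k) (fock k) = 1"
  unfolding cinner_fock gauss_int_hermite_same fock_norm_sq by simp

lemma cinner_fock_0: "k > 0 \<Longrightarrow> cinner (fock 0) (fock k) = 0"
  unfolding cinner_fock by (simp only: gauss_int_hermite_0) simp

lemma fock_L2: "fock k \<in> L2"
proof -
  have "(\<lambda>x. (cmod (fock k x))\<^sup>2) = (\<lambda>x. Re (fock k x * fock k x))"
    unfolding fock_eq norm_of_real power2_abs by (simp only: power2_eq_square Re_complex_of_real flip: of_real_mult)
  then show ?thesis
    using integrable_Re[OF integrable_fock_fock[of k k]] by (simp add: L2_def)
qed

section \<open>Wigner functions of Fock matrix elements\<close>

text \<open>Up to normalization and the factor \<open>exp (- q\<^sup>2)\<close>, the Wigner integral of the matrix unit \<open>|m\<rangle>\<langle>k|\<close>.\<close>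

definition fock_overlap :: "real \<Rightarrow> real \<Rightarrow> nat \<Rightarrow> nat \<Rightarrow> complex" where
  "fock_overlap q p m k = gauss_int (2 * p) 1
     (pcompose (hermite_poly m) [:complex_of_real q, -1:] * pcompose (hermite_poly k) [:complex_of_real q, 1:])"

text \<open>Ladder relations. The Hermite recurrence produces the factor 2 q + 2 y on the right and
  2 q - 2 y on the left. Integration by parts trades y for \<i> * p, up to derivative terms, which
  completes the factor to 2 z or twice its conjugate. Of the derivative terms, those lowering the
  index that is being raised cancel against the recurrence; the others remain.\<close>

lemma fock_overlap_Suc_right:
  "fock_overlap q p m (Suc k) =
     2 * Complex q p * fock_overlap q p m k - 2 * of_nat m * fock_overlap q p (m - 1) k"
  (is ?r)
and fock_overlap_Suc_left:
  "fock_overlap q p (Suc m) k =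
     2 * cnj (Complex q p) * fock_overlap q p m k - 2 * of_nat k * fock_overlap q p m (k - 1)"
  (is ?l)
proof -
  define U where "U m = pcompose (hermite_poly m) [:complex_of_real q, -1:]" for m
  define V where "V m = pcompose (hermite_poly m) [:complex_of_real q, 1:]" for m
  let ?q = "complex_of_real q" and ?p = "complex_of_real p"
  have US: "U (Suc m) = [:2 * ?q, -2:] * U m - smult (2 * of_nat m) (U (m - 1))" for m
    unfolding U_def hermite_poly_Suc by (simp add: pcompose_diff pcompose_mult pcompose_smult pcompose_pCons algebra_simps smult_add_right smult_diff_right)
  have VS: "V (Suc m) = [:2 * ?q, 2:] * V m - smult (2 * of_nat m) (V (m - 1))" for m
    unfolding V_def hermite_poly_Suc by (simp add: pcompose_diff pcompose_mult pcompose_smult pcompose_pCons algebra_simps smult_add_right smult_diff_right)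
  have dU: "pderiv (U m) = smult (- 2 * of_nat m) (U (m - 1))" for m
    unfolding U_def by (simp add: pderiv_pcompose pderiv_hermite_poly pderiv_pCons pcompose_smult)
  have dV: "pderiv (V m) = smult (2 * of_nat m) (V (m - 1))" for m
    unfolding V_def by (simp add: pderiv_pcompose pderiv_hermite_poly pderiv_pCons pcompose_smult)
  let ?J = "gauss_int (2 * p) 1"
  have A: "fock_overlap q p m k = ?J (U m * V k)" for m k
    by (simp add: fock_overlap_def U_def V_def)
  let ?F = "U m * V k" and ?L = "[:\<i> * complex_of_real (2 * p), - 2 * complex_of_real 1:]"
  have d: "?J (?F * ?L) = 2 * of_nat m * ?J (U (m - 1) * V k) - 2 * of_nat k * ?J (U m * V (k - 1))"
  proof -
    have "pderiv ?F = smult (2 * of_nat k) (U m * V (k - 1)) - smult (2 * of_nat m) (U (m - 1) * V k)"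
      by (simp add: pderiv_mult dU dV algebra_simps)
    then show ?thesis
      by (simp only: gauss_int_by_parts zero_less_one gauss_int_diff gauss_int_smult) simp
  qed
  have z: "Complex q p = ?q + \<i> * ?p" by (simp add: complex_eq_iff)
  have r: "U m * V (Suc k) = smult (2 * Complex q p) ?F - ?F * ?L - smult (2 * of_nat k) (U m * V (k - 1))"
    by (simp add: VS z algebra_simps smult_add_left)
  have l: "U (Suc m) * V k = smult (2 * cnj (Complex q p)) ?F + ?F * ?L - smult (2 * of_nat m) (U (m - 1) * V k)"
    by (simp add: US z algebra_simps smult_add_left smult_diff_left)
  show ?r
    unfolding A r by (simp only: gauss_int_add gauss_int_diff gauss_int_smult zero_less_one d) simp
  show ?l
    unfolding A l by (simp only: gauss_int_add gauss_int_diff gauss_int_smult zero_less_one d) simp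
qed

lemma fock_overlap_0_0: "fock_overlap q p 0 0 = complex_of_real (sqrt pi * exp (- p\<^sup>2))"
  using integral_gauss_fourier[of p] by (simp add: fock_overlap_def gauss_int_def pcompose_1)

lemma fock_overlap_right_0: "fock_overlap q p m 0 = (2 * cnj (Complex q p)) ^ m * fock_overlap q p 0 0"
  by (induction m) (simp_all add: fock_overlap_Suc_left)

lemma fock_overlap_left_0: "fock_overlap q p 0 k = (2 * Complex q p) ^ k * fock_overlap q p 0 0"
  by (induction k) (simp_all add: fock_overlap_Suc_right)

text \<open>Solves the right ladder relation by induction on k with m arbitrary. Up to normalization
  the sum is an associated Laguerre polynomial in |z|^2 times a power of z or of its conjugate.
  Terms with j > m vanish, so the truncated exponent \<open>m - j\<close> does no harm.\<close>

lemma fock_overlap_eq: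
  "fock_overlap q p m k = fock_overlap q p 0 0 *
     (\<Sum>j\<le>k. (-2) ^ j * fact j * of_nat (m choose j) * of_nat (k choose j) *
        (2 * Complex q p) ^ (k - j) * (2 * cnj (Complex q p)) ^ (m - j))"
proof (induction k arbitrary: m)
  case 0
  then show ?case by (simp add: fock_overlap_right_0[of q p m])
next
  case (Suc k)
  let ?z = "2 * Complex q p" and ?w = "2 * cnj (Complex q p)"
  let ?T = "\<lambda>m k j. (-2) ^ j * fact j * of_nat (m choose j) * of_nat (k choose j) * ?z ^ (k - j) * ?w ^ (m - j)"
  let ?S = "\<lambda>m k. \<Sum>j\<le>k. ?T m k j"
  have 1: "?z * ?S m k = (\<Sum>j\<le>Suc k. (-2) ^ j * fact j * of_nat (m choose j) * of_nat (k choose j) * ?z ^ (Suc k - j) * ?w ^ (m - j))"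
    by (simp add: sum_distrib_left Suc_diff_le mult_ac)
  \<comment> \<open>Absorption rewrites the lowered binomial \<open>(m - 1) choose i\<close> as one
    with upper index m and lower index \<open>Suc i\<close>; the two parts of the ladder relation
    can then be joined by Pascal's rule in k.\<close>
  have absorb: "of_nat (Suc i) * of_nat (m choose Suc i) = (of_nat m * of_nat ((m - 1) choose i) :: complex)" for i
  proof (cases m)
    case (Suc m')
    have "(of_nat (Suc i * (Suc m' choose Suc i)) :: complex) = of_nat (Suc m' * (m' choose i))"
      using Suc_times_binomial_eq[of m' i] by (simp only: mult.commute)
    then show ?thesis unfolding Suc by (simp only: of_nat_mult diff_Suc_1)
  qed simp
  have 2: "- 2 * of_nat m * ?S (m - 1) k =
      (\<Sum>i\<le>k. (-2) ^ Suc i * fact (Suc i) * of_nat (m choose Suc i) * of_nat (k choose i) * ?z ^ (k - i) * ?w ^ (m - Suc i))"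
    unfolding sum_distrib_left
  proof (rule sum.cong[OF refl])
    fix i
    have "(-2) ^ Suc i * fact (Suc i) * of_nat (m choose Suc i) * of_nat (k choose i) * ?z ^ (k - i) * ?w ^ (m - Suc i)
      = -2 * (-2) ^ i * fact i * (of_nat (Suc i) * of_nat (m choose Suc i)) * of_nat (k choose i) * ?z ^ (k - i) * ?w ^ (m - Suc i)"
      by (simp add: fact_Suc mult_ac del: of_nat_Suc)
    also have "\<dots> = - 2 * of_nat m * ?T (m - 1) k i"
      unfolding absorb by (simp add: mult_ac)
    finally show "- 2 * of_nat m * ?T (m - 1) k i = (-2) ^ Suc i * fact (Suc i) * of_nat (m choose Suc i) * of_nat (k choose i) * ?z ^ (k - i) * ?w ^ (m - Suc i)"
      by (rule sym)
  qed
  have "?S m (Suc k) = ?z * ?S m k - 2 * of_nat m * ?S (m - 1) k"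
  proof -
    have "?S m (Suc k) = ?T m (Suc k) 0 + (\<Sum>i\<le>k. ?T m (Suc k) (Suc i))"
      by (rule sum.atMost_Suc_shift)
    also have "(\<Sum>i\<le>k. ?T m (Suc k) (Suc i)) =
       (\<Sum>i\<le>k. (-2) ^ Suc i * fact (Suc i) * of_nat (m choose Suc i) * of_nat (k choose Suc i) * ?z ^ (k - i) * ?w ^ (m - Suc i))
       + (\<Sum>i\<le>k. (-2) ^ Suc i * fact (Suc i) * of_nat (m choose Suc i) * of_nat (k choose i) * ?z ^ (k - i) * ?w ^ (m - Suc i))"
      unfolding sum.distrib[symmetric] by (rule sum.cong) (auto simp: algebra_simps)
    also have "?T m (Suc k) 0 + (\<dots>) = ?z * ?S m k - 2 * of_nat m * ?S (m - 1) k"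
      unfolding 1 2[symmetric] sum.atMost_Suc_shift[of _ k] by simp
    finally show ?thesis .
  qed
  moreover have "2 * z * (A * X) - 2 * w * (A * Y) = A * (2 * z * X - 2 * w * Y)" for z w A X Y :: complex
    by (simp add: algebra_simps)
  ultimately show ?case
    unfolding fock_overlap_Suc_right Suc.IH by (simp only:)
qed

lemma gauss_fock_overlap:
  "exp (2 * \<i> * complex_of_real p * complex_of_real y) * (fock m (q - y) * cnj (fock k (q + y))) =
     complex_of_real (exp (- q\<^sup>2) / (fock_norm m * fock_norm k)) * (gauss (2 * p) 1 y *
       poly (pcompose (hermite_poly m) [:complex_of_real q, -1:] * pcompose (hermite_poly k) [:complex_of_real q, 1:]) (complex_of_real y))"
proof -
  have "poly (hermite_poly m) (complex_of_real q - complex_of_real y) = complex_of_real (hermite m (q - y))"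
    "poly (hermite_poly k) (complex_of_real q + complex_of_real y) = complex_of_real (hermite k (q + y))"
    by (simp_all flip: poly_hermite_poly)
  moreover have "exp (- (q - y)\<^sup>2 / 2) * exp (- (q + y)\<^sup>2 / 2) = exp (- q\<^sup>2) * exp (- 1 * y\<^sup>2)"
  proof -
    have "- (q - y)\<^sup>2 / 2 + - (q + y)\<^sup>2 / 2 = - q\<^sup>2 + - 1 * y\<^sup>2"
      by (simp add: power2_sum power2_diff field_simps)
    then show ?thesis by (simp only: flip: exp_add)
  qed
  then have "complex_of_real (exp (- (q - y)\<^sup>2 / 2)) * complex_of_real (exp (- (q + y)\<^sup>2 / 2)) =
     complex_of_real (exp (- q\<^sup>2)) * complex_of_real (exp (- 1 * y\<^sup>2))"
    by (simp only: flip: of_real_mult)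
  ultimately show ?thesis
    by (simp add: poly_pcompose cnj_fock fock_eq gauss_def mult_ac)
qed

lemma integrable_wigner_fock:
  "integrable lborel (\<lambda>y. exp (2 * \<i> * complex_of_real p * complex_of_real y) * (fock m (q - y) * cnj (fock k (q + y))))"
  unfolding gauss_fock_overlap by (intro integrable_mult_right integrable_gauss_poly) simp

lemma wigner_fock_overlap:
  "wigner (\<lambda>x y. fock m x * cnj (fock k y)) (q, p) =
     complex_of_real (exp (- q\<^sup>2) / (pi * fock_norm m * fock_norm k)) * fock_overlap q p m k"
  unfolding wigner_def prod.case gauss_fock_overlap fock_overlap_def gauss_int_def by simp

section \<open>Closed forms of the Wigner functions\<close>

lemma beta_coeff_eq: "beta_coeff k = sqrt (2 ^ k / fact k)"
proof -
  have "2 powr (real k / 2) = sqrt (2 ^ k)"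
    by (simp add: powr_half_sqrt[symmetric] powr_powr powr_realpow[symmetric] del: powr_realpow)
  then show ?thesis by (simp add: beta_coeff_def real_sqrt_divide)
qed

text \<open>The origin of \<open>beta_coeff\<close>: \<open>2 ^ k\<close> comes from (2 z)^k in the
  overlap with the vacuum, \<open>sqrt pi\<close> from the Gaussian integral, and the denominator
  from the normalization of the two Fock states.\<close>

lemma beta_fock_norm: "2 ^ k * sqrt pi / (fock_norm 0 * fock_norm k) = beta_coeff k"
proof -
  have "fock_norm 0 * fock_norm k = sqrt (2 ^ k * fact k) * sqrt pi"
    by (simp add: fock_norm_def real_sqrt_mult)
  moreover have "2 ^ k / sqrt (2 ^ k) = sqrt (2 ^ k :: real)" by (rule real_div_sqrt) simp
  then have "2 ^ k / sqrt (2 ^ k) / sqrt (fact k) = beta_coeff k"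
    by (simp add: beta_coeff_eq real_sqrt_divide)
  ultimately show ?thesis
    by (simp add: real_sqrt_mult)
qed

lemma wigner_fock_0_k:
  "wigner (\<lambda>x y. fock 0 x * cnj (fock k y)) (q, p) =
     complex_of_real (exp (- (q\<^sup>2 + p\<^sup>2)) / pi * beta_coeff k) * Complex q p ^ k" (is ?A)
and wigner_fock_k_0:
  "wigner (\<lambda>x y. fock k x * cnj (fock 0 y)) (q, p) =
     complex_of_real (exp (- (q\<^sup>2 + p\<^sup>2)) / pi * beta_coeff k) * cnj (Complex q p) ^ k" (is ?B)
proof -
  have e: "exp (- (q\<^sup>2 + p\<^sup>2)) = exp (- q\<^sup>2) * exp (- p\<^sup>2)" by (simp flip: exp_add)
  have c: "exp (- (q\<^sup>2 + p\<^sup>2)) / pi * beta_coeff k =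
     exp (- q\<^sup>2) / (pi * fock_norm 0 * fock_norm k) * (sqrt pi * exp (- p\<^sup>2)) * 2 ^ k"
    unfolding beta_fock_norm[symmetric] e by (simp add: mult_ac)
  show ?A ?B
    unfolding wigner_fock_overlap c fock_overlap_right_0[of q p k] fock_overlap_left_0[of q p k] fock_overlap_0_0
    by (simp_all add: power_mult_distrib mult_ac)
qed

lemma complex_mult_cnj_Complex: "Complex q p * cnj (Complex q p) = complex_of_real (q\<^sup>2 + p\<^sup>2)"
  by (simp add: complex_mult_cnj)

lemma wigner_fock:
  "wigner (projector (fock k)) (q, p) = complex_of_real (exp (- (q\<^sup>2 + p\<^sup>2)) / pi * poly_P k (q\<^sup>2 + p\<^sup>2))"
proof -
  define x where "x = q\<^sup>2 + p\<^sup>2"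
  let ?z = "Complex q p"
  have e: "exp (- x) = exp (- q\<^sup>2) * exp (- p\<^sup>2)" by (simp add: x_def flip: exp_add)
  have zz: "(2 * ?z) ^ i * (2 * cnj ?z) ^ i = complex_of_real ((4 * x) ^ i)" for i
  proof -
    have "(2 * ?z) * (2 * cnj ?z) = 4 * (?z * cnj ?z)" by simp
    also have "\<dots> = complex_of_real (4 * x)" unfolding complex_mult_cnj_Complex x_def by simp
    finally have "(2 * ?z) * (2 * cnj ?z) = complex_of_real (4 * x)" .
    then show ?thesis by (metis of_real_power power_mult_distrib)
  qed
  have "(\<Sum>j\<le>k. (-2) ^ j * fact j * of_nat (k choose j) * of_nat (k choose j) * (2 * ?z) ^ (k - j) * (2 * cnj ?z) ^ (k - j))
     = (\<Sum>j\<le>k. complex_of_real ((-2) ^ j * fact j * real (k choose j) * real (k choose j) * (4 * x) ^ (k - j)))"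
    by (rule sum.cong[OF refl], simp only: mult.assoc zz) simp
  \<comment> \<open>Reversing the order of summation makes the exponent of 4 x the index, as in the
    Laguerre polynomial.\<close>
  also have "\<dots> = (\<Sum>i\<le>k. complex_of_real ((-2) ^ (k - i) * fact (k - i) * real (k choose i) * real (k choose i) * (4 * x) ^ i))"
    by (rule sum.reindex_bij_witness[of _ "\<lambda>i. k - i" "\<lambda>i. k - i"])
       (auto simp: binomial_symmetric[symmetric])
  also have "\<dots> = complex_of_real (2 ^ k * fact k * poly_P k x)"
    unfolding poly_P_def laguerre_def of_real_sum[symmetric] of_real_eq_iff sum_distrib_left
  proof (rule sum.cong[OF refl])
    fix i assume "i \<in> {..k}"
    then have i: "i \<le> k" by simp
    have f: "fact (k - i) * real (k choose i) = fact k / fact i"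
      using binomial_fact[OF i, where ?'a=real] by (simp add: field_simps)
    have "(-2::real) ^ (k - i) = (-1) ^ (k - i) * 2 ^ (k - i)"
      using power_mult_distrib[of "-1::real" 2 "k - i"] by simp
    moreover have "(-1::real) ^ (k - i) = (-1) ^ k * (-1) ^ i"
      using i by (simp add: minus_one_power_iff)
    ultimately have "(-2::real) ^ (k - i) = (-1) ^ k * (-1) ^ i * 2 ^ (k - i)" by simp
    moreover have "(4 * x) ^ i = 2 ^ i * (2 * x) ^ i"
      using power_mult_distrib[of 2 "2 * x" i] by simp
    ultimately have "(-2) ^ (k - i) * fact (k - i) * real (k choose i) * real (k choose i) * (4 * x) ^ i =
      (2 ^ (k - i) * 2 ^ i) * ((-1) ^ k * (-1) ^ i * (fact (k - i) * real (k choose i)) * real (k choose i) * (2 * x) ^ i)"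
      by (simp only: mult_ac)
    also have "(2::real) ^ (k - i) * 2 ^ i = 2 ^ k"
      using i by (metis power_add le_add_diff_inverse2)
    also have "2 ^ k * ((-1) ^ k * (-1) ^ i * (fact (k - i) * real (k choose i)) * real (k choose i) * (2 * x) ^ i) =
      2 ^ k * fact k * ((-1) ^ k * (real (k choose i) * (-1) ^ i / fact i * (2 * x) ^ i))"
      unfolding f by simp
    finally show "(-2) ^ (k - i) * fact (k - i) * real (k choose i) * real (k choose i) * (4 * x) ^ i =
      2 ^ k * fact k * ((-1) ^ k * (real (k choose i) * (-1) ^ i / fact i * (2 * x) ^ i))" .
  qed
  finally have s: "(\<Sum>j\<le>k. (-2) ^ j * fact j * of_nat (k choose j) * of_nat (k choose j) * (2 * ?z) ^ (k - j) * (2 * cnj ?z) ^ (k - j))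
     = complex_of_real (2 ^ k * fact k * poly_P k x)" .
  have "wigner (projector (fock k)) (q, p) =
     complex_of_real (exp (- q\<^sup>2) / (pi * fock_norm k * fock_norm k)) * (complex_of_real (sqrt pi * exp (- p\<^sup>2)) *
       complex_of_real (2 ^ k * fact k * poly_P k x))"
    unfolding projector_def wigner_fock_overlap fock_overlap_eq[of q p k k] s fock_overlap_0_0 ..
  also have "\<dots> = complex_of_real (exp (- q\<^sup>2) / (pi * (fock_norm k * fock_norm k)) * ((sqrt pi * exp (- p\<^sup>2)) *
       (2 ^ k * fact k * poly_P k x)))" by (simp add: mult_ac)
  also have "\<dots> = complex_of_real (exp (- x) / pi * poly_P k x)"
    unfolding fock_norm_sq e by simp
  finally show ?thesis unfolding x_def .
qed

section \<open>Orthonormal expansions\<close>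

definition norm_sq :: "(real \<Rightarrow> complex) \<Rightarrow> real" where
  "norm_sq f = (LINT x|lborel. (cmod (f x))\<^sup>2)"

lemma norm_sq_nonneg [simp]: "norm_sq f \<ge> 0"
  by (simp add: norm_sq_def)

lemma l2norm_eq: "l2norm f = sqrt (norm_sq f)"
  by (simp add: l2norm_def norm_sq_def)

lemma L2_measurable: "f \<in> L2 \<Longrightarrow> f \<in> borel_measurable borel"
  and L2_integrable: "f \<in> L2 \<Longrightarrow> integrable lborel (\<lambda>x. (cmod (f x))\<^sup>2)"
  by (auto simp: L2_def)

lemma mult_le_half_sum_squares: "a * b \<le> (a\<^sup>2 + b\<^sup>2) / (2::real)"
  using sum_squares_bound[of a b] by simp

lemma measurable_cnj [measurable]: "cnj \<in> borel_measurable borel"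
  by (intro borel_measurable_continuous_onI continuous_intros)

lemma integrable_cinner:
  assumes "f \<in> L2" "g \<in> L2"
  shows "integrable lborel (\<lambda>x. cnj (f x) * g x)"
proof (rule Bochner_Integration.integrable_bound)
  show "integrable lborel (\<lambda>x. ((cmod (f x))\<^sup>2 + (cmod (g x))\<^sup>2) / 2)"
    using assms by (intro integrable_divide Bochner_Integration.integrable_add L2_integrable)
  have [measurable]: "f \<in> borel_measurable borel" "g \<in> borel_measurable borel"
    using assms[THEN L2_measurable] by auto
  show "(\<lambda>x. cnj (f x) * g x) \<in> borel_measurable lborel"
    by measurable
  show "AE x in lborel. norm (cnj (f x) * g x) \<le> norm (((cmod (f x))\<^sup>2 + (cmod (g x))\<^sup>2) / 2)"
    using mult_le_half_sum_squares[of "cmod (f x)" "cmod (g x)" for x] by (simp add: norm_mult)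
qed

lemma integral_norm_cinner_le:
  assumes "f \<in> L2" "g \<in> L2"
  shows "(LINT x|lborel. cmod (f x) * cmod (g x)) \<le> (norm_sq f + norm_sq g) / 2"
proof -
  have "(LINT x|lborel. cmod (f x) * cmod (g x)) \<le> (LINT x|lborel. ((cmod (f x))\<^sup>2 + (cmod (g x))\<^sup>2) / 2)"
  proof (rule integral_mono)
    show "integrable lborel (\<lambda>x. cmod (f x) * cmod (g x))"
      using integrable_norm[OF integrable_cinner[OF assms]] by (simp add: norm_mult)
    show "integrable lborel (\<lambda>x. ((cmod (f x))\<^sup>2 + (cmod (g x))\<^sup>2) / 2)"
      using assms by (intro integrable_divide Bochner_Integration.integrable_add L2_integrable)
  qed (rule mult_le_half_sum_squares)
  also have "\<dots> = (norm_sq f + norm_sq g) / 2"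
    using assms by (simp add: norm_sq_def L2_integrable)
  finally show ?thesis .
qed

lemma cnj_cinner: "cnj (cinner f g) = cinner g f"
  using Bochner_Integration.integral_cnj[of lborel "\<lambda>x. cnj (f x) * g x"] unfolding cinner_def by (simp add: mult.commute)

lemma cinner_same: "cinner f f = complex_of_real (norm_sq f)"
proof -
  have "cnj (f x) * f x = complex_of_real ((cmod (f x))\<^sup>2)" for x
    by (simp add: complex_norm_square mult.commute del: of_real_power)
  then show ?thesis unfolding cinner_def norm_sq_def by (simp only: integral_complex_of_real)
qed

lemma L2_cmult: "f \<in> L2 \<Longrightarrow> (\<lambda>x. c * f x) \<in> L2"
  by (auto simp: L2_def norm_mult power_mult_distrib)

lemma L2_add:
  assumes "f \<in> L2" "g \<in> L2"
  shows "(\<lambda>x. f x + g x) \<in> L2"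
proof -
  have [measurable]: "f \<in> borel_measurable borel" "g \<in> borel_measurable borel"
    using assms by (auto simp: L2_def)
  have "integrable lborel (\<lambda>x. (cmod (f x + g x))\<^sup>2)"
  proof (rule Bochner_Integration.integrable_bound)
    show "integrable lborel (\<lambda>x. 2 * (cmod (f x))\<^sup>2 + 2 * (cmod (g x))\<^sup>2)"
      using assms by (intro integrable_mult_right Bochner_Integration.integrable_add L2_integrable)
    have "(cmod (u + v))\<^sup>2 \<le> 2 * (cmod u)\<^sup>2 + 2 * (cmod v)\<^sup>2" for u v
    proof -
      have "(cmod (u + v))\<^sup>2 \<le> (cmod u + cmod v)\<^sup>2"
        by (intro power_mono norm_triangle_ineq) auto
      also have "\<dots> \<le> 2 * (cmod u)\<^sup>2 + 2 * (cmod v)\<^sup>2"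
        using mult_le_half_sum_squares[of "cmod u" "cmod v"] by (simp add: power2_sum field_simps)
      finally show ?thesis .
    qed
    then show "AE x in lborel. norm ((cmod (f x + g x))\<^sup>2) \<le> norm (2 * (cmod (f x))\<^sup>2 + 2 * (cmod (g x))\<^sup>2)"
      by simp
  qed measurable
  then show ?thesis by (simp add: L2_def)
qed

lemma L2_diff: "f \<in> L2 \<Longrightarrow> g \<in> L2 \<Longrightarrow> (\<lambda>x. f x - g x) \<in> L2"
  using L2_add[of f "\<lambda>x. (-1) * g x"] L2_cmult[of g "-1"] by simp

lemma L2_sum: "(\<And>k. k < N \<Longrightarrow> e k \<in> L2) \<Longrightarrow> (\<lambda>x. \<Sum>k<(N::nat). c k * e k x) \<in> L2"
proof (induction N)
  case 0
  then show ?case by (simp add: L2_def)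
next
  case (Suc N)
  then show ?case by (auto intro!: L2_add L2_cmult)
qed

lemma cinner_diff_right:
  assumes "h \<in> L2" "f \<in> L2" "g \<in> L2"
  shows "cinner h (\<lambda>x. f x - g x) = cinner h f - cinner h g"
  unfolding cinner_def using assms by (simp add: right_diff_distrib integrable_cinner)

lemma cinner_add_right:
  assumes "h \<in> L2" "f \<in> L2" "g \<in> L2"
  shows "cinner h (\<lambda>x. f x + g x) = cinner h f + cinner h g"
  unfolding cinner_def using assms by (simp add: distrib_left integrable_cinner)

lemma cinner_cmult_right: "cinner h (\<lambda>x. c * f x) = c * cinner h f"
  unfolding cinner_def by (simp add: mult.left_commute[of _ c])

lemma cinner_sum_right:
  assumes "h \<in> L2" "\<And>k. k < N \<Longrightarrow> e k \<in> L2"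
  shows "cinner h (\<lambda>x. \<Sum>k<(N::nat). c k * e k x) = (\<Sum>k<N. c k * cinner h (e k))"
  using assms
proof (induction N)
  case 0
  then show ?case by (simp add: cinner_def)
next
  case (Suc N)
  then show ?case by (simp add: cinner_add_right L2_sum L2_cmult cinner_cmult_right)
qed

lemma cmod_diff_sq: "(cmod (x - y))\<^sup>2 = (cmod x)\<^sup>2 + (cmod y)\<^sup>2 - 2 * Re (cnj y * x)"
  unfolding cmod_power2 by (simp add: power2_eq_square algebra_simps)

text \<open>Expansion of the square, completed in c. With c equal to the coefficient it gives
  Bessel's inequality; with f orthogonal to e it is Pythagoras.\<close>

lemma norm_sq_diff_unit:
  assumes "f \<in> L2" "e \<in> L2" "norm_sq e = 1"
  shows "norm_sq (\<lambda>x. f x - c * e x) = norm_sq f - (cmod (cinner e f))\<^sup>2 + (cmod (c - cinner e f))\<^sup>2"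
proof -
  have "norm_sq (\<lambda>x. f x - c * e x) =
     (LINT x|lborel. (cmod (f x))\<^sup>2 + (cmod c)\<^sup>2 * (cmod (e x))\<^sup>2 - 2 * Re (cnj c * (cnj (e x) * f x)))"
    unfolding norm_sq_def cmod_diff_sq by (simp add: norm_mult power_mult_distrib mult.assoc)
  also have "\<dots> = norm_sq f + (cmod c)\<^sup>2 - 2 * Re (cnj c * cinner e f)"
  proof -
    have i1: "integrable lborel (\<lambda>x. (cmod (f x))\<^sup>2)" and i2: "integrable lborel (\<lambda>x. (cmod c)\<^sup>2 * (cmod (e x))\<^sup>2)"
      using assms by (auto intro: L2_integrable)
    have i3: "integrable lborel (\<lambda>x. cnj c * (cnj (e x) * f x))"
      using assms by (intro integrable_mult_right integrable_cinner)
    have "(LINT x|lborel. 2 * Re (cnj c * (cnj (e x) * f x))) = 2 * Re (cnj c * cinner e f)"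
      using integral_Re[OF i3] unfolding cinner_def integral_mult_right_zero by (simp only:)
    moreover have "(LINT x|lborel. (cmod c)\<^sup>2 * (cmod (e x))\<^sup>2) = (cmod c)\<^sup>2"
      using assms(3) by (simp add: norm_sq_def)
    moreover have "(LINT x|lborel. (cmod (f x))\<^sup>2 + (cmod c)\<^sup>2 * (cmod (e x))\<^sup>2 - 2 * Re (cnj c * (cnj (e x) * f x))) =
      norm_sq f + (LINT x|lborel. (cmod c)\<^sup>2 * (cmod (e x))\<^sup>2) - (LINT x|lborel. 2 * Re (cnj c * (cnj (e x) * f x)))"
      unfolding norm_sq_def
      by (subst Bochner_Integration.integral_diff[OF Bochner_Integration.integrable_add[OF i1 i2] integrable_mult_right[OF integrable_Re[OF i3]]],
          subst Bochner_Integration.integral_add[OF i1 i2]) (rule refl)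
    ultimately show ?thesis by (simp only:)
  qed
  also have "\<dots> = norm_sq f - (cmod (cinner e f))\<^sup>2 + (cmod (cinner e f - c))\<^sup>2"
    unfolding cmod_diff_sq by simp
  finally show ?thesis by (simp add: norm_minus_commute)
qed

lemma bessel_unit:
  assumes "f \<in> L2" "e \<in> L2" "norm_sq e = 1"
  shows "(cmod (cinner e f))\<^sup>2 \<le> norm_sq f"
  using norm_sq_diff_unit[OF assms, of "cinner e f"] norm_sq_nonneg[of "\<lambda>x. f x - cinner e f * e x"] by simp

text \<open>Basis vectors are removed one at a time, each by the single-vector case. Arbitrary c
  serves both halves of Parseval's identity: the true coefficients bound the partial sums from
  above, and an approximating combination gives the converse, since the last sum is
  nonnegative.\<close>

lemma norm_sq_diff_orthonormal:
  assumes "f \<in> L2" "\<And>k. e k \<in> L2" "\<And>j k. cinner (e j) (e k) = (if j = k then 1 else 0)"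
  shows "norm_sq (\<lambda>x. f x - (\<Sum>k<(N::nat). c k * e k x)) =
     norm_sq f - (\<Sum>k<N. (cmod (cinner (e k) f))\<^sup>2) + (\<Sum>k<N. (cmod (c k - cinner (e k) f))\<^sup>2)"
proof (induction N)
  case (Suc N)
  have n: "norm_sq (e N) = 1" using assms(3)[of N N] by (simp add: cinner_same)
  have c: "cinner (e N) (\<lambda>x. f x - (\<Sum>k<N. c k * e k x)) = cinner (e N) f"
    using assms by (simp add: cinner_diff_right L2_sum cinner_sum_right)
  have "norm_sq (\<lambda>x. f x - (\<Sum>k<Suc N. c k * e k x)) = norm_sq (\<lambda>x. (f x - (\<Sum>k<N. c k * e k x)) - c N * e N x)"
    by (simp add: algebra_simps)
  also have "\<dots> = norm_sq (\<lambda>x. f x - (\<Sum>k<N. c k * e k x)) - (cmod (cinner (e N) f))\<^sup>2 + (cmod (c N - cinner (e N) f))\<^sup>2"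
    using assms n by (subst norm_sq_diff_unit) (auto intro!: L2_diff L2_sum simp: c)
  finally show ?case using Suc by simp
qed simp

lemma parseval:
  assumes "orthonormal_basis e" "f \<in> L2"
  shows "(\<lambda>k. (cmod (cinner (e k) f))\<^sup>2) sums norm_sq f"
proof -
  have e: "\<And>k. e k \<in> L2" "\<And>j k. cinner (e j) (e k) = (if j = k then 1 else 0)"
    using assms by (auto simp: orthonormal_basis_def)
  let ?a = "\<lambda>k. (cmod (cinner (e k) f))\<^sup>2"
  note ex = norm_sq_diff_orthonormal[OF assms(2) e]
  have le: "(\<Sum>k<N. ?a k) \<le> norm_sq f" for N
    using ex[where N = N and c = "\<lambda>k. cinner (e k) f"] norm_sq_nonneg[of "\<lambda>x. f x - (\<Sum>k<N. cinner (e k) f * e k x)"] by simp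
  have sm: "summable ?a"
    by (rule summableI_nonneg_bounded[of _ "norm_sq f"]) (use le in auto)
  have "suminf ?a \<le> norm_sq f"
    using sm le by (rule suminf_le_const)
  moreover have "norm_sq f \<le> suminf ?a + d" if d: "d > 0" for d
  proof -
    obtain N c where N: "l2norm (\<lambda>x. f x - (\<Sum>k<N. c k * e k x)) < sqrt d"
    proof -
      have "sqrt d > 0" using d by simp
      then show thesis using assms that unfolding orthonormal_basis_def by blast
    qed
    then have "norm_sq (\<lambda>x. f x - (\<Sum>k<N. c k * e k x)) < d"
      by (simp add: l2norm_eq)
    moreover have "(\<Sum>k<N. (cmod (c k - cinner (e k) f))\<^sup>2) \<ge> 0" by (intro sum_nonneg) auto
    ultimately have "norm_sq f \<le> (\<Sum>k<N. ?a k) + d"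
      using ex[where N = N and c = c] by linarith
    moreover have "(\<Sum>k<N. ?a k) \<le> suminf ?a"
      using sm by (intro sum_le_suminf) auto
    ultimately show ?thesis by linarith
  qed
  then have "norm_sq f \<le> suminf ?a" by (rule field_le_epsilon)
  ultimately show ?thesis using sm by (simp add: sums_iff)
qed

section \<open>Mixtures of pure states\<close>

lemma sums_nonneg:
  fixes f :: "nat \<Rightarrow> real"
  assumes "f sums s" "\<And>j. f j \<ge> 0"
  shows "s \<ge> 0"
  using assms suminf_nonneg[of f] by (auto simp: sums_iff)

text \<open>Countable ensembles of unit vectors cover both the thermal state and the family.
  \<open>pointwise\<close> is imposed because a kernel must make sense at every pair of points,
  whereas summable weights alone give convergence only almost everywhere.\<close>

locale mixture =
  fixes \<phi> :: "nat \<Rightarrow> real \<Rightarrow> complex" and \<mu> :: "nat \<Rightarrow> real"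
  assumes L2: "\<And>j. \<phi> j \<in> L2"
    and unit: "\<And>j. norm_sq (\<phi> j) = 1"
    and nonneg: "\<And>j. \<mu> j \<ge> 0"
    and total: "\<mu> sums 1"
    and pointwise: "\<And>x. summable (\<lambda>j. \<mu> j * (cmod (\<phi> j x))\<^sup>2)"
begin

definition kernel :: op_kernel where
  "kernel x y = (\<Sum>j. complex_of_real (\<mu> j) * projector (\<phi> j) x y)"

lemma summable_weights: "summable \<mu>"
  using total by (rule sums_summable)

lemma measurable_state [measurable]: "\<phi> j \<in> borel_measurable borel"
  using L2 by (rule L2_measurable)

lemma summable_abs: "summable (\<lambda>j. \<mu> j * cmod (\<phi> j x))"
proof (rule summable_comparison_test')
  show "summable (\<lambda>j. (\<mu> j + \<mu> j * (cmod (\<phi> j x))\<^sup>2) / 2)"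
    by (intro summable_divide summable_add summable_weights pointwise)
  show "norm (\<mu> j * cmod (\<phi> j x)) \<le> (\<mu> j + \<mu> j * (cmod (\<phi> j x))\<^sup>2) / 2" for j
    using mult_left_mono[OF mult_le_half_sum_squares[of 1 "cmod (\<phi> j x)"] nonneg[of j]] nonneg[of j]
    by (simp add: field_simps)
qed

lemma summable_abs_mult: "summable (\<lambda>j. \<mu> j * (cmod (\<phi> j x) * cmod (\<phi> j y)))"
proof (rule summable_comparison_test')
  show "summable (\<lambda>j. (\<mu> j * (cmod (\<phi> j x))\<^sup>2 + \<mu> j * (cmod (\<phi> j y))\<^sup>2) / 2)"
    by (intro summable_divide summable_add summable_weights pointwise)
  show "norm (\<mu> j * (cmod (\<phi> j x) * cmod (\<phi> j y))) \<le> (\<mu> j * (cmod (\<phi> j x))\<^sup>2 + \<mu> j * (cmod (\<phi> j y))\<^sup>2) / 2" for j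
    using mult_left_mono[OF mult_le_half_sum_squares[of "cmod (\<phi> j x)" "cmod (\<phi> j y)"] nonneg[of j]] nonneg[of j]
    by (simp add: field_simps abs_mult)
qed

lemma summable_weighted:
  assumes "\<And>j. cmod (c j) \<le> B"
  shows "summable (\<lambda>j. cmod (complex_of_real (\<mu> j) * c j * \<phi> j x))"
proof (rule summable_comparison_test')
  show "summable (\<lambda>j. B * (\<mu> j * cmod (\<phi> j x)))"
    by (intro summable_mult summable_abs)
  show "norm (cmod (complex_of_real (\<mu> j) * c j * \<phi> j x)) \<le> B * (\<mu> j * cmod (\<phi> j x))" for j
    using mult_right_mono[OF assms[of j], of "\<mu> j * cmod (\<phi> j x)"] nonneg[of j]
    by (simp add: norm_mult mult_ac)
qed

lemma cmod_coeff: "f \<in> L2 \<Longrightarrow> cmod (cinner (\<phi> j) f) \<le> sqrt (norm_sq f)"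
  using bessel_unit[OF _ L2 unit, of f j] by (simp add: real_le_rsqrt)

text \<open>Passes from the kernel to a series of rank-one operators. Integral and series may be
  exchanged because the integrals of |\<phi> j| |f| are bounded uniformly in j by (1 +
  \<open>norm_sq f\<close>) / 2.\<close>

lemma operator_eq:
  assumes f: "f \<in> L2"
  shows "integral_operator kernel f x = (\<Sum>j. complex_of_real (\<mu> j) * cinner (\<phi> j) f * \<phi> j x)"
proof -
  have [measurable]: "f \<in> borel_measurable borel" using f by (rule L2_measurable)
  let ?g = "\<lambda>j y. complex_of_real (\<mu> j) * \<phi> j x * (cnj (\<phi> j y) * f y)"
  have "(LINT y|lborel. (\<Sum>j. ?g j y)) = (\<Sum>j. LINT y|lborel. ?g j y)"
  proof (rule integral_suminf)
    show "integrable lborel (?g j)" for j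
      by (intro integrable_mult_right integrable_cinner L2 f)
    have "summable (\<lambda>j. cmod (f y) * (\<mu> j * (cmod (\<phi> j x) * cmod (\<phi> j y))))" for y
      by (intro summable_mult summable_abs_mult)
    then show "AE y in lborel. summable (\<lambda>j. norm (?g j y))"
      using nonneg by (simp add: norm_mult mult_ac)
    show "summable (\<lambda>j. LINT y|lborel. norm (?g j y))"
    proof (rule summable_comparison_test')
      show "summable (\<lambda>j. (1 + norm_sq f) / 2 * (\<mu> j * cmod (\<phi> j x)))"
        by (intro summable_mult summable_abs)
      fix j
      have "(LINT y|lborel. norm (?g j y)) = \<mu> j * cmod (\<phi> j x) * (LINT y|lborel. cmod (\<phi> j y) * cmod (f y))"
        using nonneg by (simp add: norm_mult mult.assoc)
      also have "\<dots> \<le> \<mu> j * cmod (\<phi> j x) * ((1 + norm_sq f) / 2)"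
        using integral_norm_cinner_le[OF L2 f, of j] nonneg unit by (intro mult_left_mono) auto
      finally show "norm (LINT y|lborel. norm (?g j y)) \<le> (1 + norm_sq f) / 2 * (\<mu> j * cmod (\<phi> j x))"
        by (simp add: mult_ac integral_nonneg_AE)
    qed
  qed
  also have "(\<lambda>y. \<Sum>j. ?g j y) = (\<lambda>y. kernel x y * f y)"
  proof
    fix y
    have "summable (\<lambda>j. complex_of_real (\<mu> j) * projector (\<phi> j) x y)"
      using summable_abs_mult[of x y] nonneg
      by (intro summable_norm_cancel[of "\<lambda>j. complex_of_real (\<mu> j) * projector (\<phi> j) x y"]) (simp add: norm_mult projector_def)
    from suminf_mult2[OF this, of "f y"] show "(\<Sum>j. ?g j y) = kernel x y * f y"
      by (simp add: kernel_def projector_def mult_ac)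
  qed
  finally have "integral_operator kernel f x = (\<Sum>j. LINT y|lborel. ?g j y)"
    unfolding integral_operator_def .
  also have "(\<lambda>j. LINT y|lborel. ?g j y) = (\<lambda>j. complex_of_real (\<mu> j) * cinner (\<phi> j) f * \<phi> j x)"
    unfolding cinner_def integral_mult_right_zero by (simp only: mult_ac)
  finally show ?thesis .
qed

lemma integral_weighted_density:
  "integrable lborel (\<lambda>x. \<Sum>j. \<mu> j * (cmod (\<phi> j x))\<^sup>2)"
  "(LINT x|lborel. (\<Sum>j. \<mu> j * (cmod (\<phi> j x))\<^sup>2)) = 1"
proof -
  have i: "integrable lborel (\<lambda>x. \<mu> j * (cmod (\<phi> j x))\<^sup>2)" for j
    by (intro integrable_mult_right L2_integrable L2)
  have s: "AE x in lborel. summable (\<lambda>j. norm (\<mu> j * (cmod (\<phi> j x))\<^sup>2))"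
    using pointwise nonneg by (simp add: abs_mult)
  have u: "(LINT x|lborel. (cmod (\<phi> j x))\<^sup>2) = 1" for j
    using unit[of j] by (simp add: norm_sq_def)
  then have n: "(LINT x|lborel. \<mu> j * (cmod (\<phi> j x))\<^sup>2) = \<mu> j" for j
    by simp
  have t: "summable (\<lambda>j. LINT x|lborel. norm (\<mu> j * (cmod (\<phi> j x))\<^sup>2))"
    using nonneg summable_weights by (simp add: abs_mult u)
  show "integrable lborel (\<lambda>x. \<Sum>j. \<mu> j * (cmod (\<phi> j x))\<^sup>2)"
    by (rule integrable_suminf[OF i s t])
  show "(LINT x|lborel. (\<Sum>j. \<mu> j * (cmod (\<phi> j x))\<^sup>2)) = 1"
    using integral_suminf[OF i s t] total unfolding n by (simp add: sums_iff)
qed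

text \<open>The weights form a probability distribution, and the variance of |\<phi> j x| under it
  is nonnegative; \<open>m\<close> is its mean.\<close>

lemma weighted_sum_square_le: "(\<Sum>j. \<mu> j * cmod (\<phi> j x))\<^sup>2 \<le> (\<Sum>j. \<mu> j * (cmod (\<phi> j x))\<^sup>2)"
proof -
  define m where "m = (\<Sum>j. \<mu> j * cmod (\<phi> j x))"
  have "(\<lambda>j. \<mu> j * cmod (\<phi> j x)) sums m"
    unfolding m_def by (rule summable_sums[OF summable_abs])
  from sums_add[OF sums_diff[OF summable_sums[OF pointwise[of x]] sums_mult[OF this, of "2 * m"]] sums_mult[OF total, of "m\<^sup>2"]]
  have "(\<lambda>j. \<mu> j * (cmod (\<phi> j x))\<^sup>2 - 2 * m * (\<mu> j * cmod (\<phi> j x)) + m\<^sup>2 * \<mu> j) sums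
     ((\<Sum>j. \<mu> j * (cmod (\<phi> j x))\<^sup>2) - 2 * m * m + m\<^sup>2 * 1)" .
  moreover have "\<mu> j * (cmod (\<phi> j x))\<^sup>2 - 2 * m * (\<mu> j * cmod (\<phi> j x)) + m\<^sup>2 * \<mu> j = \<mu> j * (cmod (\<phi> j x) - m)\<^sup>2" for j
    by (simp add: power2_eq_square algebra_simps)
  ultimately have "(\<lambda>j. \<mu> j * (cmod (\<phi> j x) - m)\<^sup>2) sums ((\<Sum>j. \<mu> j * (cmod (\<phi> j x))\<^sup>2) - 2 * m * m + m\<^sup>2 * 1)"
    by (simp only:)
  then have "0 \<le> (\<Sum>j. \<mu> j * (cmod (\<phi> j x))\<^sup>2) - 2 * m * m + m\<^sup>2 * 1"
    by (rule sums_nonneg) (simp add: nonneg)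
  then show ?thesis unfolding m_def[symmetric] by (simp add: power2_eq_square)
qed

lemma operator_L2:
  assumes f: "f \<in> L2"
  shows "integral_operator kernel f \<in> L2" and "norm_sq (integral_operator kernel f) \<le> norm_sq f"
proof -
  let ?T = "integral_operator kernel f"
  have T: "?T = (\<lambda>x. \<Sum>j. complex_of_real (\<mu> j) * cinner (\<phi> j) f * \<phi> j x)"
    using operator_eq[OF f] by (simp add: fun_eq_iff)
  have [measurable]: "?T \<in> borel_measurable borel"
    unfolding T by measurable
  let ?S = "\<lambda>x. \<Sum>j. \<mu> j * (cmod (\<phi> j x))\<^sup>2"
  \<comment> \<open>Bessel's inequality bounds every coefficient by the norm of f. What remains is,
    by the variance inequality, at most a density of integral one, so the operator is a
    contraction.\<close>
  have b: "(cmod (?T x))\<^sup>2 \<le> norm_sq f * ?S x" for x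
  proof -
    have "cmod (?T x) \<le> (\<Sum>j. cmod (complex_of_real (\<mu> j) * cinner (\<phi> j) f * \<phi> j x))"
      unfolding T using cmod_coeff[OF f] by (intro summable_norm summable_weighted)
    also have "\<dots> \<le> (\<Sum>j. sqrt (norm_sq f) * (\<mu> j * cmod (\<phi> j x)))"
    proof (rule suminf_le)
      show "cmod (complex_of_real (\<mu> j) * cinner (\<phi> j) f * \<phi> j x) \<le> sqrt (norm_sq f) * (\<mu> j * cmod (\<phi> j x))" for j
        using mult_right_mono[OF cmod_coeff[OF f, of j], of "\<mu> j * cmod (\<phi> j x)"] nonneg[of j]
        by (simp add: norm_mult mult_ac)
    qed (use cmod_coeff[OF f] in \<open>auto intro!: summable_weighted summable_mult summable_abs\<close>)
    also have "\<dots> = sqrt (norm_sq f) * (\<Sum>j. \<mu> j * cmod (\<phi> j x))"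
      by (rule suminf_mult[OF summable_abs])
    finally have "(cmod (?T x))\<^sup>2 \<le> (sqrt (norm_sq f) * (\<Sum>j. \<mu> j * cmod (\<phi> j x)))\<^sup>2"
      by (rule power_mono) simp
    also have "\<dots> = norm_sq f * (\<Sum>j. \<mu> j * cmod (\<phi> j x))\<^sup>2"
      by (simp add: power_mult_distrib)
    also have "\<dots> \<le> norm_sq f * ?S x"
      by (intro mult_left_mono weighted_sum_square_le) simp
    finally show ?thesis .
  qed
  have i: "integrable lborel (\<lambda>x. norm_sq f * ?S x)"
    by (intro integrable_mult_right integral_weighted_density)
  have i2: "integrable lborel (\<lambda>x. (cmod (?T x))\<^sup>2)"
    by (rule Bochner_Integration.integrable_bound[OF i]) (use order_trans[OF b abs_ge_self] in simp_all)
  then show "?T \<in> L2" by (simp add: L2_def)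
  have "norm_sq ?T \<le> (LINT x|lborel. norm_sq f * ?S x)"
    unfolding norm_sq_def[of ?T] by (intro integral_mono i i2 b)
  also have "\<dots> = norm_sq f" by (simp add: integral_weighted_density)
  finally show "norm_sq ?T \<le> norm_sq f" .
qed

lemma operator_linear:
  assumes "f \<in> L2" "g \<in> L2"
  shows "integral_operator kernel (\<lambda>y. a * f y + b * g y) x =
     a * integral_operator kernel f x + b * integral_operator kernel g x"
proof -
  have s: "summable (\<lambda>j. complex_of_real (\<mu> j) * cinner (\<phi> j) h * \<phi> j x)" if "h \<in> L2" for h
    using summable_weighted[OF cmod_coeff[OF that]] by (rule summable_norm_cancel)
  have "(\<lambda>j. complex_of_real (\<mu> j) * cinner (\<phi> j) (\<lambda>y. a * f y + b * g y) * \<phi> j x) =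
      (\<lambda>j. a * (complex_of_real (\<mu> j) * cinner (\<phi> j) f * \<phi> j x) + b * (complex_of_real (\<mu> j) * cinner (\<phi> j) g * \<phi> j x))"
    using assms by (simp add: cinner_add_right L2_cmult L2 cinner_cmult_right algebra_simps)
  then show ?thesis
    using assms by (simp add: operator_eq L2_add L2_cmult suminf_add[symmetric] summable_mult s suminf_mult)
qed

text \<open>The quadratic form as a nonnegative series: this gives positivity at once and supplies
  the double series for the trace.\<close>

lemma cinner_operator:
  assumes f: "f \<in> L2"
  shows "(\<lambda>j. \<mu> j * (cmod (cinner (\<phi> j) f))\<^sup>2) sums Re (cinner f (integral_operator kernel f))"
    and "Im (cinner f (integral_operator kernel f)) = 0"
proof -
  have [measurable]: "f \<in> borel_measurable borel" using f by (rule L2_measurable)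
  let ?g = "\<lambda>j x. complex_of_real (\<mu> j) * cinner (\<phi> j) f * (cnj (f x) * \<phi> j x)"
  have "(\<lambda>j. LINT x|lborel. ?g j x) sums (LINT x|lborel. (\<Sum>j. ?g j x))"
  proof (rule sums_integral)
    show "integrable lborel (?g j)" for j
      by (intro integrable_mult_right integrable_cinner L2 f)
    have "summable (\<lambda>j. cmod (f x) * cmod (complex_of_real (\<mu> j) * cinner (\<phi> j) f * \<phi> j x))" for x
      using cmod_coeff[OF f] by (intro summable_mult summable_weighted)
    then show "AE x in lborel. summable (\<lambda>j. norm (?g j x))"
      by (simp add: norm_mult mult_ac)
    show "summable (\<lambda>j. LINT y|lborel. norm (?g j y))"
    proof (rule summable_comparison_test')
      show "summable (\<lambda>j. sqrt (norm_sq f) * ((norm_sq f + 1) / 2) * \<mu> j)"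
        by (intro summable_mult summable_weights)
      fix j
      have "(LINT y|lborel. norm (?g j y)) = \<mu> j * cmod (cinner (\<phi> j) f) * (LINT y|lborel. cmod (f y) * cmod (\<phi> j y))"
        using nonneg by (simp add: norm_mult mult.assoc)
      also have "\<dots> \<le> \<mu> j * sqrt (norm_sq f) * ((norm_sq f + 1) / 2)"
        using integral_norm_cinner_le[OF f L2, of j] nonneg unit cmod_coeff[OF f] by (intro mult_mono) auto
      finally show "norm (LINT y|lborel. norm (?g j y)) \<le> sqrt (norm_sq f) * ((norm_sq f + 1) / 2) * \<mu> j"
        by (simp add: mult_ac integral_nonneg_AE)
    qed
  qed
  also have "(\<lambda>j. LINT x|lborel. ?g j x) = (\<lambda>j. complex_of_real (\<mu> j * (cmod (cinner (\<phi> j) f))\<^sup>2))"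
  proof
    fix j
    have "(LINT x|lborel. ?g j x) = complex_of_real (\<mu> j) * (cinner (\<phi> j) f * cnj (cinner (\<phi> j) f))"
      unfolding cnj_cinner by (simp add: cinner_def)
    also have "\<dots> = complex_of_real (\<mu> j * (cmod (cinner (\<phi> j) f))\<^sup>2)"
      unfolding of_real_mult complex_norm_square ..
    finally show "(LINT x|lborel. ?g j x) = complex_of_real (\<mu> j * (cmod (cinner (\<phi> j) f))\<^sup>2)" .
  qed
  also have "(\<lambda>x. \<Sum>j. ?g j x) = (\<lambda>x. cnj (f x) * integral_operator kernel f x)"
  proof
    fix x
    have "summable (\<lambda>j. complex_of_real (\<mu> j) * cinner (\<phi> j) f * \<phi> j x)"
      using summable_weighted[OF cmod_coeff[OF f]] by (rule summable_norm_cancel)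
    from suminf_mult[OF this, of "cnj (f x)"]
    show "(\<Sum>j. ?g j x) = cnj (f x) * integral_operator kernel f x"
      unfolding operator_eq[OF f] by (simp add: mult_ac)
  qed
  finally have s: "(\<lambda>j. complex_of_real (\<mu> j * (cmod (cinner (\<phi> j) f))\<^sup>2)) sums cinner f (integral_operator kernel f)"
    unfolding cinner_def .
  show "(\<lambda>j. \<mu> j * (cmod (cinner (\<phi> j) f))\<^sup>2) sums Re (cinner f (integral_operator kernel f))"
    using sums_Re[OF s] by simp
  have "(\<lambda>j. 0) sums Im (cinner f (integral_operator kernel f))"
    using sums_Im[OF s] by simp
  then show "Im (cinner f (integral_operator kernel f)) = 0"
    using sums_unique2[OF sums_zero] by metis
qed

text \<open>Tonelli for the nonnegative array \<open>a\<close>: for fixed k its sum over j is a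
  diagonal element, and for fixed j its sum over k is \<mu> j by Parseval for the given basis. The
  interchange is done in \<open>ennreal\<close>, with a series read as an integral over counting
  measure.\<close>

lemma trace_operator:
  assumes e: "orthonormal_basis e"
  shows "(\<lambda>k. cinner (e k) (integral_operator kernel (e k))) sums 1"
proof -
  have eL: "e k \<in> L2" for k using e by (simp add: orthonormal_basis_def)
  define a where "a j k = \<mu> j * (cmod (cinner (\<phi> j) (e k)))\<^sup>2" for j k
  have a0: "a j k \<ge> 0" for j k unfolding a_def using nonneg by simp
  have row: "(\<lambda>k. a j k) sums \<mu> j" for j
  proof -
    have "cmod (cinner (\<phi> j) (e k)) = cmod (cinner (e k) (\<phi> j))" for k
      by (metis cnj_cinner complex_mod_cnj)
    then show ?thesis
      using sums_mult[OF parseval[OF e L2[of j]], of "\<mu> j"] unit[of j] by (simp add: a_def)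
  qed
  define b where "b k = Re (cinner (e k) (integral_operator kernel (e k)))" for k
  have col: "(\<lambda>j. a j k) sums b k" for k
    unfolding a_def b_def by (rule cinner_operator(1)[OF eL])
  have b0: "b k \<ge> 0" for k
    by (rule sums_nonneg[OF col a0])
  have "(\<Sum>k. ennreal (b k)) = (\<Sum>k. \<Sum>j. ennreal (a j k))"
    using col a0 by (intro suminf_cong) (simp add: suminf_ennreal2 sums_iff)
  also have "\<dots> = (\<Sum>k. \<integral>\<^sup>+j. ennreal (a j k) \<partial>count_space UNIV)"
    by (simp add: nn_integral_count_space_nat)
  also have "\<dots> = (\<integral>\<^sup>+j. (\<Sum>k. ennreal (a j k)) \<partial>count_space UNIV)"
    by (rule nn_integral_suminf[symmetric]) simp
  also have "\<dots> = (\<Sum>j. \<Sum>k. ennreal (a j k))"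
    by (simp add: nn_integral_count_space_nat)
  also have "\<dots> = (\<Sum>j. ennreal (\<mu> j))"
    using row a0 by (intro suminf_cong) (simp add: suminf_ennreal2 sums_iff)
  also have "\<dots> = ennreal 1"
    using total nonneg by (simp add: suminf_ennreal2 sums_iff)
  finally have t: "(\<Sum>k. ennreal (b k)) = ennreal 1" .
  have sb: "summable b"
    using b0 t by (intro summable_suminf_not_top) auto
  have "ennreal (suminf b) = ennreal 1"
    using t suminf_ennreal2[OF b0 sb] by simp
  then have "b sums 1"
    using sb suminf_nonneg[OF sb b0] by (simp add: sums_iff)
  then have "(\<lambda>k. complex_of_real (b k)) sums complex_of_real 1"
    by (rule sums_of_real)
  moreover have "complex_of_real (b k) = cinner (e k) (integral_operator kernel (e k))" for k
    unfolding b_def using cinner_operator(2)[OF eL] by (simp add: complex_eq_iff)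
  ultimately show ?thesis by simp
qed

lemma quantum_state_kernel: "quantum_state kernel"
  unfolding quantum_state_def density_operator_def
proof (intro conjI ballI allI impI)
  show "\<exists>C. \<forall>f\<in>L2. l2norm (integral_operator kernel f) \<le> C * l2norm f"
    using operator_L2 by (intro exI[of _ 1]) (simp add: l2norm_eq)
  show "cinner f (integral_operator kernel f) \<in> \<real>\<^sub>\<ge>\<^sub>0" if f: "f \<in> L2" for f
  proof -
    have "0 \<le> Re (cinner f (integral_operator kernel f))"
      by (rule sums_nonneg[OF cinner_operator(1)[OF f]]) (simp add: nonneg)
    then show ?thesis using cinner_operator(2)[OF f] by (simp add: complex_nonneg_Reals_iff)
  qed
qed (auto simp: operator_L2 operator_linear trace_operator)

lemma wigner_kernel:
  "(\<lambda>j. complex_of_real (\<mu> j) * wigner (projector (\<phi> j)) (q, p)) sums wigner kernel (q, p)"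
proof -
  let ?e = "\<lambda>y. exp (2 * \<i> * complex_of_real p * complex_of_real y)"
  let ?g = "\<lambda>j y. complex_of_real (\<mu> j) * (?e y * projector (\<phi> j) (q - y) (q + y))"
  have ne: "cmod (?e y) = 1" for y by simp
  have sq: "integrable lborel (\<lambda>y. (cmod (\<phi> j (q + s * y)))\<^sup>2)"
       "(LINT y|lborel. (cmod (\<phi> j (q + s * y)))\<^sup>2) = 1" if "s = 1 \<or> s = -1" for j s
  proof -
    have s: "s \<noteq> 0" "\<bar>s\<bar> = 1" using that by auto
    show "integrable lborel (\<lambda>y. (cmod (\<phi> j (q + s * y)))\<^sup>2)"
      by (rule lborel_integrable_real_affine[OF L2_integrable[OF L2] s(1)])
    show "(LINT y|lborel. (cmod (\<phi> j (q + s * y)))\<^sup>2) = 1"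
      using lborel_integral_real_affine[OF s(1), of "\<lambda>x. (cmod (\<phi> j x))\<^sup>2" q] s(2) unit[of j]
      by (simp add: norm_sq_def)
  qed
  \<comment> \<open>The arithmetic mean of the two squares dominates the product in the Wigner
    integral. Shifts and reflection preserve Lebesgue measure, so its integral is 1 for every q and
    j.\<close>
  let ?h = "\<lambda>j y. ((cmod (\<phi> j (q - y)))\<^sup>2 + (cmod (\<phi> j (q + y)))\<^sup>2) / 2"
  have h: "integrable lborel (?h j)" "(LINT y|lborel. ?h j y) = 1" for j
    using sq[of 1 j] sq[of "-1" j] by auto
  have gb: "norm (?g j y) \<le> \<mu> j * ?h j y" for j y
    using mult_left_mono[OF mult_le_half_sum_squares[of "cmod (\<phi> j (q - y))" "cmod (\<phi> j (q + y))"] nonneg[of j]]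
      nonneg[of j] by (simp add: norm_mult projector_def)
  have gi: "integrable lborel (?g j)" for j
  proof (rule Bochner_Integration.integrable_bound)
    show "integrable lborel (\<lambda>y. \<mu> j * ?h j y)" by (intro integrable_mult_right h)
    show "?g j \<in> borel_measurable lborel" unfolding projector_def by measurable
    show "AE y in lborel. norm (?g j y) \<le> norm (\<mu> j * ?h j y)"
      using order_trans[OF gb abs_ge_self] by simp
  qed
  have "(\<lambda>j. LINT y|lborel. ?g j y) sums (LINT y|lborel. (\<Sum>j. ?g j y))"
  proof (rule sums_integral[OF gi])
    show "AE y in lborel. summable (\<lambda>j. norm (?g j y))"
      using summable_abs_mult nonneg by (simp add: norm_mult projector_def)
    show "summable (\<lambda>j. LINT y|lborel. norm (?g j y))"
    proof (rule summable_comparison_test'[OF summable_weights])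
      fix j
      have "(LINT y|lborel. norm (?g j y)) \<le> (LINT y|lborel. \<mu> j * ?h j y)"
        by (intro integral_mono integrable_norm gi integrable_mult_right h gb)
      also have "\<dots> = \<mu> j * (LINT y|lborel. ?h j y)" by (rule integral_mult_right_zero)
      also have "\<dots> = \<mu> j" unfolding h by simp
      finally show "norm (LINT y|lborel. norm (?g j y)) \<le> \<mu> j"
        by (simp add: integral_nonneg_AE)
    qed
  qed
  also have "(\<lambda>y. \<Sum>j. ?g j y) = (\<lambda>y. ?e y * kernel (q - y) (q + y))"
  proof
    fix y
    have "summable (\<lambda>j. complex_of_real (\<mu> j) * projector (\<phi> j) (q - y) (q + y))"
      using summable_abs_mult[of "q - y" "q + y"] nonneg
      by (intro summable_norm_cancel[of "\<lambda>j. complex_of_real (\<mu> j) * projector (\<phi> j) (q - y) (q + y)"])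
         (simp add: norm_mult projector_def)
    from suminf_mult[OF this, of "?e y"] show "(\<Sum>j. ?g j y) = ?e y * kernel (q - y) (q + y)"
      by (simp add: kernel_def mult_ac)
  qed
  finally have "(\<lambda>j. LINT y|lborel. ?g j y) sums (LINT y|lborel. ?e y * kernel (q - y) (q + y))" .
  from sums_mult[OF this, of "complex_of_real (1 / pi)"] show ?thesis
    by (simp add: wigner_def mult_ac)
qed

end

section \<open>Pointwise summability of the thermal kernel\<close>

lemma fock_norm_Suc: "fock_norm (Suc k) = sqrt (2 * real (Suc k)) * fock_norm k"
  unfolding fock_norm_def real_sqrt_mult[symmetric] by (simp add: mult_ac)

text \<open>The three-term recurrence for the normalized functions: the older function has a
  coefficient of modulus at most 1, and the coefficient of the newer one decays like 1 / sqrt k at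
  fixed x.\<close>

lemma cmod_fock_Suc_Suc_le:
  "cmod (fock (Suc (Suc k)) x) \<le> 2 * \<bar>x\<bar> / sqrt (2 * real (Suc (Suc k))) * cmod (fock (Suc k) x) + cmod (fock k x)"
proof -
  define a where "a = sqrt (2 * real (Suc (Suc k)))"
  define b where "b = sqrt (2 * real (Suc k))"
  let ?e = "exp (- x\<^sup>2 / 2)"
  have pos: "a > 0" "b > 0" "fock_norm k > 0" by (auto simp: fock_norm_pos a_def b_def)
  have bb: "2 * real (Suc k) = b * b" unfolding b_def by simp
  have ba: "\<bar>b / a\<bar> \<le> 1" using pos by (simp add: a_def b_def)
  have n: "fock_norm (Suc k) = b * fock_norm k" "fock_norm (Suc (Suc k)) = a * (b * fock_norm k)"
    by (simp_all only: fock_norm_Suc a_def b_def)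
  define u where "u = hermite k x * ?e / fock_norm k"
  define v where "v = hermite (Suc k) x * ?e / fock_norm (Suc k)"
  have "hermite (Suc (Suc k)) x * ?e / fock_norm (Suc (Suc k)) = 2 * x / a * v - b / a * u"
    unfolding u_def v_def n hermite.simps bb using pos by (simp add: field_simps)
  then have "cmod (fock (Suc (Suc k)) x) = \<bar>2 * x / a * v - b / a * u\<bar>"
    by (simp only: fock_eq norm_of_real)
  also have "\<dots> \<le> \<bar>2 * x / a * v\<bar> + \<bar>b / a * u\<bar>" by (rule abs_triangle_ineq4)
  also have "\<dots> = 2 * \<bar>x\<bar> / a * \<bar>v\<bar> + \<bar>b / a\<bar> * \<bar>u\<bar>" using pos by (simp add: abs_mult)
  also have "\<dots> \<le> 2 * \<bar>x\<bar> / a * \<bar>v\<bar> + 1 * \<bar>u\<bar>"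
    by (intro add_left_mono mult_right_mono ba) simp
  finally show ?thesis unfolding u_def v_def a_def fock_eq norm_of_real by simp
qed

text \<open>The sum \<open>m k\<close> of two neighbouring moduli grows at most by the factor 1 +
  \<open>r k\<close> with \<open>r k\<close> tending to 0, hence more slowly than any geometric
  sequence. The ratio test then works with (1 + t) / 2, which lies between t and 1.\<close>

lemma summable_fock_pointwise:
  assumes "0 \<le> t" "t < 1"
  shows "summable (\<lambda>k. t ^ k * (cmod (fock k x))\<^sup>2)"
proof -
  define m where "m k = cmod (fock k x) + cmod (fock (Suc k) x)" for k
  define r where "r k = 2 * \<bar>x\<bar> / sqrt (2 * real (Suc (Suc k)))" for k
  have m0: "m k \<ge> 0" for k by (simp add: m_def)
  have r0: "r k \<ge> 0" for k by (simp add: r_def)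
  have mS: "m (Suc k) \<le> (1 + r k) * m k" for k
  proof -
    have "0 \<le> r k * cmod (fock k x)" by (simp add: r0)
    then show ?thesis
      using cmod_fock_Suc_Suc_le[of k x] unfolding m_def r_def[symmetric] by (simp add: algebra_simps)
  qed
  have "(\<lambda>k. t * (1 + r k)\<^sup>2) \<longlonglongrightarrow> t * (1 + 0)\<^sup>2"
    unfolding r_def by (intro tendsto_intros) real_asymp
  then have "\<forall>\<^sub>F k in sequentially. t * (1 + r k)\<^sup>2 < (1 + t) / 2"
    by (rule order_tendstoD) (use assms in auto)
  then obtain N where N: "\<And>k. k \<ge> N \<Longrightarrow> t * (1 + r k)\<^sup>2 \<le> (1 + t) / 2"
    unfolding eventually_sequentially by (meson less_imp_le)
  have sm: "summable (\<lambda>k. t ^ k * (m k)\<^sup>2)"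
  proof (rule summable_ratio_test[of "(1 + t) / 2" N])
    show "(1 + t) / 2 < 1" using assms by simp
    fix k assume k: "N \<le> k"
    have "(m (Suc k))\<^sup>2 \<le> (1 + r k)\<^sup>2 * (m k)\<^sup>2"
      unfolding power_mult_distrib[symmetric] by (intro power_mono mS m0)
    then have "t ^ Suc k * (m (Suc k))\<^sup>2 \<le> t ^ Suc k * ((1 + r k)\<^sup>2 * (m k)\<^sup>2)"
      using assms by (intro mult_left_mono) auto
    also have "\<dots> = (t * (1 + r k)\<^sup>2) * (t ^ k * (m k)\<^sup>2)" by simp
    also have "\<dots> \<le> (1 + t) / 2 * (t ^ k * (m k)\<^sup>2)"
      using assms by (intro mult_right_mono N k) auto
    finally show "norm (t ^ Suc k * (m (Suc k))\<^sup>2) \<le> (1 + t) / 2 * norm (t ^ k * (m k)\<^sup>2)"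
      using assms by (simp add: abs_mult)
  qed
  show ?thesis
  proof (rule summable_comparison_test'[OF sm])
    fix k
    have "(cmod (fock k x))\<^sup>2 \<le> (m k)\<^sup>2" by (intro power_mono) (auto simp: m_def)
    then show "norm (t ^ k * (cmod (fock k x))\<^sup>2) \<le> t ^ k * (m k)\<^sup>2"
      using assms by (simp add: abs_mult mult_left_mono)
  qed
qed

section \<open>The generating function of the Laguerre polynomials\<close>

text \<open>The negative binomial series with exponent -(i + 1), shifted by i; the shift is free
  because the terms with k < i vanish.\<close>

lemma sums_binomial_power:
  fixes t :: real
  assumes "\<bar>t\<bar> < 1"
  shows "(\<lambda>k. real (k choose i) * t ^ k) sums (t ^ i / (1 - t) ^ (i + 1))"
proof -
  have "(\<lambda>k. (- real (i + 1) gchoose k) * (- t) ^ k) sums (1 + - t) powr - real (i + 1)"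
    using assms by (intro gen_binomial_real) simp
  also have "(\<lambda>k. (- real (i + 1) gchoose k) * (- t) ^ k) = (\<lambda>k. real (k + i choose i) * t ^ k)"
  proof
    fix k
    have "(- real (i + 1) gchoose k) = (-1) ^ k * (real (k + i) gchoose k)"
    proof -
      have "real (i + 1) + real k - 1 = real (k + i)" by simp
      then show ?thesis using gbinomial_minus[of "real (i + 1)" k] by (simp only:)
    qed
    also have "real (k + i) gchoose k = real (k + i choose i)"
      using binomial_gbinomial[of "k + i" k, where ?'a = real] binomial_symmetric[of k "k + i"] by simp
    finally show "(- real (i + 1) gchoose k) * (- t) ^ k = real (k + i choose i) * t ^ k"
      by (simp add: power_minus[of t])
  qed
  also have "(1 + - t) powr - real (i + 1) = 1 / (1 - t) ^ (i + 1)"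
    using assms by (subst powr_minus, subst powr_realpow) (auto simp: field_simps)
  finally have "(\<lambda>k. t ^ i * (real (k + i choose i) * t ^ k)) sums (t ^ i * (1 / (1 - t) ^ (i + 1)))"
    by (rule sums_mult)
  then have "(\<lambda>k. real (k + i choose i) * t ^ (k + i)) sums (t ^ i / (1 - t) ^ (i + 1))"
    by (simp add: power_add mult_ac)
  then show ?thesis
    by (subst (asm) sums_zero_iff_shift) auto
qed

text \<open>With the explicit sum for \<open>laguerre\<close> inserted and the summations exchanged,
  the sum over k is a negative binomial series and the one over i an exponential series.\<close>

lemma laguerre_generating_function:
  assumes t: "\<bar>t\<bar> < 1"
  shows "(\<lambda>k. t ^ k * laguerre k y) sums (exp (- t * y / (1 - t)) / (1 - t))"
proof -
  let ?M = "count_space (UNIV :: nat set)"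
  define f where "f i k = (- y) ^ i / fact i * (real (k choose i) * t ^ k)" for i k :: nat
  have nf: "norm (f i k) = \<bar>y\<bar> ^ i / fact i * (real (k choose i) * \<bar>t\<bar> ^ k)" for i k
    by (simp add: f_def abs_mult power_abs)
  have nfs: "(\<lambda>k. norm (f i k)) sums (\<bar>y\<bar> ^ i / fact i * (\<bar>t\<bar> ^ i / (1 - \<bar>t\<bar>) ^ (i + 1)))" for i
    unfolding nf using t by (intro sums_mult sums_binomial_power) simp
  have fs: "(\<lambda>k. f i k) sums ((- y) ^ i / fact i * (t ^ i / (1 - t) ^ (i + 1)))" for i
    unfolding f_def using t by (intro sums_mult sums_binomial_power) simp
  have fi: "integrable ?M (f i)" for i
    unfolding integrable_count_space_nat_iff using nfs by (rule sums_summable)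
  have nfi: "integrable ?M (\<lambda>k. norm (f i k))" for i by (rule integrable_norm[OF fi])
  have int_f: "(LINT k|?M. f i k) = (- y) ^ i / fact i * (t ^ i / (1 - t) ^ (i + 1))" for i
    using sums_integral_count_space_nat[OF fi] fs by (rule sums_unique2)
  have int_nf: "(LINT k|?M. norm (f i k)) = \<bar>y\<bar> ^ i / fact i * (\<bar>t\<bar> ^ i / (1 - \<bar>t\<bar>) ^ (i + 1))" for i
    using sums_integral_count_space_nat[OF nfi] nfs by (rule sums_unique2)
  have row: "f i k = 0" if "i \<notin> {..k}" for i k
    using that by (simp add: f_def)
  have AE: "AE k in ?M. summable (\<lambda>i. norm (f i k))"
    using row by (intro AE_I2 summable_finite[of "{.._}"]) auto
  have e: "(\<lambda>i. y ^ i / fact i * (t ^ i / (1 - t) ^ (i + 1))) sums (exp (t * y / (1 - t)) / (1 - t))"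
    if "\<bar>t\<bar> < 1" for y t :: real
  proof -
    have "(\<lambda>i. (t * y / (1 - t)) ^ i /\<^sub>R fact i) sums exp (t * y / (1 - t))" by (rule exp_converges)
    from sums_divide[OF this, of "1 - t"] show ?thesis
      by (simp add: power_mult_distrib power_divide field_simps)
  qed
  \<comment> \<open>Taking norms merely replaces t and y by their absolute values, so the same
    exponential series gives the absolute convergence needed for the exchange.\<close>
  have sm: "summable (\<lambda>i. LINT k|?M. norm (f i k))"
    unfolding int_nf using e[of "\<bar>t\<bar>" "\<bar>y\<bar>"] t by (auto dest: sums_summable)
  have "(\<lambda>k. \<Sum>i. f i k) sums (LINT k|?M. (\<Sum>i. f i k))"
    by (rule sums_integral_count_space_nat[OF integrable_suminf[OF fi AE sm]])
  moreover have "(\<lambda>i. LINT k|?M. f i k) sums (LINT k|?M. (\<Sum>i. f i k))"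
    by (rule sums_integral[OF fi AE sm])
  then have "(LINT k|?M. (\<Sum>i. f i k)) = exp (- t * y / (1 - t)) / (1 - t)"
    unfolding int_f using e[OF t, of "- y"] by (auto dest: sums_unique2)
  moreover have "(\<Sum>i. f i k) = t ^ k * laguerre k y" for k
  proof -
    have "(\<Sum>i. f i k) = (\<Sum>i\<le>k. f i k)" by (rule suminf_finite) (use row in auto)
    then show ?thesis
      unfolding laguerre_def f_def sum_distrib_left by (simp add: power_minus[of y] mult_ac)
  qed
  ultimately show ?thesis by simp
qed

section \<open>The states of the family\<close>

lemma norm_sq_fock: "norm_sq (fock k) = 1"
  using cinner_fock_same[of k] by (simp add: cinner_same)

lemma psi_L2: "psi n \<epsilon> \<in> L2"
  unfolding psi_def by (intro L2_add L2_cmult fock_L2)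

lemma norm_sq_cmult: "norm_sq (\<lambda>x. c * f x) = (cmod c)\<^sup>2 * norm_sq f"
  by (simp add: norm_sq_def norm_mult power_mult_distrib)

lemma norm_sq_psi:
  assumes "n > 0" "\<bar>\<epsilon>\<bar> \<le> 1"
  shows "norm_sq (psi n \<epsilon>) = 1"
proof -
  let ?f = "\<lambda>x. complex_of_real (sqrt (1 - \<epsilon>\<^sup>2)) * fock 0 x"
  have "cinner (fock n) (fock 0) = 0"
    using cinner_fock_0[OF assms(1)] cnj_cinner[of "fock 0" "fock n"] by simp
  then have c: "cinner (fock n) ?f = 0" by (simp only: cinner_cmult_right mult_zero_right)
  have "norm_sq (\<lambda>x. ?f x - (- complex_of_real \<epsilon>) * fock n x) = (1 - \<epsilon>\<^sup>2) + \<epsilon>\<^sup>2"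
    using norm_sq_diff_unit[OF L2_cmult[OF fock_L2] fock_L2 norm_sq_fock, of "complex_of_real (sqrt (1 - \<epsilon>\<^sup>2))" 0 "- complex_of_real \<epsilon>" n]
      assms(2) by (simp add: c norm_sq_cmult norm_sq_fock abs_square_le_1)
  then show ?thesis by (simp add: psi_def[abs_def])
qed

lemma wigner_psi:
  assumes "\<bar>\<epsilon>\<bar> \<le> 1"
  shows "wigner (projector (psi n \<epsilon>)) (q, p) = complex_of_real (exp (- (q\<^sup>2 + p\<^sup>2)) / pi *
     (1 - \<epsilon>\<^sup>2 + \<epsilon>\<^sup>2 * poly_P n (q\<^sup>2 + p\<^sup>2) + 2 * \<epsilon> * sqrt (1 - \<epsilon>\<^sup>2) * beta_coeff n * Re (Complex q p ^ n)))"
proof -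
  define a where "a = sqrt (1 - \<epsilon>\<^sup>2)"
  let ?e = "\<lambda>y. exp (2 * \<i> * complex_of_real p * complex_of_real y)"
  let ?g = "\<lambda>m k y. ?e y * (fock m (q - y) * cnj (fock k (q + y)))"
  let ?W = "\<lambda>m k. wigner (\<lambda>x y. fock m x * cnj (fock k y)) (q, p)"
  note i = integrable_wigner_fock[of p _ q]
  have lin: "(LINT y|lborel. A * f y + B * g y + C * h y + D * k y) =
      A * (LINT y|lborel. f y) + B * (LINT y|lborel. g y) + C * (LINT y|lborel. h y) + D * (LINT y|lborel. k y)"
    if "integrable lborel f" "integrable lborel g" "integrable lborel h" "integrable lborel k"
    for A B C D :: complex and f g h k :: "real \<Rightarrow> complex"
    using that by simp
  have "(\<lambda>y. ?e y * projector (psi n \<epsilon>) (q - y) (q + y)) =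
    (\<lambda>y. complex_of_real (a * a) * ?g 0 0 y + complex_of_real (a * \<epsilon>) * ?g 0 n y +
         complex_of_real (\<epsilon> * a) * ?g n 0 y + complex_of_real (\<epsilon> * \<epsilon>) * ?g n n y)"
    by (simp add: projector_def psi_def a_def[symmetric] algebra_simps del: cnj_fock)
  then have "wigner (projector (psi n \<epsilon>)) (q, p) =
     complex_of_real (a * a) * ?W 0 0 + complex_of_real (a * \<epsilon>) * ?W 0 n +
     complex_of_real (\<epsilon> * a) * ?W n 0 + complex_of_real (\<epsilon> * \<epsilon>) * ?W n n"
    unfolding wigner_def prod.case
    by (simp only: lin[OF i i i i] distrib_left mult.left_commute[of "complex_of_real (1 / pi)"])
  moreover have "?W k k = complex_of_real (exp (- (q\<^sup>2 + p\<^sup>2)) / pi * poly_P k (q\<^sup>2 + p\<^sup>2))" for k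
    using wigner_fock[of k q p] unfolding projector_def .
  moreover have "poly_P 0 (q\<^sup>2 + p\<^sup>2) = 1" by (simp add: poly_P_def laguerre_def)
  moreover have "beta_coeff 0 = 1" by (simp add: beta_coeff_def)
  moreover have "cnj (Complex q p) ^ n = cnj (Complex q p ^ n)" by simp
  moreover have "a * a = 1 - \<epsilon>\<^sup>2" using assms by (simp add: a_def abs_square_le_1)
  ultimately show ?thesis
    unfolding wigner_fock_0_k wigner_fock_k_0 a_def[symmetric]
    by (simp add: complex_eq_iff power2_eq_square algebra_simps add_divide_distrib diff_divide_distrib del: cnj_fock complex_cnj_power)
qed

definition thermal_weight :: "real \<Rightarrow> nat \<Rightarrow> real" where
  "thermal_weight \<nu> k = \<nu> ^ k / (\<nu> + 1) ^ (k + 1)"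

lemma thermal_weight_eq: "thermal_weight \<nu> k = (\<nu> / (\<nu> + 1)) ^ k / (\<nu> + 1)"
  by (simp add: thermal_weight_def power_divide)

context
  fixes \<nu> :: real
  assumes nu: "\<nu> > 0"
begin

lemma thermal_weight_nonneg: "thermal_weight \<nu> k \<ge> 0"
  using nu by (simp add: thermal_weight_def)

lemma thermal_weight_sums: "thermal_weight \<nu> sums 1"
proof -
  have "(\<lambda>k. (\<nu> / (\<nu> + 1)) ^ k / (\<nu> + 1)) sums (1 / (1 - \<nu> / (\<nu> + 1)) / (\<nu> + 1))"
    using nu by (intro sums_divide geometric_sums) auto
  then show ?thesis using nu by (simp add: thermal_weight_eq[abs_def] field_simps)
qed

lemma summable_thermal_pointwise: "summable (\<lambda>k. thermal_weight \<nu> k * (cmod (fock k x))\<^sup>2)"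
  using summable_divide[OF summable_fock_pointwise[of "\<nu> / (\<nu> + 1)" x], of "\<nu> + 1"] nu
  by (simp add: thermal_weight_eq)

lemma mixture_thermal: "mixture fock (thermal_weight \<nu>)"
  by (rule mixture.intro)
     (auto simp: fock_L2 norm_sq_fock thermal_weight_nonneg thermal_weight_sums summable_thermal_pointwise)

lemma thermal_eq_kernel: "thermal \<nu> = mixture.kernel fock (thermal_weight \<nu>)"
  by (simp add: fun_eq_iff thermal_def mixture.kernel_def[OF mixture_thermal] thermal_weight_def)

text \<open>The generating function at t = -\<nu> / (\<nu> + 1), whose sign absorbs the
  \<open>(-1) ^ k\<close> in \<open>poly_P\<close>. Since 1 - c = 1 / s, the result is the broader
  Gaussian exp (-|r|^2 / s) / (pi s), written relative to the vacuum.\<close>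

lemma wigner_thermal:
  "wigner (thermal \<nu>) (q, p) =
     complex_of_real (exp (- (q\<^sup>2 + p\<^sup>2)) / pi * (exp (c_par \<nu> * (q\<^sup>2 + p\<^sup>2)) / s_par \<nu>))"
proof -
  define x where "x = q\<^sup>2 + p\<^sup>2"
  define t where "t = - \<nu> / (\<nu> + 1)"
  have t: "\<bar>t\<bar> < 1" using nu by (simp add: t_def)
  have w: "thermal_weight \<nu> k * (exp (- x) / pi * poly_P k x) = exp (- x) / pi / (\<nu> + 1) * (t ^ k * laguerre k (2 * x))" for k
  proof -
    have "t ^ k = (-1) ^ k * (\<nu> / (\<nu> + 1)) ^ k"
      using power_minus[of "\<nu> / (\<nu> + 1)" k] unfolding t_def minus_divide_left .
    then show ?thesis by (simp add: thermal_weight_eq poly_P_def mult_ac)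
  qed
  have c: "c_par \<nu> = 2 * \<nu> / (2 * \<nu> + 1)"
    using nu by (simp add: c_par_def s_par_def field_simps)
  have d: "1 - t = (2 * \<nu> + 1) / (\<nu> + 1)" using nu by (simp add: t_def field_simps)
  have "- t / (1 - t) = \<nu> / (2 * \<nu> + 1)" 
  proof -
    have "(u / a) / (v / a) = u / v" if "a \<noteq> 0" for u v a :: real
      using that by simp
    from this[of "\<nu> + 1" \<nu> "2 * \<nu> + 1"] show ?thesis
      unfolding d using nu by (simp add: t_def)
  qed
  then have e: "- t * (2 * x) / (1 - t) = c_par \<nu> * x"
    unfolding c by (metis (no_types, lifting) mult.assoc mult.commute times_divide_eq_left)
  have "(\<lambda>k. exp (- x) / pi / (\<nu> + 1) * (t ^ k * laguerre k (2 * x))) sums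
      (exp (- x) / pi / (\<nu> + 1) * (exp (- t * (2 * x) / (1 - t)) / (1 - t)))"
    by (intro sums_mult laguerre_generating_function t)
  also have "exp (- x) / pi / (\<nu> + 1) * (exp (- t * (2 * x) / (1 - t)) / (1 - t)) =
      exp (- x) / pi * (exp (c_par \<nu> * x) / s_par \<nu>)"
  proof -
    have "A / a * (E / (v / a)) = A * (E / v)" if "a \<noteq> 0" for A E v a :: real
      using that by simp
    from this[of "\<nu> + 1"] show ?thesis unfolding e unfolding d s_par_def using nu by simp
  qed
  finally have "(\<lambda>k. complex_of_real (thermal_weight \<nu> k * (exp (- x) / pi * poly_P k x))) sums
     complex_of_real (exp (- x) / pi * (exp (c_par \<nu> * x) / s_par \<nu>))"
    unfolding w by (rule sums_of_real)
  moreover have "(\<lambda>k. complex_of_real (thermal_weight \<nu> k * (exp (- x) / pi * poly_P k x))) sums wigner (thermal \<nu>) (q, p)"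
    using mixture.wigner_kernel[OF mixture_thermal, of q p] unfolding thermal_eq_kernel[symmetric] wigner_fock x_def[symmetric]
    by (simp only: of_real_mult)
  ultimately show ?thesis unfolding x_def[symmetric] by (rule sums_unique2[symmetric])
qed

context
  fixes n :: nat and K \<epsilon> :: real
  assumes n: "n > 0" and eps: "\<bar>\<epsilon>\<bar> \<le> 1" and delta: "0 \<le> delta n \<nu> K \<epsilon>" "delta n \<nu> K \<epsilon> \<le> 1"
begin

text \<open>\<open>psi\<close> is put in front of the thermal ensemble, whose indices move up by
  one, so that everything proved for mixtures transfers to \<open>rho\<close>.\<close>

lemma mixture_rho:
  "mixture (case_nat (psi n \<epsilon>) fock) (case_nat (1 - delta n \<nu> K \<epsilon>) (\<lambda>k. delta n \<nu> K \<epsilon> * thermal_weight \<nu> k))"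
    (is "mixture ?\<phi> ?\<mu>")
proof
  show "?\<phi> j \<in> L2" for j by (auto simp: psi_L2 fock_L2 split: nat.split)
  show "norm_sq (?\<phi> j) = 1" for j using n eps by (auto simp: norm_sq_fock norm_sq_psi split: nat.split)
  show "?\<mu> j \<ge> 0" for j using delta thermal_weight_nonneg by (auto split: nat.split)
  have "(\<lambda>k. ?\<mu> (Suc k)) sums (delta n \<nu> K \<epsilon> * 1)"
    using sums_mult[OF thermal_weight_sums] by simp
  then show "?\<mu> sums 1" by (subst (asm) sums_Suc_iff) simp
  show "summable (\<lambda>j. ?\<mu> j * (cmod (?\<phi> j x))\<^sup>2)" for x
    using summable_mult[OF summable_thermal_pointwise, of "delta n \<nu> K \<epsilon>" x]
    by (subst summable_Suc_iff[symmetric]) (simp add: mult_ac)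
qed

lemma rho_eq_kernel:
  "rho n \<nu> K \<epsilon> = mixture.kernel (case_nat (psi n \<epsilon>) fock)
     (case_nat (1 - delta n \<nu> K \<epsilon>) (\<lambda>k. delta n \<nu> K \<epsilon> * thermal_weight \<nu> k))"
    (is "_ = mixture.kernel ?\<phi> ?\<mu>")
proof (intro ext)
  fix x y
  interpret mixture fock "thermal_weight \<nu>" by (rule mixture_thermal)
  have "summable (\<lambda>j. complex_of_real (thermal_weight \<nu> j) * projector (fock j) x y)"
    using summable_abs_mult[of x y] thermal_weight_nonneg
    by (intro summable_norm_cancel[of "\<lambda>j. complex_of_real (thermal_weight \<nu> j) * projector (fock j) x y"])
       (simp add: norm_mult projector_def)
  then have "(\<lambda>j. complex_of_real (thermal_weight \<nu> j) * projector (fock j) x y) sums thermal \<nu> x y"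
    unfolding thermal_eq_kernel kernel_def by (rule summable_sums)
  from sums_mult[OF this, of "complex_of_real (delta n \<nu> K \<epsilon>)"]
  have "(\<lambda>j. complex_of_real (?\<mu> (Suc j)) * projector (?\<phi> (Suc j)) x y) sums
     (complex_of_real (delta n \<nu> K \<epsilon>) * thermal \<nu> x y)"
    by (simp add: mult.assoc)
  from sums_Suc[OF this]
  have "(\<lambda>j. complex_of_real (?\<mu> j) * projector (?\<phi> j) x y) sums rho n \<nu> K \<epsilon> x y"
    by (simp add: rho_def add.commute)
  then show "rho n \<nu> K \<epsilon> x y = mixture.kernel ?\<phi> ?\<mu> x y"
    unfolding mixture.kernel_def[OF mixture_rho] by (rule sums_unique)
qed

lemma quantum_state_rho: "quantum_state (rho n \<nu> K \<epsilon>)"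
  unfolding rho_eq_kernel by (rule mixture.quantum_state_kernel[OF mixture_rho])

lemma wigner_rho:
  "wigner (rho n \<nu> K \<epsilon>) (q, p) = complex_of_real (exp (- (q\<^sup>2 + p\<^sup>2)) / pi *
     ((1 - delta n \<nu> K \<epsilon>) * (1 - \<epsilon>\<^sup>2 + \<epsilon>\<^sup>2 * poly_P n (q\<^sup>2 + p\<^sup>2) + 2 * \<epsilon> * sqrt (1 - \<epsilon>\<^sup>2) * beta_coeff n * Re (Complex q p ^ n))
      + delta n \<nu> K \<epsilon> * (exp (c_par \<nu> * (q\<^sup>2 + p\<^sup>2)) / s_par \<nu>)))"
proof -
  have "(\<lambda>j. complex_of_real (thermal_weight \<nu> j) * wigner (projector (fock j)) (q, p)) sums wigner (thermal \<nu>) (q, p)"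
    unfolding thermal_eq_kernel by (rule mixture.wigner_kernel[OF mixture_thermal])
  from sums_mult[OF this, of "complex_of_real (delta n \<nu> K \<epsilon>)"]
  have "(\<lambda>j. complex_of_real (case_nat (1 - delta n \<nu> K \<epsilon>) (\<lambda>k. delta n \<nu> K \<epsilon> * thermal_weight \<nu> k) (Suc j)) *
      wigner (projector (case_nat (psi n \<epsilon>) fock (Suc j))) (q, p)) sums
     (complex_of_real (delta n \<nu> K \<epsilon>) * wigner (thermal \<nu>) (q, p))"
    by (simp add: mult.assoc)
  from sums_unique2[OF mixture.wigner_kernel[OF mixture_rho, of q p] sums_Suc[OF this]]
  have "wigner (rho n \<nu> K \<epsilon>) (q, p) = complex_of_real (1 - delta n \<nu> K \<epsilon>) * wigner (projector (psi n \<epsilon>)) (q, p) +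
      complex_of_real (delta n \<nu> K \<epsilon>) * wigner (thermal \<nu>) (q, p)"
    unfolding rho_eq_kernel by (simp add: add.commute)
  moreover have lin: "complex_of_real u * complex_of_real (e * x) + complex_of_real v * complex_of_real (e * y) =
      complex_of_real (e * (u * x + v * y))" for u v e x y
    by (simp add: algebra_simps)
  ultimately show ?thesis
    unfolding wigner_psi[OF eps] wigner_thermal lin ..
qed

end

end

section \<open>Gaussian moments in the plane\<close>

definition rad2 :: "real \<times> real \<Rightarrow> real" where
  "rad2 r = (fst r)\<^sup>2 + (snd r)\<^sup>2"

definition zc :: "real \<times> real \<Rightarrow> complex" where
  "zc r = Complex (fst r) (snd r)"

lemma zc_eq: "zc r = complex_of_real (fst r) + \<i> * complex_of_real (snd r)"
  by (simp add: zc_def complex_eq_iff)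

lemma rad2_nonneg [simp]: "rad2 r \<ge> 0"
  by (simp add: rad2_def)

lemma cmod_zc_sq: "(cmod (zc r))\<^sup>2 = rad2 r"
  by (simp add: zc_def rad2_def cmod_power2)

lemma cmod_zc_le: "cmod (zc r) \<le> 1 + rad2 r"
proof -
  have "cmod (zc r) * 1 \<le> ((cmod (zc r))\<^sup>2 + 1\<^sup>2) / 2" by (rule mult_le_half_sum_squares)
  also have "\<dots> \<le> 1 + rad2 r" using rad2_nonneg[of r] by (simp add: cmod_zc_sq del: rad2_nonneg)
  finally show ?thesis by simp
qed

lemma measurable_rad2 [measurable]: "rad2 \<in> borel_measurable borel"
  unfolding rad2_def[abs_def] by (intro borel_measurable_continuous_onI continuous_intros)

lemma measurable_zc [measurable]: "zc \<in> borel_measurable borel"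
  unfolding zc_eq[abs_def] by (intro borel_measurable_continuous_onI continuous_intros)

lemma integral_pair:
  fixes f :: "real \<times> real \<Rightarrow> 'a :: {banach, second_countable_topology}"
  assumes "integrable lborel f"
  shows "(LINT r|lborel. f r) = (LINT x|lborel. LINT y|lborel. f (x, y))"
    and "(LINT r|lborel. f r) = (LINT y|lborel. LINT x|lborel. f (x, y))"
  using lborel_pair.integral_fst'[of f] lborel_pair.integral_snd[of "\<lambda>x y. f (x, y)"] assms
  by (simp_all add: lborel_prod)

lemma integrable_gauss2:
  assumes "\<alpha> > 0"
  shows "integrable lborel (\<lambda>r. exp (- \<alpha> * rad2 r))"
    and "(LINT r|lborel. exp (- \<alpha> * rad2 r)) = pi / \<alpha>"
proof -
  have e: "exp (- \<alpha> * rad2 (x, y)) = exp (- \<alpha> * x\<^sup>2) * exp (- \<alpha> * y\<^sup>2)" for x y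
    by (simp add: rad2_def algebra_simps flip: exp_add)
  have "integrable (lborel \<Otimes>\<^sub>M lborel) (\<lambda>r. exp (- \<alpha> * rad2 r))"
  proof (rule lborel_pair.Fubini_integrable)
    show "(\<lambda>r. exp (- \<alpha> * rad2 r)) \<in> borel_measurable (lborel \<Otimes>\<^sub>M lborel)"
      unfolding lborel_prod by measurable
    show "integrable lborel (\<lambda>x. LINT y|lborel. norm (exp (- \<alpha> * rad2 (x, y))))"
      unfolding e using integrable_gauss[OF assms] by (simp add: abs_mult)
    show "AE x in lborel. integrable lborel (\<lambda>y. exp (- \<alpha> * rad2 (x, y)))"
      unfolding e using integrable_gauss[OF assms] by (simp add: integrable_mult_right)
  qed
  then show i: "integrable lborel (\<lambda>r. exp (- \<alpha> * rad2 r))" by (simp add: lborel_prod)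
  have "(LINT r|lborel. exp (- \<alpha> * rad2 r)) = sqrt (pi / \<alpha>) * sqrt (pi / \<alpha>)"
    unfolding integral_pair(1)[OF i] e
    by (simp only: integral_mult_right_zero integral_mult_left_zero integral_gauss[OF assms])
  then show "(LINT r|lborel. exp (- \<alpha> * rad2 r)) = pi / \<alpha>" using assms by simp
qed

lemma power_le_fact_exp:
  fixes x :: real
  assumes "x \<ge> 0"
  shows "x ^ k \<le> fact k * exp x"
proof -
  have s: "(\<lambda>n. x ^ n /\<^sub>R fact n) sums exp x" by (rule exp_converges)
  have "(\<Sum>n\<in>{k}. x ^ n /\<^sub>R fact n) \<le> exp x"
    unfolding sums_unique[OF s] using assms by (intro sum_le_suminf sums_summable[OF s]) auto
  then show ?thesis by (simp add: field_simps)
qed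

text \<open>Half of the Gaussian exponent absorbs the polynomial growth, and the other half is
  integrable.\<close>

lemma integrable_gauss_growth:
  fixes f :: "real \<times> real \<Rightarrow> 'a :: {banach, second_countable_topology}"
  assumes a: "\<alpha> > 0" and f [measurable]: "f \<in> borel_measurable borel"
    and b: "\<And>r. norm (f r) \<le> C * (1 + rad2 r) ^ k"
  shows "integrable lborel (\<lambda>r. exp (- \<alpha> * rad2 r) *\<^sub>R f r)"
proof (rule Bochner_Integration.integrable_bound)
  \<comment> \<open>From \<open>power_le_fact_exp\<close> at \<alpha> / 2 * (1 +
    \<open>rad2 r\<close>); the factor \<open>exp (\<alpha> / 2)\<close> is due to the summand
    1.\<close>
  define B where "B = \<bar>C\<bar> * ((2 / \<alpha>) ^ k * (fact k * exp (\<alpha> / 2)))"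
  show "integrable lborel (\<lambda>r. B * exp (- (\<alpha> / 2) * rad2 r))"
    using a by (intro integrable_mult_right integrable_gauss2) simp
  show "AE r in lborel. norm (exp (- \<alpha> * rad2 r) *\<^sub>R f r) \<le> norm (B * exp (- (\<alpha> / 2) * rad2 r))"
  proof (rule AE_I2)
    fix r
    have "(1 + rad2 r) ^ k = (2 / \<alpha>) ^ k * (\<alpha> / 2 * (1 + rad2 r)) ^ k"
    proof -
      have "2 / \<alpha> * (\<alpha> / 2 * (1 + rad2 r)) = 1 + rad2 r" using a by simp
      then show ?thesis by (simp only: flip: power_mult_distrib)
    qed
    also have "\<dots> \<le> (2 / \<alpha>) ^ k * (fact k * exp (\<alpha> / 2 * (1 + rad2 r)))"
      using a by (intro mult_left_mono power_le_fact_exp) auto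
    finally have p: "(1 + rad2 r) ^ k \<le> (2 / \<alpha>) ^ k * (fact k * exp (\<alpha> / 2 * (1 + rad2 r)))" .
    have "norm (f r) \<le> \<bar>C\<bar> * (1 + rad2 r) ^ k"
      by (rule order_trans[OF b]) (intro mult_right_mono, auto)
    also have "\<dots> \<le> \<bar>C\<bar> * ((2 / \<alpha>) ^ k * (fact k * exp (\<alpha> / 2 * (1 + rad2 r))))"
      by (intro mult_left_mono p) simp
    also have "exp (\<alpha> / 2 * (1 + rad2 r)) = exp (\<alpha> / 2) * exp (\<alpha> / 2 * rad2 r)"
      by (simp add: algebra_simps flip: exp_add)
    also have "\<bar>C\<bar> * ((2 / \<alpha>) ^ k * (fact k * (exp (\<alpha> / 2) * exp (\<alpha> / 2 * rad2 r)))) = B * exp (\<alpha> / 2 * rad2 r)"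
      by (simp only: B_def mult.assoc)
    finally have "exp (- \<alpha> * rad2 r) * norm (f r) \<le> exp (- \<alpha> * rad2 r) * (B * exp (\<alpha> / 2 * rad2 r))"
      by (intro mult_left_mono) auto
    also have "\<dots> = B * exp (- (\<alpha> / 2) * rad2 r)"
    proof -
      have "exp (- \<alpha> * rad2 r) * exp (\<alpha> / 2 * rad2 r) = exp (- (\<alpha> / 2) * rad2 r)"
        unfolding exp_add[symmetric] by (simp add: field_simps)
      then show ?thesis by (simp only: mult.left_commute)
    qed
    finally show "norm (exp (- \<alpha> * rad2 r) *\<^sub>R f r) \<le> norm (B * exp (- (\<alpha> / 2) * rad2 r))"
      by (simp add: abs_le_iff)
  qed
qed measurable

lemma poly_P_eq: "poly_P n x = (\<Sum>k\<le>n. (-1) ^ n * (real (n choose k) * (-2) ^ k / fact k) * x ^ k)"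
proof -
  have "(-1) ^ k * 2 ^ k = ((-2)::real) ^ k" for k by (simp flip: power_mult_distrib)
  then have "real (n choose k) * (-1) ^ k / fact k * (2 * x) ^ k = real (n choose k) * (-2) ^ k / fact k * x ^ k" for k
    unfolding power_mult_distrib by (metis (no_types, lifting) mult.assoc times_divide_eq_left)
  then show ?thesis
    unfolding poly_P_def laguerre_def sum_distrib_left by (simp only: mult.assoc)
qed

context
  fixes \<alpha> :: real
  assumes alpha: "\<alpha> > 0"
begin

text \<open>Monomials in z and its conjugate instead of q and p: rotation invariance of the Gaussian
  then makes the moments with unequal exponents vanish.\<close>

definition gauss_monomial :: "nat \<Rightarrow> nat \<Rightarrow> real \<times> real \<Rightarrow> complex" where
  "gauss_monomial a b r = complex_of_real (exp (- \<alpha> * rad2 r)) * (zc r ^ a * cnj (zc r) ^ b)"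

lemma integrable_gauss_monomial: "integrable lborel (gauss_monomial a b)"
proof -
  have "integrable lborel (\<lambda>r. exp (- \<alpha> * rad2 r) *\<^sub>R (zc r ^ a * cnj (zc r) ^ b))"
  proof (rule integrable_gauss_growth[OF alpha, where C = 1 and k = "a + b"])
    fix r
    have "cmod (zc r ^ a * cnj (zc r) ^ b) = cmod (zc r) ^ (a + b)"
      by (simp add: norm_mult norm_power power_add)
    also have "\<dots> \<le> (1 + rad2 r) ^ (a + b)" by (intro power_mono cmod_zc_le) simp
    finally show "norm (zc r ^ a * cnj (zc r) ^ b) \<le> 1 * (1 + rad2 r) ^ (a + b)" by simp
  qed measurable
  then show ?thesis by (simp add: gauss_monomial_def[abs_def] scaleR_conv_of_real)
qed

definition moment :: "nat \<Rightarrow> nat \<Rightarrow> complex" where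
  "moment a b = (LINT r|lborel. gauss_monomial a b r)"

text \<open>\<open>?G\<close> is the q-derivative of the Gaussian monomial, so its integral over q
  is zero for each p.\<close>

lemma moment_by_parts_fst:
  "of_nat a * moment (a - 1) b + of_nat b * moment a (b - 1) - complex_of_real \<alpha> * (moment (Suc a) b + moment a (Suc b)) = 0"
proof -
  let ?G = "\<lambda>r. of_nat a * gauss_monomial (a - 1) b r + of_nat b * gauss_monomial a (b - 1) r - complex_of_real \<alpha> * (gauss_monomial (Suc a) b r + gauss_monomial a (Suc b) r)"
  have i: "integrable lborel ?G"
    by (intro Bochner_Integration.integrable_add Bochner_Integration.integrable_diff integrable_mult_right integrable_gauss_monomial)
  have "(LINT q|lborel. ?G (q, p)) = 0" for p
  proof -
    define F where "F = [:\<i> * complex_of_real p, 1:] ^ a * [:- \<i> * complex_of_real p, 1:] ^ b"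
    have d: "pderiv F = smult (of_nat a) ([:\<i> * complex_of_real p, 1:] ^ (a - 1) * [:- \<i> * complex_of_real p, 1:] ^ b)
       + smult (of_nat b) ([:\<i> * complex_of_real p, 1:] ^ a * [:- \<i> * complex_of_real p, 1:] ^ (b - 1))"
      unfolding F_def by (simp add: pderiv_mult pderiv_power pderiv_pCons mult_ac add.commute)
    have "?G (q, p) = complex_of_real (exp (- \<alpha> * p\<^sup>2)) * (gauss 0 \<alpha> q * (poly F (complex_of_real q) * (\<i> * complex_of_real 0 - 2 * complex_of_real (\<alpha> * q))
       + poly (pderiv F) (complex_of_real q)))" for q
    proof -
      have w: "complex_of_real (exp (- \<alpha> * rad2 (q, p))) = complex_of_real (exp (- \<alpha> * p\<^sup>2)) * gauss 0 \<alpha> q"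
        by (simp add: rad2_def gauss_def algebra_simps flip: of_real_mult exp_add)
      have z: "poly [:\<i> * complex_of_real p, 1:] (complex_of_real q) = zc (q, p)"
        "poly [:- \<i> * complex_of_real p, 1:] (complex_of_real q) = cnj (zc (q, p))"
        by (simp_all add: zc_eq algebra_simps)
      have q: "2 * complex_of_real (\<alpha> * q) = complex_of_real \<alpha> * (zc (q, p) + cnj (zc (q, p)))"
        by (simp add: zc_eq)
      show ?thesis
        unfolding gauss_monomial_def w d q unfolding F_def poly_add poly_smult poly_mult poly_power z
        by (simp add: algebra_simps)
    qed
    then have "(LINT q|lborel. ?G (q, p)) = complex_of_real (exp (- \<alpha> * p\<^sup>2)) * (LINT q|lborel. (gauss 0 \<alpha> q * (poly F (complex_of_real q) * (\<i> * complex_of_real 0 - 2 * complex_of_real (\<alpha> * q))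
       + poly (pderiv F) (complex_of_real q))))"
      by (simp only: integral_mult_right_zero)
    then show ?thesis unfolding integral_gauss_by_parts[OF alpha] by (simp only: mult_zero_right)
  qed
  then have "(LINT r|lborel. ?G r) = 0"
    unfolding integral_pair(2)[OF i] by (simp only: Bochner_Integration.integral_zero)
  then show ?thesis unfolding moment_def by (simp add: integrable_gauss_monomial)
qed

text \<open>Here \<open>?G\<close> is \<i> times the p-derivative; that factor clears the imaginary
  units, so that the relation can be combined with the one for q.\<close>

lemma moment_by_parts_snd:
  "- of_nat a * moment (a - 1) b + of_nat b * moment a (b - 1) - complex_of_real \<alpha> * (moment (Suc a) b - moment a (Suc b)) = 0"
proof -
  let ?G = "\<lambda>r. - of_nat a * gauss_monomial (a - 1) b r + of_nat b * gauss_monomial a (b - 1) r - complex_of_real \<alpha> * (gauss_monomial (Suc a) b r - gauss_monomial a (Suc b) r)"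
  have i: "integrable lborel ?G"
    by (intro Bochner_Integration.integrable_add Bochner_Integration.integrable_diff integrable_mult_right integrable_gauss_monomial)
  have "(LINT p|lborel. ?G (q, p)) = 0" for q
  proof -
    define F where "F = [:complex_of_real q, \<i>:] ^ a * [:complex_of_real q, - \<i>:] ^ b"
    have d: "pderiv F = smult (\<i> * of_nat a) ([:complex_of_real q, \<i>:] ^ (a - 1) * [:complex_of_real q, - \<i>:] ^ b)
       + smult (- \<i> * of_nat b) ([:complex_of_real q, \<i>:] ^ a * [:complex_of_real q, - \<i>:] ^ (b - 1))"
      unfolding F_def by (simp add: pderiv_mult pderiv_power pderiv_pCons mult_ac add.commute)
    have "?G (q, p) = \<i> * complex_of_real (exp (- \<alpha> * q\<^sup>2)) * (gauss 0 \<alpha> p * (poly F (complex_of_real p) * (\<i> * complex_of_real 0 - 2 * complex_of_real (\<alpha> * p))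
       + poly (pderiv F) (complex_of_real p)))" for p
    proof -
      have w: "complex_of_real (exp (- \<alpha> * rad2 (q, p))) = complex_of_real (exp (- \<alpha> * q\<^sup>2)) * gauss 0 \<alpha> p"
        by (simp add: rad2_def gauss_def algebra_simps flip: of_real_mult exp_add)
      have z: "poly [:complex_of_real q, \<i>:] (complex_of_real p) = zc (q, p)"
        "poly [:complex_of_real q, - \<i>:] (complex_of_real p) = cnj (zc (q, p))"
        by (simp_all add: zc_eq algebra_simps)
      have p: "2 * complex_of_real (\<alpha> * p) = - \<i> * (complex_of_real \<alpha> * (zc (q, p) - cnj (zc (q, p))))"
        by (simp add: zc_eq algebra_simps)
      show ?thesis
        unfolding gauss_monomial_def w d p unfolding F_def poly_add poly_smult poly_mult poly_power z
        by (simp add: algebra_simps)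
    qed
    then have "(LINT p|lborel. ?G (q, p)) = \<i> * complex_of_real (exp (- \<alpha> * q\<^sup>2)) * (LINT p|lborel. (gauss 0 \<alpha> p * (poly F (complex_of_real p) * (\<i> * complex_of_real 0 - 2 * complex_of_real (\<alpha> * p))
       + poly (pderiv F) (complex_of_real p))))"
      by (simp only: integral_mult_right_zero)
    then show ?thesis unfolding integral_gauss_by_parts[OF alpha] by (simp only: mult_zero_right)
  qed
  then have "(LINT r|lborel. ?G r) = 0"
    unfolding integral_pair(1)[OF i] by (simp only: Bochner_Integration.integral_zero)
  then show ?thesis unfolding moment_def by (simp add: integrable_gauss_monomial)
qed

text \<open>\<open>\<partial>\<^sub>q + \<i> \<partial>\<^sub>p\<close> annihilates powers of \<open>z\<close>, so integrating the factor \<open>z = q + \<i> p\<close> by parts against the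
  Gaussian only differentiates the powers of its conjugate.\<close>

lemma moment_Suc: "complex_of_real \<alpha> * moment (Suc a) b = of_nat b * moment a (b - 1)"
proof -
  have "(x :: complex) = y" if "A + y - (x + B) = 0" "- A + y - (x - B) = 0" for x y A B
  proof -
    have "2 * (y - x) = (A + y - (x + B)) + (- A + y - (x - B))" by simp
    then show ?thesis unfolding that by simp
  qed
  from this[OF moment_by_parts_fst[of a b, unfolded distrib_left] moment_by_parts_snd[of a b, unfolded right_diff_distrib minus_mult_left[symmetric]]]
  show ?thesis .
qed

lemma moment_0: "a > 0 \<Longrightarrow> moment a 0 = 0"
  using moment_Suc[of "a - 1" 0] alpha by simp

lemma moment_same: "moment k k = complex_of_real (pi * fact k / \<alpha> ^ Suc k)"
proof (induction k)
  case 0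
  have "moment 0 0 = complex_of_real (LINT r|lborel. exp (- \<alpha> * rad2 r))"
    unfolding moment_def gauss_monomial_def by (simp flip: integral_complex_of_real)
  then show ?case unfolding integrable_gauss2(2)[OF alpha] by simp
next
  case (Suc k)
  have "complex_of_real \<alpha> * moment (Suc k) (Suc k) = complex_of_real \<alpha> * complex_of_real (pi * fact (Suc k) / \<alpha> ^ Suc (Suc k))"
    unfolding moment_Suc using Suc alpha by (simp add: field_simps)
  then show ?case using alpha by (metis less_irrefl mult_cancel_left of_real_eq_0_iff)
qed

lemma Re_moment:
  "integrable lborel (\<lambda>r. exp (- \<alpha> * rad2 r) * Re (zc r ^ a * cnj (zc r) ^ b))"
  "(LINT r|lborel. exp (- \<alpha> * rad2 r) * Re (zc r ^ a * cnj (zc r) ^ b)) = Re (moment a b)"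
  using integrable_Re[OF integrable_gauss_monomial[of a b]] integral_Re[OF integrable_gauss_monomial[of a b]]
  unfolding moment_def gauss_monomial_def by simp_all

lemma zc_power_cnj: "zc r ^ k * cnj (zc r) ^ k = complex_of_real (rad2 r ^ k)"
proof -
  have "zc r * cnj (zc r) = complex_of_real (rad2 r)"
    unfolding cmod_zc_sq[symmetric] by (rule complex_norm_square[symmetric])
  then show ?thesis by (metis of_real_power power_mult_distrib)
qed

lemma integral_rad2_power:
  "integrable lborel (\<lambda>r. exp (- \<alpha> * rad2 r) * rad2 r ^ k)"
  "(LINT r|lborel. exp (- \<alpha> * rad2 r) * rad2 r ^ k) = pi * fact k / \<alpha> ^ Suc k"
  using Re_moment[of k k] unfolding zc_power_cnj moment_same Re_complex_of_real by simp_all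

lemma integral_Re_zc_power:
  assumes "n > 0"
  shows "integrable lborel (\<lambda>r. exp (- \<alpha> * rad2 r) * Re (zc r ^ n))"
  "(LINT r|lborel. exp (- \<alpha> * rad2 r) * Re (zc r ^ n)) = 0"
  using Re_moment[of n 0] moment_0[OF assms] by simp_all

lemma integral_rad2_Re_zc_power:
  assumes "n > 0"
  shows "integrable lborel (\<lambda>r. exp (- \<alpha> * rad2 r) * (rad2 r * Re (zc r ^ n)))"
  "(LINT r|lborel. exp (- \<alpha> * rad2 r) * (rad2 r * Re (zc r ^ n))) = 0"
proof -
  have "Re (zc r ^ Suc n * cnj (zc r) ^ 1) = rad2 r * Re (zc r ^ n)" for r
  proof -
    have "zc r ^ Suc n * cnj (zc r) ^ 1 = zc r ^ n * (zc r ^ 1 * cnj (zc r) ^ 1)" by simp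
    also have "\<dots> = zc r ^ n * complex_of_real (rad2 r)" unfolding zc_power_cnj by simp
    finally have "zc r ^ Suc n * cnj (zc r) ^ 1 = zc r ^ n * complex_of_real (rad2 r)" .
    then show ?thesis by (simp only:) simp
  qed
  note e = this
  have "moment (Suc n) 1 = 0" using moment_Suc[of n 1] moment_0[OF assms] alpha by simp
  then show "integrable lborel (\<lambda>r. exp (- \<alpha> * rad2 r) * (rad2 r * Re (zc r ^ n)))"
    "(LINT r|lborel. exp (- \<alpha> * rad2 r) * (rad2 r * Re (zc r ^ n))) = 0"
    using Re_moment[of "Suc n" 1] unfolding e by simp_all
qed

lemma integral_Re_zc_power_sq:
  assumes "n > 0"
  shows "integrable lborel (\<lambda>r. exp (- \<alpha> * rad2 r) * (Re (zc r ^ n))\<^sup>2)"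
  "(LINT r|lborel. exp (- \<alpha> * rad2 r) * (Re (zc r ^ n))\<^sup>2) = pi * fact n / (2 * \<alpha> ^ Suc n)"
proof -
  \<comment> \<open>For complex w, (Re w)^2 = (Re (w^2) + |w|^2) / 2. The first term oscillates with
    the angle and integrates to zero; the second is radial.\<close>
  have "(Re (zc r ^ n))\<^sup>2 = (Re (zc r ^ (2 * n)) + rad2 r ^ n) / 2" for r
  proof -
    have "rad2 r ^ n = (cmod (zc r ^ n))\<^sup>2"
      unfolding cmod_zc_sq[symmetric] norm_power by (simp add: mult.commute flip: power_mult)
    moreover have "Re (zc r ^ (2 * n)) = (Re (zc r ^ n))\<^sup>2 - (Im (zc r ^ n))\<^sup>2"
      by (metis Re_power2 mult.commute power_mult)
    ultimately show ?thesis by (simp add: cmod_power2)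
  qed
  then have e: "exp (- \<alpha> * rad2 r) * (Re (zc r ^ n))\<^sup>2 =
      (exp (- \<alpha> * rad2 r) * Re (zc r ^ (2 * n)) + exp (- \<alpha> * rad2 r) * rad2 r ^ n) / 2" for r
    by (simp only:) (simp add: algebra_simps add_divide_distrib)
  have n2: "2 * n > 0" using assms by simp
  note i = integral_Re_zc_power(1)[OF n2] integral_rad2_power(1)[of n]
  show "integrable lborel (\<lambda>r. exp (- \<alpha> * rad2 r) * (Re (zc r ^ n))\<^sup>2)"
    unfolding e by (intro integrable_divide Bochner_Integration.integrable_add i)
  show "(LINT r|lborel. exp (- \<alpha> * rad2 r) * (Re (zc r ^ n))\<^sup>2) = pi * fact n / (2 * \<alpha> ^ Suc n)"
    unfolding e integral_divide_zero Bochner_Integration.integral_add[OF i]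
      integral_Re_zc_power(2)[OF n2] integral_rad2_power(2) by simp
qed

text \<open>The k-th radial moment contributes \<open>fact k\<close>, which cancels the factorial in
  the Laguerre coefficient and leaves a binomial expansion. This is the source of the ratio u in the
  entropy coefficient.\<close>

lemma integral_poly_P:
  "integrable lborel (\<lambda>r. exp (- \<alpha> * rad2 r) * poly_P n (rad2 r))"
  "(LINT r|lborel. exp (- \<alpha> * rad2 r) * poly_P n (rad2 r)) = pi / \<alpha> * ((2 - \<alpha>) / \<alpha>) ^ n"
proof -
  have e: "exp (- \<alpha> * rad2 r) * poly_P n (rad2 r) =
     (\<Sum>k\<le>n. (-1) ^ n * (real (n choose k) * (-2) ^ k / fact k) * (exp (- \<alpha> * rad2 r) * rad2 r ^ k))" for r
    unfolding poly_P_eq sum_distrib_left by (simp only: mult.left_commute)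
  show "integrable lborel (\<lambda>r. exp (- \<alpha> * rad2 r) * poly_P n (rad2 r))"
    unfolding e by (intro Bochner_Integration.integrable_sum integrable_mult_right integral_rad2_power)
  have "(LINT r|lborel. exp (- \<alpha> * rad2 r) * poly_P n (rad2 r)) =
     (\<Sum>k\<le>n. (-1) ^ n * (real (n choose k) * (-2) ^ k / fact k) * (pi * fact k / \<alpha> ^ Suc k))"
    unfolding e by (subst Bochner_Integration.integral_sum)
       (simp_all only: integral_mult_right_zero integral_rad2_power integrable_mult_right)
  also have "\<dots> = (\<Sum>k\<le>n. (pi / \<alpha>) * (-1) ^ n * (real (n choose k) * (-2 / \<alpha>) ^ k * 1 ^ (n - k)))"
    by (rule sum.cong[OF refl], simp only: power_divide power_one) simp
  also have "\<dots> = (pi / \<alpha>) * (-1) ^ n * (-2 / \<alpha> + 1) ^ n"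
    unfolding sum_distrib_left[symmetric] by (simp only: binomial_ring)
  also have "\<dots> = (pi / \<alpha>) * ((-1) * (-2 / \<alpha> + 1)) ^ n"
    unfolding power_mult_distrib by simp
  also have "(-1) * (-2 / \<alpha> + 1) = (2 - \<alpha>) / \<alpha>" using alpha by (simp add: field_simps)
  finally show "(LINT r|lborel. exp (- \<alpha> * rad2 r) * poly_P n (rad2 r)) = pi / \<alpha> * ((2 - \<alpha>) / \<alpha>) ^ n" .
qed

end

lemma sum_binomial_index:
  fixes x :: real
  shows "(\<Sum>k\<le>n. real k * real (n choose k) * x ^ k) = real n * x * (1 + x) ^ (n - 1)"
proof (cases n)
  case (Suc m)
  have "(\<Sum>k\<le>n. real k * real (n choose k) * x ^ k) = (\<Sum>k\<le>m. real (Suc k) * real (Suc m choose Suc k) * x ^ Suc k)"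
    unfolding Suc by (subst sum.atMost_Suc_shift) simp
  also have "\<dots> = (\<Sum>k\<le>m. real n * x * (real (m choose k) * x ^ k * 1 ^ (m - k)))"
  proof (rule sum.cong[OF refl])
    fix k
    have "real (Suc k) * real (Suc m choose Suc k) = real (Suc m) * real (m choose k)"
      using Suc_times_binomial_eq[of m k] by (metis mult.commute of_nat_mult)
    then show "real (Suc k) * real (Suc m choose Suc k) * x ^ Suc k = real n * x * (real (m choose k) * x ^ k * 1 ^ (m - k))"
      unfolding Suc by (simp only:) simp
  qed
  also have "\<dots> = real n * x * (x + 1) ^ m"
    unfolding sum_distrib_left[symmetric] by (simp add: binomial_ring)
  finally show ?thesis unfolding Suc by (simp add: add.commute)
qed simp

text \<open>The value 1 + 2 n is the mean of q^2 + p^2 in the n-th Fock state. It enters at \<alpha>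
  = 1, where the logarithm of the Gaussian weight brings down \<open>rad2\<close>.\<close>

lemma integral_rad2_poly_P:
  "integrable lborel (\<lambda>r. exp (- rad2 r) * (rad2 r * poly_P n (rad2 r)))"
  "(LINT r|lborel. exp (- rad2 r) * (rad2 r * poly_P n (rad2 r))) = pi * (1 + 2 * real n)"
proof -
  have e: "exp (- rad2 r) * (rad2 r * poly_P n (rad2 r)) =
     (\<Sum>k\<le>n. (-1) ^ n * (real (n choose k) * (-2) ^ k / fact k) * (exp (- 1 * rad2 r) * rad2 r ^ Suc k))" for r
    unfolding poly_P_eq sum_distrib_left by (rule sum.cong) (simp_all add: mult_ac)
  show "integrable lborel (\<lambda>r. exp (- rad2 r) * (rad2 r * poly_P n (rad2 r)))"
    unfolding e by (intro Bochner_Integration.integrable_sum integrable_mult_right integral_rad2_power zero_less_one)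
  have "(LINT r|lborel. exp (- rad2 r) * (rad2 r * poly_P n (rad2 r))) =
     (\<Sum>k\<le>n. (-1) ^ n * (real (n choose k) * (-2) ^ k / fact k) * (pi * fact (Suc k) / 1 ^ Suc (Suc k)))"
    unfolding e by (subst Bochner_Integration.integral_sum)
       (simp_all only: integral_mult_right_zero integral_rad2_power integrable_mult_right zero_less_one)
  also have "\<dots> = (\<Sum>k\<le>n. pi * (-1) ^ n * (real (n choose k) * (-2) ^ k * 1 ^ (n - k)) + pi * (-1) ^ n * (real k * real (n choose k) * (-2) ^ k))"
    by (rule sum.cong) (simp_all add: algebra_simps add_divide_distrib)
  also have "\<dots> = pi * (-1) ^ n * (-2 + 1) ^ n + pi * (-1) ^ n * (real n * (-2) * (1 + -2) ^ (n - 1))"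
    unfolding sum.distrib sum_distrib_left[symmetric] sum_binomial_index by (simp only: binomial_ring)
  also have "\<dots> = pi * (1 + 2 * real n)"
    by (cases n) (simp_all add: algebra_simps flip: power_mult_distrib)
  finally show "(LINT r|lborel. exp (- rad2 r) * (rad2 r * poly_P n (rad2 r))) = pi * (1 + 2 * real n)" .
qed

section \<open>Second-order bounds with cubic error\<close>

lemma powr_taylor:
  fixes \<alpha> v :: real
  assumes a: "0 < \<alpha>" "\<alpha> < 2" and v: "\<bar>v\<bar> \<le> 1 / 2"
  shows "\<bar>(1 + v) powr \<alpha> - (1 + \<alpha> * v + \<alpha> * (\<alpha> - 1) / 2 * v\<^sup>2)\<bar> \<le> 18 * \<bar>v\<bar> ^ 3"
proof (cases "v = 0")
  case False
  define D where "D = (\<lambda>(m::nat) t. if m = 0 then (1 + t) powr \<alpha> else if m = 1 then \<alpha> * (1 + t) powr (\<alpha> - 1)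
    else if m = 2 then \<alpha> * (\<alpha> - 1) * (1 + t) powr (\<alpha> - 2) else \<alpha> * (\<alpha> - 1) * (\<alpha> - 2) * (1 + t) powr (\<alpha> - 3))"
  have "\<exists>t. (if v < 0 then v < t \<and> t < 0 else 0 < t \<and> t < v) \<and>
     (1 + v) powr \<alpha> = (\<Sum>m<3. (D m 0 / fact m) * (v - 0) ^ m) + (D 3 t / fact 3) * (v - 0) ^ 3"
  proof (rule Taylor[where a = "-1/2" and b = "1/2"])
    show "\<forall>m t. m < 3 \<and> - 1 / 2 \<le> t \<and> t \<le> 1 / 2 \<longrightarrow> (D m has_real_derivative D (Suc m) t) (at t)"
    proof (intro allI impI)
      fix m :: nat and t :: real
      assume "m < 3 \<and> - 1 / 2 \<le> t \<and> t \<le> 1 / 2"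
      then have t: "1 + t > 0" and "m = 0 \<or> m = 1 \<or> m = 2" by auto
      then show "(D m has_real_derivative D (Suc m) t) (at t)"
      proof (elim disjE)
        have "((\<lambda>t. (1 + t) powr b) has_real_derivative b * (1 + t) powr (b - 1) * 1) (at t)" for b
          by (rule DERIV_chain2[where f = "\<lambda>z. z powr b" and g = "\<lambda>t. 1 + t"], rule has_real_derivative_powr[OF t])
             (auto intro!: derivative_eq_intros)
        then have p: "((\<lambda>t. (1 + t) powr b) has_real_derivative b * (1 + t) powr (b - 1)) (at t)" for b
          by (simp only: mult_1_right)
        show ?thesis if "m = 0" using p[of \<alpha>] by (simp add: D_def that)
        show ?thesis if "m = 1" using DERIV_cmult[OF p[of "\<alpha> - 1"], of \<alpha>] by (simp add: D_def that mult.assoc)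
        show ?thesis if "m = 2" using DERIV_cmult[OF p[of "\<alpha> - 2"], of "\<alpha> * (\<alpha> - 1)"] by (simp add: D_def that mult.assoc)
      qed
    qed
  qed (use v False in \<open>auto simp: D_def\<close>)
  then obtain t where t': "if v < 0 then v < t \<and> t < 0 else 0 < t \<and> t < v" and
    e: "(1 + v) powr \<alpha> = (\<Sum>m<3. (D m 0 / fact m) * v ^ m) + (D 3 t / fact 3) * v ^ 3"
    unfolding diff_zero by blast
  have t: "\<bar>t\<bar> \<le> 1 / 2" using t' v by (auto split: if_splits)
  have "(\<Sum>m<3. (D m 0 / fact m) * v ^ m) = 1 + \<alpha> * v + \<alpha> * (\<alpha> - 1) / 2 * v\<^sup>2"
    by (simp add: D_def numeral_3_eq_3 power2_eq_square)
  \<comment> \<open>Since 1 + t is at least 1 / 2, the coefficient is at most 4 * 8 / 6. The larger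
    constant 18 is dictated by the range |v| > 1 / 2.\<close>
  moreover have "\<bar>D 3 t / fact 3\<bar> \<le> 18"
  proof -
    have "(1 + t) powr (\<alpha> - 3) \<le> (1 / 2) powr (\<alpha> - 3)"
      using t a by (intro powr_mono2') auto
    also have "\<dots> = 2 powr (3 - \<alpha>)" by (simp add: powr_divide powr_minus_divide[symmetric] flip: powr_minus)
    also have "\<dots> \<le> 2 powr 3" using a by (intro powr_mono) auto
    finally have p: "(1 + t) powr (\<alpha> - 3) \<le> 8" by simp
    have "\<bar>\<alpha> * (\<alpha> - 1) * (\<alpha> - 2)\<bar> \<le> 2 * 1 * 2"
      unfolding abs_mult using a by (intro mult_mono) auto
    then have "\<bar>\<alpha> * (\<alpha> - 1) * (\<alpha> - 2) * (1 + t) powr (\<alpha> - 3)\<bar> \<le> 4 * 8"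
      unfolding abs_mult[of "_ * _"] by (intro mult_mono) (use p in auto)
    then show ?thesis by (simp add: D_def fact_numeral)
  qed
  then have "\<bar>D 3 t / fact 3 * v ^ 3\<bar> \<le> 18 * \<bar>v\<bar> ^ 3"
    unfolding abs_mult power_abs by (intro mult_right_mono) auto
  ultimately show ?thesis unfolding e by simp
qed simp

lemma mult_ln_taylor:
  fixes v :: real
  assumes v: "\<bar>v\<bar> \<le> 1 / 2"
  shows "\<bar>(1 + v) * ln (1 + v) - (v + v\<^sup>2 / 2)\<bar> \<le> 18 * \<bar>v\<bar> ^ 3"
proof (cases "v = 0")
  case False
  define D where "D = (\<lambda>(m::nat) t. if m = 0 then (1 + t) * ln (1 + t) else if m = 1 then 1 + ln (1 + t)
    else if m = 2 then 1 / (1 + t) else - 1 / (1 + t :: real)\<^sup>2)"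
  have "\<exists>t. (if v < 0 then v < t \<and> t < 0 else 0 < t \<and> t < v) \<and>
     (1 + v) * ln (1 + v) = (\<Sum>m<3. (D m 0 / fact m) * (v - 0) ^ m) + (D 3 t / fact 3) * (v - 0) ^ 3"
  proof (rule Taylor[where a = "-1/2" and b = "1/2"])
    show "\<forall>m t. m < 3 \<and> - 1 / 2 \<le> t \<and> t \<le> 1 / 2 \<longrightarrow> (D m has_real_derivative D (Suc m) t) (at t)"
    proof (intro allI impI)
      fix m :: nat and t :: real
      assume "m < 3 \<and> - 1 / 2 \<le> t \<and> t \<le> 1 / 2"
      then have t: "1 + t > 0" and "m = 0 \<or> m = 1 \<or> m = 2" by auto
      then show "(D m has_real_derivative D (Suc m) t) (at t)"
        unfolding D_def by (elim disjE) (auto intro!: derivative_eq_intros simp: power2_eq_square)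
    qed
  qed (use v False in \<open>auto simp: D_def\<close>)
  then obtain t where t': "if v < 0 then v < t \<and> t < 0 else 0 < t \<and> t < v" and
    e: "(1 + v) * ln (1 + v) = (\<Sum>m<3. (D m 0 / fact m) * v ^ m) + (D 3 t / fact 3) * v ^ 3"
    unfolding diff_zero by blast
  have t: "\<bar>t\<bar> \<le> 1 / 2" using t' v by (auto split: if_splits)
  have "(\<Sum>m<3. (D m 0 / fact m) * v ^ m) = v + v\<^sup>2 / 2"
    by (simp add: D_def numeral_3_eq_3 power2_eq_square)
  moreover have "\<bar>D 3 t / fact 3\<bar> \<le> 18"
  proof -
    have "(1 / 2)\<^sup>2 \<le> (1 + t)\<^sup>2" using t by (intro power_mono) auto
    then have "1 / (1 + t)\<^sup>2 \<le> 4" using t by (simp add: field_simps power2_eq_square)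
    then show ?thesis by (simp add: D_def fact_numeral)
  qed
  then have "\<bar>D 3 t / fact 3 * v ^ 3\<bar> \<le> 18 * \<bar>v\<bar> ^ 3"
    unfolding abs_mult power_abs by (intro mult_right_mono) auto
  ultimately show ?thesis unfolding e by simp
qed simp

text \<open>Makes the bounds below trivial away from \<open>v = 0\<close>; the constant 18 is \<open>8 + 2 * 4 + 2\<close>.\<close>

lemma cubic_dominates:
  fixes v :: real
  assumes "\<bar>v\<bar> > 1 / 2"
  shows "1 \<le> 8 * \<bar>v\<bar> ^ 3" "\<bar>v\<bar> \<le> 4 * \<bar>v\<bar> ^ 3" "v\<^sup>2 \<le> 2 * \<bar>v\<bar> ^ 3"
proof -
  define a where "a = \<bar>v\<bar>"
  have a: "a \<ge> 1 / 2" using assms by (simp add: a_def)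
  have v2: "v\<^sup>2 = a\<^sup>2" by (simp add: a_def)
  have 3: "a\<^sup>2 * 1 \<le> a\<^sup>2 * (2 * a)" using a by (intro mult_left_mono) auto
  have 2: "a * 1 \<le> a * (2 * a)" using a by (intro mult_left_mono) auto
  have "a\<^sup>2 \<le> 2 * a ^ 3" using 3 by (simp add: power2_eq_square power3_eq_cube)
  moreover have "a \<le> 2 * a\<^sup>2" using 2 by (simp add: power2_eq_square)
  ultimately show "v\<^sup>2 \<le> 2 * \<bar>v\<bar> ^ 3" "\<bar>v\<bar> \<le> 4 * \<bar>v\<bar> ^ 3" "1 \<le> 8 * \<bar>v\<bar> ^ 3"
    unfolding v2 a_def[symmetric] using a by linarith+
qed

text \<open>The positive part is taken because 1 + v may be negative where only the thermal part
  restores positivity. For |v| > 1 / 2 the left side is at most 1 + |v|, which the cubic term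
  dominates together with the polynomial terms.\<close>

lemma powr_le_second_order:
  fixes \<alpha> v :: real
  assumes a: "0 < \<alpha>" "\<alpha> < 1"
  shows "(max 0 (1 + v)) powr \<alpha> \<le> 1 + \<alpha> * v + \<alpha> * (\<alpha> - 1) / 2 * v\<^sup>2 + 18 * \<bar>v\<bar> ^ 3"
proof (cases "\<bar>v\<bar> \<le> 1 / 2")
  case True
  then show ?thesis using powr_taylor[of \<alpha> v] a by (auto simp: max_def abs_le_iff)
next
  case False
  let ?x = "max 0 (1 + v)"
  have "?x powr \<alpha> \<le> 1 + \<bar>v\<bar>"
  proof (cases "?x \<le> 1")
    case True
    then have "?x powr \<alpha> \<le> 1" using a by (intro powr_le1) auto
    then show ?thesis by simp
  next
    case False
    then have "?x powr \<alpha> \<le> ?x powr 1" using a by (intro powr_mono) auto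
    then show ?thesis using False by (auto simp: max_def split: if_splits)
  qed
  moreover have "- \<bar>v\<bar> \<le> \<alpha> * v"
  proof -
    have "\<bar>\<alpha> * v\<bar> \<le> 1 * \<bar>v\<bar>" unfolding abs_mult using a by (intro mult_right_mono) auto
    then show ?thesis by linarith
  qed
  moreover have "- (v\<^sup>2) \<le> \<alpha> * (\<alpha> - 1) / 2 * v\<^sup>2"
  proof -
    have "\<alpha> * (1 - \<alpha>) \<le> 1 * 1" using a by (intro mult_mono) auto
    then have "-1 * v\<^sup>2 \<le> \<alpha> * (\<alpha> - 1) / 2 * v\<^sup>2" by (intro mult_right_mono) (auto simp: algebra_simps)
    then show ?thesis by simp
  qed
  ultimately show ?thesis
    using cubic_dominates[of v] False zero_le_power[OF abs_ge_zero, of v 3] by linarith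
qed

text \<open>y stands for the full density, which exceeds 1 + v by the thermal part; monotonicity
  removes the difference. For |v| > 1 / 2 the left side is not positive, because 1 + 2 |v| + v^2 is
  at most 18 |v|^3.\<close>

lemma powr_ge_second_order:
  fixes \<alpha> v y :: real
  assumes a: "1 < \<alpha>" "\<alpha> < 2" and y: "0 \<le> y" "1 + v \<le> y"
  shows "1 + \<alpha> * v + \<alpha> * (\<alpha> - 1) / 2 * v\<^sup>2 - 18 * \<bar>v\<bar> ^ 3 \<le> y powr \<alpha>"
proof (cases "\<bar>v\<bar> \<le> 1 / 2")
  case True
  then have "(1 + v) powr \<alpha> \<le> y powr \<alpha>" using a y by (intro powr_mono2) auto
  then show ?thesis using powr_taylor[of \<alpha> v] a True by (auto simp: abs_le_iff)
next
  case False
  have "\<alpha> * v \<le> 2 * \<bar>v\<bar>"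
  proof -
    have "\<bar>\<alpha> * v\<bar> \<le> 2 * \<bar>v\<bar>" unfolding abs_mult using a by (intro mult_right_mono) auto
    then show ?thesis by linarith
  qed
  moreover have "\<alpha> * (\<alpha> - 1) / 2 * v\<^sup>2 \<le> v\<^sup>2"
  proof -
    have "\<alpha> * (\<alpha> - 1) \<le> 2 * 1" using a by (intro mult_mono) auto
    then have "\<alpha> * (\<alpha> - 1) / 2 * v\<^sup>2 \<le> 1 * v\<^sup>2" by (intro mult_right_mono) auto
    then show ?thesis by simp
  qed
  ultimately have "1 + \<alpha> * v + \<alpha> * (\<alpha> - 1) / 2 * v\<^sup>2 - 18 * \<bar>v\<bar> ^ 3 \<le> 0"
    using cubic_dominates[of v] False by linarith
  then show ?thesis using powr_ge_zero[of y \<alpha>] by linarith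
qed

text \<open>The convex function x ln x lies above its tangent at z; with the default
  \<open>ln 0 = 0\<close> this includes y = 0.\<close>

lemma mult_ln_ge:
  fixes y z :: real
  assumes "0 \<le> y" "0 < z"
  shows "y * ln y \<ge> z * ln z + (1 + ln z) * (y - z)"
proof (cases "y = 0")
  case False
  then have y: "y > 0" using assms by simp
  have "ln (z / y) \<le> z / y - 1" using assms y by (intro ln_le_minus_one) simp
  then have "y * (ln z - ln y) \<le> y * (z / y - 1)"
    using y assms by (intro mult_left_mono) (auto simp: ln_div)
  also have "\<dots> = z - y" using y by (simp add: algebra_simps)
  finally show ?thesis by (simp add: algebra_simps)
qed (use assms in \<open>simp add: algebra_simps\<close>)

text \<open>x ln x is not monotone, but its tangent at 1 + v has slope 1 + ln (1 + v), which is
  nonnegative as soon as 1 + v is at least 1 / 2; so replacing 1 + v by the larger y does not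
  decrease the value.\<close>

lemma mult_ln_ge_second_order:
  fixes v y :: real
  assumes y: "0 \<le> y" "1 + v \<le> y"
  shows "v + v\<^sup>2 / 2 - 18 * \<bar>v\<bar> ^ 3 \<le> y * ln y"
proof (cases "\<bar>v\<bar> \<le> 1 / 2")
  case True
  then have z: "1 + v \<ge> 1 / 2" by auto
  have "- ln (1 + v) = ln (1 / (1 + v))" using z by (simp add: ln_div)
  also have "\<dots> \<le> 1 / (1 + v) - 1" using z by (intro ln_le_minus_one) simp
  also have "\<dots> \<le> 1" using z by (simp add: field_simps)
  finally have "0 \<le> (1 + ln (1 + v)) * (y - (1 + v))" using y by (intro mult_nonneg_nonneg) auto
  then have "(1 + v) * ln (1 + v) \<le> y * ln y"
    using mult_ln_ge[OF y(1), of "1 + v"] z by linarith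
  then show ?thesis using mult_ln_taylor[OF True] by (auto simp: abs_le_iff)
next
  case False
  \<comment> \<open>The tangent at 1 gives y - 1 as a lower bound.\<close>
  have "-1 \<le> y * ln y" using mult_ln_ge[OF y(1), of 1] y(1) by simp
  then show ?thesis
    using cubic_dominates[of v] False abs_ge_self[of v] zero_le_power[OF abs_ge_zero, of v 3] by linarith
qed

text \<open>After scaling to a + b = 1 it suffices that u is at most \<open>u powr \<alpha>\<close>
  on the unit interval.\<close>

lemma powr_add_le:
  fixes a b \<alpha> :: real
  assumes "0 \<le> a" "0 \<le> b" "0 < \<alpha>" "\<alpha> \<le> 1"
  shows "(a + b) powr \<alpha> \<le> a powr \<alpha> + b powr \<alpha>"
proof (cases "a + b = 0")
  case False
  then have s: "a + b > 0" using assms by simp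
  have le: "u \<le> u powr \<alpha>" if "0 \<le> u" "u \<le> 1" for u :: real
    using powr_mono'[of \<alpha> 1 u] that assms by simp
  have "1 = a / (a + b) + b / (a + b)" using s by (simp flip: add_divide_distrib)
  also have "\<dots> \<le> (a / (a + b)) powr \<alpha> + (b / (a + b)) powr \<alpha>"
    using assms s by (intro add_mono le) (auto simp: field_simps)
  also have "\<dots> = (a powr \<alpha> + b powr \<alpha>) / (a + b) powr \<alpha>"
    using assms by (simp add: powr_divide add_divide_distrib)
  finally show ?thesis using s by (simp add: le_divide_eq)
qed (use assms in auto)

text \<open>Reduces integrability at \<alpha> = 1 to the orders 1 / 2 and 2. Large w uses ln w <= w;
  small w uses the same bound for 1 / \<open>sqrt w\<close>.\<close>

lemma abs_mult_ln_le:
  fixes w :: real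
  assumes "w \<ge> 0"
  shows "\<bar>w * ln w\<bar> \<le> 2 * w powr (1 / 2) + w powr 2"
proof (cases "w = 0")
  case False
  then have w: "w > 0" using assms by simp
  define u where "u = sqrt w"
  have u: "u > 0" "w = u\<^sup>2" "w powr (1 / 2) = u" "w powr 2 = w\<^sup>2" 
    using w by (auto simp: u_def powr_half_sqrt)
  have "ln w \<le> w" using ln_le_minus_one[OF w] by simp
  then have 1: "w * ln w \<le> w * w" using w by (intro mult_left_mono) auto
  have "- ln w = 2 * ln (1 / u)" using u by (simp add: ln_div ln_realpow)
  also have "\<dots> \<le> 2 * (1 / u)"
    using ln_le_minus_one[of "1 / u"] u by simp
  finally have "w * - ln w \<le> w * (2 * (1 / u))" using w by (intro mult_left_mono) auto
  also have "\<dots> = 2 * u" using u by (simp add: power2_eq_square)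
  finally have 2: "- (w * ln w) \<le> 2 * u" by simp
  show ?thesis unfolding u(3,4) power2_eq_square
    using 1 2 u(1) mult_nonneg_nonneg[OF assms assms] by linarith
qed simp

text \<open>Compare coefficients: those on the right are binomial, so at least 1, and for n >= 3 the
  interior ones exceed 1. At n = 2 both sides equal 1 + u.\<close>

lemma sum_power_less_power:
  fixes u :: real
  assumes "u > 0" "n \<ge> 3"
  shows "(\<Sum>k<n. u ^ k) < (1 + u) ^ (n - 1)"
  using assms(2)
proof (induction n rule: dec_induct)
  case base
  then show ?case using assms by (simp add: numeral_3_eq_3 power2_eq_square algebra_simps)
next
  case (step n)
  have "(\<Sum>k<Suc n. u ^ k) = 1 + u * (\<Sum>k<n. u ^ k)"
    by (subst sum.lessThan_Suc_shift) (simp add: sum_distrib_left)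
  also have "\<dots> < 1 + u * (1 + u) ^ (n - 1)" using step assms by simp
  also have "\<dots> \<le> (1 + u) ^ (n - 1) + u * (1 + u) ^ (n - 1)" using assms by simp
  also have "\<dots> = (1 + u) ^ Suc (n - 1)" by (simp add: algebra_simps)
  finally show ?case using step by simp
qed

lemma entropy_coefficient:
  fixes \<alpha> :: real
  assumes "0 < \<alpha>" "\<alpha> < 2" "n \<ge> 3"
  shows "\<alpha> < 1 \<Longrightarrow> ((2 - \<alpha>) / \<alpha>) ^ n - 1 + (\<alpha> - 1) * (2 / \<alpha>) ^ n < 0"
    and "\<alpha> > 1 \<Longrightarrow> ((2 - \<alpha>) / \<alpha>) ^ n - 1 + (\<alpha> - 1) * (2 / \<alpha>) ^ n > 0"
proof -
  define u where "u = (2 - \<alpha>) / \<alpha>"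
  have u: "u > 0" using assms by (simp add: u_def)
  have t: "2 / \<alpha> = 1 + u" using assms by (simp add: u_def field_simps)
  have n: "n = Suc (n - 1)" using assms by simp
  \<comment> \<open>In terms of u, \<alpha> = 2 / (1 + u). Thus one factor 1 + u turns \<alpha> - 1
    into 1 - u, and u - 1 can be split off from the whole coefficient.\<close>
  have "(\<alpha> - 1) * (1 + u) = 1 - u" using assms by (simp add: u_def field_simps)
  then have "(\<alpha> - 1) * (2 / \<alpha>) ^ n = (1 - u) * (1 + u) ^ (n - 1)"
    unfolding t by (subst n) (simp flip: mult.assoc)
  moreover have "u ^ n - 1 = (u - 1) * (\<Sum>k<n. u ^ k)"
    by (rule power_diff_1_eq)
  ultimately have e: "((2 - \<alpha>) / \<alpha>) ^ n - 1 + (\<alpha> - 1) * (2 / \<alpha>) ^ n = (u - 1) * ((\<Sum>k<n. u ^ k) - (1 + u) ^ (n - 1))"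
    unfolding u_def[symmetric] by (simp add: algebra_simps)
  have neg: "(\<Sum>k<n. u ^ k) - (1 + u) ^ (n - 1) < 0"
    using sum_power_less_power[OF u assms(3)] by simp
  show "((2 - \<alpha>) / \<alpha>) ^ n - 1 + (\<alpha> - 1) * (2 / \<alpha>) ^ n < 0" if "\<alpha> < 1"
  proof -
    have "u > 1" using that assms by (simp add: u_def field_simps)
    then show ?thesis unfolding e using neg by (simp add: mult_pos_neg)
  qed
  show "((2 - \<alpha>) / \<alpha>) ^ n - 1 + (\<alpha> - 1) * (2 / \<alpha>) ^ n > 0" if "\<alpha> > 1"
  proof -
    have "u < 1" using that assms by (simp add: u_def field_simps)
    then show ?thesis unfolding e using neg by (simp add: mult_neg_neg)
  qed
qed

lemma two_mult_less_power:
  assumes "n \<ge> 3"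
  shows "2 * real n < 2 ^ n"
  using assms
proof (induction n rule: dec_induct)
  case (step n)
  then show ?case by simp
qed simp

section \<open>Size of the thermal admixture and positivity\<close>

text \<open>A real infimum bounds its set only if a lower bound exists. Here the positive leading
  coefficient controls large x, and compactness the rest of the half-line.\<close>

lemma bdd_below_poly_P: "bdd_below (poly_P n ` {0..})"
proof -
  define c where "c k = (-1) ^ n * (real (n choose k) * (-2) ^ k / fact k)" for k
  define p where "p = (\<Sum>k\<le>n. monom (c k) k)"
  have pp: "poly p x = poly_P n x" for x
    unfolding p_def poly_P_eq c_def by (simp add: poly_sum poly_monom)
  show ?thesis
  proof (cases "n = 0")
    case True
    then show ?thesis by (auto simp: poly_P_eq intro!: bdd_belowI[of _ 1])
  next
    case False
    have cf: "coeff p k = (if k \<le> n then c k else 0)" for k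
      unfolding p_def by (simp add: coeff_sum)
    have cn: "c n > 0"
      unfolding c_def by (simp flip: power_mult_distrib mult.assoc)
    have deg: "degree p = n"
      by (rule antisym[OF degree_le le_degree]) (use cn in \<open>auto simp: cf\<close>)
    then have lc: "lead_coeff p > 0" using cn by (simp add: cf)
    obtain X where X: "\<And>x. x \<ge> X \<Longrightarrow> poly p x \<ge> lead_coeff p"
      using poly_pinfty_gt_lc[OF lc] by auto
    have "compact (poly p ` {0..max 0 X})"
      by (intro compact_continuous_image continuous_intros) auto
    then have "bdd_below (poly p ` {0..max 0 X})" by (intro bounded_imp_bdd_below compact_imp_bounded)
    then obtain B where "\<forall>x\<in>{0..max 0 X}. B \<le> poly p x"
      unfolding bdd_below_def by auto
    then have B: "\<And>x. 0 \<le> x \<Longrightarrow> x \<le> max 0 X \<Longrightarrow> B \<le> poly p x" by auto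
    have "min B 0 \<le> poly_P n x" if "x \<ge> 0" for x
    proof (cases "x \<le> max 0 X")
      case True
      then show ?thesis using B[OF that] unfolding pp[symmetric] by simp
    next
      case False
      then have "0 \<le> poly p x" using X[of x] lc by fastforce
      then show ?thesis unfolding pp[symmetric] by simp
    qed
    then show ?thesis by (intro bdd_belowI[of _ "min B 0"]) auto
  qed
qed

lemma poly_P_ge: "x \<ge> 0 \<Longrightarrow> - const_M n \<le> poly_P n x"
  using cINF_lower[OF bdd_below_poly_P[of n], of x] by (simp add: const_M_def)

lemma const_M_nonneg: "const_M n \<ge> 0"
  by (simp add: const_M_def)

lemma beta_pos: "beta_coeff n > 0"
  by (simp add: beta_coeff_eq)

locale family =
  fixes n :: nat and \<nu> K :: real
  assumes n3: "n \<ge> 3" and nu: "\<nu> > 0" and K1: "K > 1"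
begin

abbreviation "s \<equiv> s_par \<nu>"
abbreviation "c \<equiv> c_par \<nu>"
abbreviation "\<beta> \<equiv> beta_coeff n"
abbreviation "\<delta> \<equiv> delta n \<nu> K"

lemma s1: "s > 1" using nu by (simp add: s_par_def)

lemma c_pos: "c > 0" and c_eq: "1 - c = 1 / s"
  using s1 by (auto simp: c_par_def field_simps)

lemma ev_margin: "\<forall>\<^sub>F \<epsilon> in at_right 0. 1 / 2 \<le> 1 - (1 + const_M n) * \<epsilon>\<^sup>2"
proof -
  have "((\<lambda>\<epsilon>. 1 - (1 + const_M n) * \<epsilon>\<^sup>2) \<longlongrightarrow> 1 - (1 + const_M n) * 0\<^sup>2) (at_right (0::real))"
    by (intro tendsto_intros)
  then have "\<forall>\<^sub>F \<epsilon> in at_right 0. 1 / 2 < 1 - (1 + const_M n) * \<epsilon>\<^sup>2"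
    by (rule order_tendstoD) simp
  then show ?thesis by eventually_elim simp
qed

lemma ev_pos: "\<forall>\<^sub>F \<epsilon> in at_right (0::real). 0 < \<epsilon>"
  by (rule eventually_at_right_less)

lemma x_minus_powr:
  assumes "0 < \<epsilon>" "0 < 1 - (1 + const_M n) * \<epsilon>\<^sup>2"
  shows "x_minus n \<epsilon> > 0" "x_minus n \<epsilon> powr (real n / 2) = (1 - (1 + const_M n) * \<epsilon>\<^sup>2) / (2 * \<epsilon> * \<beta>)"
  using assms n3 beta_pos[of n] by (auto simp: x_minus_def powr_powr)

text \<open>Only 1 / 2 of the numerator is kept, which still shows growth of order
  \<open>\<epsilon> powr (- 2 / n)\<close>.\<close>

lemma x_minus_ge:
  assumes "0 < \<epsilon>" "1 / 2 \<le> 1 - (1 + const_M n) * \<epsilon>\<^sup>2"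
  shows "(1 / (4 * \<beta>) / \<epsilon>) powr (2 / real n) \<le> x_minus n \<epsilon>"
  unfolding x_minus_def
proof (rule powr_mono2)
  have "1 / (4 * \<beta>) / \<epsilon> = (1 / 2) / (2 * \<epsilon> * \<beta>)" by simp
  also have "\<dots> \<le> (1 - (1 + const_M n) * \<epsilon>\<^sup>2) / (2 * \<epsilon> * \<beta>)"
    using assms beta_pos[of n] by (intro divide_right_mono) auto
  finally show "1 / (4 * \<beta>) / \<epsilon> \<le> (1 - (1 + const_M n) * \<epsilon>\<^sup>2) / (2 * \<epsilon> * \<beta>)" .
qed (use assms beta_pos[of n] in auto)

text \<open>The factor 2 \<epsilon> \<beta> cancels against
  \<open>x_minus n \<epsilon> powr (n / 2)\<close>, so all smallness of \<delta> is in the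
  exponential.\<close>

lemma delta_eq:
  assumes "0 < \<epsilon>" "0 < 1 - (1 + const_M n) * \<epsilon>\<^sup>2"
  shows "\<delta> \<epsilon> = K * s * (1 - (1 + const_M n) * \<epsilon>\<^sup>2) * exp (- c * x_minus n \<epsilon>)"
  unfolding delta_def x_minus_powr(2)[OF assms] using assms beta_pos[of n] by simp

text \<open>The exponent is at most a negative constant times a positive power of 1 / \<epsilon>,
  which beats every \<open>\<epsilon> ^ m\<close>. The freedom in m pays for entropies of small
  order, where \<open>\<delta> powr \<alpha>\<close> must still be cubic in \<epsilon>.\<close>

lemma ev_delta: "\<forall>\<^sub>F \<epsilon> in at_right 0. 0 < \<delta> \<epsilon> \<and> \<delta> \<epsilon> \<le> \<epsilon> ^ m"
proof -
  \<comment> \<open>Generic positive parameters keep the structure of the concrete constants out of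
    the asymptotic computation.\<close>
  have lim: "((\<lambda>\<epsilon>. B * exp (- d * (g / \<epsilon>) powr p) / \<epsilon> ^ m) \<longlongrightarrow> 0) (at_right 0)"
    if "B > 0" "d > 0" "g > 0" "p > 0" for B d g p :: real
    using that by real_asymp
  have "((\<lambda>\<epsilon>. K * s * exp (- c * (1 / (4 * \<beta>) / \<epsilon>) powr (2 / real n)) / \<epsilon> ^ m) \<longlongrightarrow> 0) (at_right 0)"
    by (rule lim) (use K1 s1 c_pos beta_pos[of n] n3 in auto)
  then have "\<forall>\<^sub>F \<epsilon> in at_right 0. K * s * exp (- c * (1 / (4 * \<beta>) / \<epsilon>) powr (2 / real n)) / \<epsilon> ^ m < 1"
    by (rule order_tendstoD) simp
  then show ?thesis
    using ev_margin ev_pos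
  proof eventually_elim
    case (elim \<epsilon>)
    then have A: "0 < 1 - (1 + const_M n) * \<epsilon>\<^sup>2" by linarith
    have A1: "1 - (1 + const_M n) * \<epsilon>\<^sup>2 \<le> 1" using const_M_nonneg[of n] by simp
    have pos: "0 < \<delta> \<epsilon>" unfolding delta_eq[OF elim(3) A] using A K1 s1 by simp
    have "\<delta> \<epsilon> \<le> K * s * 1 * exp (- c * (1 / (4 * \<beta>) / \<epsilon>) powr (2 / real n))"
      unfolding delta_eq[OF elim(3) A]
      using x_minus_ge[OF elim(3,2)] A A1 K1 s1 c_pos by (intro mult_mono) (auto simp: mult_le_cancel_left)
    also have "\<dots> \<le> \<epsilon> ^ m" using elim by (simp add: divide_less_eq)
    finally show ?case using pos by simp
  qed
qed

text \<open>The function x^(n/2) exp (-c x) has its maximum at n / (2 c) and decreases afterwards,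
  so compensation established at \<open>x_minus\<close> persists at all larger radii.\<close>

lemma ev_x_minus: "\<forall>\<^sub>F \<epsilon> in at_right 0. real n / (2 * c) \<le> x_minus n \<epsilon>"
proof -
  have lim: "filterlim (\<lambda>\<epsilon>. (g / \<epsilon>) powr p) at_top (at_right 0)" if "g > 0" "p > 0" for g p :: real
    using that by real_asymp
  have "filterlim (\<lambda>\<epsilon>. (1 / (4 * \<beta>) / \<epsilon>) powr (2 / real n)) at_top (at_right 0)"
    by (rule lim) (use beta_pos[of n] n3 in auto)
  then have "\<forall>\<^sub>F \<epsilon> in at_right 0. real n / (2 * c) \<le> (1 / (4 * \<beta>) / \<epsilon>) powr (2 / real n)"
    unfolding filterlim_at_top by blast
  then show ?thesis using ev_margin ev_pos
  proof eventually_elim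
    case (elim \<epsilon>)
    then show ?case using x_minus_ge[of \<epsilon>] by linarith
  qed
qed

definition density :: "real \<Rightarrow> real \<times> real \<Rightarrow> real" where
  "density \<epsilon> r = (1 - \<delta> \<epsilon>) * (1 - \<epsilon>\<^sup>2 + \<epsilon>\<^sup>2 * poly_P n (rad2 r) + 2 * \<epsilon> * sqrt (1 - \<epsilon>\<^sup>2) * \<beta> * Re (zc r ^ n))
      + \<delta> \<epsilon> * (exp (c * rad2 r) / s)"

text \<open>The interference term is at least -b x^(n/2), and the rest of the pure part at least
  \<open>a\<close>. These balance exactly at x = X, by the choice of \<open>x_minus\<close>. Beyond
  X the thermal term outweighs the interference term, because x^(n/2) exp (-c x) decreases there and
  \<delta> is K times what is needed at X.\<close>

lemma density_nonneg:
  assumes e: "0 < \<epsilon>" "\<epsilon> \<le> 1" and A: "0 < 1 - (1 + const_M n) * \<epsilon>\<^sup>2" and d: "0 < \<delta> \<epsilon>" "\<delta> \<epsilon> \<le> 1"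
    and x: "real n / (2 * c) \<le> x_minus n \<epsilon>"
  shows "0 \<le> density \<epsilon> r"
proof -
  define X where "X = x_minus n \<epsilon>"
  define x where "x = rad2 r"
  define a where "a = 1 - (1 + const_M n) * \<epsilon>\<^sup>2"
  define b where "b = 2 * \<epsilon> * \<beta>"
  have b: "b > 0" using e beta_pos[of n] by (simp add: b_def)
  have X: "X > 0" "X powr (real n / 2) = a / b"
    using x_minus_powr[OF e(1) A] by (auto simp: X_def a_def b_def)
  have x0: "x \<ge> 0" by (simp add: x_def)
  have z: "\<bar>Re (zc r ^ n)\<bar> \<le> x powr (real n / 2)"
  proof -
    have "\<bar>Re (zc r ^ n)\<bar> \<le> cmod (zc r) ^ n" using abs_Re_le_cmod[of "zc r ^ n"] by (simp add: norm_power)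
    also have "cmod (zc r) = sqrt x" by (simp add: x_def flip: cmod_zc_sq)
    also have "sqrt x ^ n = x powr (real n / 2)"
    proof (cases "x = 0")
      case False
      then show ?thesis using x0 by (simp add: powr_half_sqrt[symmetric] powr_powr flip: powr_realpow)
    qed (use n3 in simp)
    finally show ?thesis .
  qed
  have "2 * \<epsilon> * sqrt (1 - \<epsilon>\<^sup>2) * \<beta> * Re (zc r ^ n) = b * (sqrt (1 - \<epsilon>\<^sup>2) * Re (zc r ^ n))"
    by (simp add: b_def)
  also have "\<dots> \<ge> b * (- (x powr (real n / 2)))"
  proof (rule mult_left_mono)
    have "\<bar>sqrt (1 - \<epsilon>\<^sup>2) * Re (zc r ^ n)\<bar> \<le> 1 * x powr (real n / 2)"
      unfolding abs_mult using e by (intro mult_mono z) (auto simp: abs_square_le_1)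
    then show "- (x powr (real n / 2)) \<le> sqrt (1 - \<epsilon>\<^sup>2) * Re (zc r ^ n)" by (simp add: abs_le_iff)
  qed (use b in simp)
  finally have cr: "- b * x powr (real n / 2) \<le> 2 * \<epsilon> * sqrt (1 - \<epsilon>\<^sup>2) * \<beta> * Re (zc r ^ n)" by simp
  have "\<epsilon>\<^sup>2 * - const_M n \<le> \<epsilon>\<^sup>2 * poly_P n x"
    using poly_P_ge[OF x0, of n] by (intro mult_left_mono) auto
  then have br: "a - b * x powr (real n / 2) \<le> 1 - \<epsilon>\<^sup>2 + \<epsilon>\<^sup>2 * poly_P n x + 2 * \<epsilon> * sqrt (1 - \<epsilon>\<^sup>2) * \<beta> * Re (zc r ^ n)"
    using cr by (simp add: a_def algebra_simps)
  have th: "0 \<le> \<delta> \<epsilon> * (exp (c * x) / s)" using d s1 by simp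
  show ?thesis
  proof (cases "x \<le> X")
    case True
    have "x powr (real n / 2) \<le> a / b" unfolding X(2)[symmetric] using True x0 by (intro powr_mono2) auto
    then have "0 \<le> a - b * x powr (real n / 2)" using b by (simp add: field_simps)
    with br have "0 \<le> 1 - \<epsilon>\<^sup>2 + \<epsilon>\<^sup>2 * poly_P n x + 2 * \<epsilon> * sqrt (1 - \<epsilon>\<^sup>2) * \<beta> * Re (zc r ^ n)" by linarith
    then have "0 \<le> (1 - \<delta> \<epsilon>) * (1 - \<epsilon>\<^sup>2 + \<epsilon>\<^sup>2 * poly_P n x + 2 * \<epsilon> * sqrt (1 - \<epsilon>\<^sup>2) * \<beta> * Re (zc r ^ n))"
      using d by (intro mult_nonneg_nonneg[of "1 - \<delta> \<epsilon>"]) auto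
    then show ?thesis unfolding density_def x_def[symmetric] using th by linarith
  next
    case False
    then have xX: "x > X" "x > 0" using X by auto
    \<comment> \<open>This replaces a monotonicity argument by derivatives: with n / (2 X) <= c it
      yields (x / X)^(n/2) <= exp (c (x - X)).\<close>
    have "ln (x / X) \<le> x / X - 1" using xX X by (intro ln_le_minus_one) simp
    then have "real n / 2 * ln (x / X) \<le> real n / 2 * ((x - X) / X)"
      using X by (intro mult_left_mono) (auto simp: diff_divide_distrib)
    also have "\<dots> = real n / (2 * X) * (x - X)" by simp
    also have "\<dots> \<le> c * (x - X)"
      using x xX X c_pos by (intro mult_right_mono) (auto simp: X_def[symmetric] field_simps)
    finally have "(x / X) powr (real n / 2) \<le> exp (c * (x - X))"
      using xX X by (simp add: powr_def)
    then have "x powr (real n / 2) \<le> X powr (real n / 2) * exp (c * (x - X))"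
      using xX X(1) by (simp add: powr_divide field_simps)
    also have "\<dots> = X powr (real n / 2) * exp (- c * X) * exp (c * x)"
      by (simp add: algebra_simps flip: exp_add)
    finally have "b * x powr (real n / 2) \<le> b * (X powr (real n / 2) * exp (- c * X) * exp (c * x))"
      using b by (intro mult_left_mono) auto
    also have "\<dots> = 1 * (b * X powr (real n / 2) * exp (- c * X) * exp (c * x))" by simp
    also have "\<dots> \<le> K * (b * X powr (real n / 2) * exp (- c * X) * exp (c * x))"
      using K1 b by (intro mult_right_mono) auto
    also have "\<dots> = \<delta> \<epsilon> * (exp (c * x) / s)"
      using s1 by (simp add: delta_def X_def b_def)
    finally have 1: "b * x powr (real n / 2) \<le> \<delta> \<epsilon> * (exp (c * x) / s)" .
    \<comment> \<open>As \<open>a\<close> is positive, the pure part is bounded below by the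
      interference term alone, and the factor 1 - \<delta> can only lessen its negativity.\<close>
    have "(1 - \<delta> \<epsilon>) * (- (b * x powr (real n / 2))) \<le>
      (1 - \<delta> \<epsilon>) * (1 - \<epsilon>\<^sup>2 + \<epsilon>\<^sup>2 * poly_P n x + 2 * \<epsilon> * sqrt (1 - \<epsilon>\<^sup>2) * \<beta> * Re (zc r ^ n))"
      using br A d by (intro mult_left_mono) (auto simp: a_def)
    moreover have "- (b * x powr (real n / 2)) \<le> (1 - \<delta> \<epsilon>) * (- (b * x powr (real n / 2)))"
      using d b mult_nonneg_nonneg[of "\<delta> \<epsilon>" "b * x powr (real n / 2)"] by (simp add: algebra_simps)
    ultimately show ?thesis unfolding density_def x_def[symmetric] using 1 by linarith
  qed
qed

lemma wigner_rho_density: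
  assumes "0 < \<epsilon>" "\<epsilon> \<le> 1" "0 < \<delta> \<epsilon>" "\<delta> \<epsilon> \<le> 1"
  shows "wigner (rho n \<nu> K \<epsilon>) r = complex_of_real (exp (- rad2 r) / pi * density \<epsilon> r)"
  using wigner_rho[OF nu, of n \<epsilon> K "fst r" "snd r"] assms n3
  by (simp add: density_def rad2_def zc_def)

end

section \<open>Expansion of the entropy\<close>

definition has_gauss_integral :: "real \<Rightarrow> (real \<times> real \<Rightarrow> real) \<Rightarrow> real \<Rightarrow> bool" where
  "has_gauss_integral \<alpha> f I \<longleftrightarrow> has_bochner_integral lborel (\<lambda>r. exp (- \<alpha> * rad2 r) * f r) I"

lemma has_gauss_integralI:
  "integrable lborel (\<lambda>r. exp (- \<alpha> * rad2 r) * f r) \<Longrightarrow> (LINT r|lborel. exp (- \<alpha> * rad2 r) * f r) = I \<Longrightarrow>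
    has_gauss_integral \<alpha> f I"
  by (simp add: has_gauss_integral_def has_bochner_integral_iff)

lemma has_gauss_integralD:
  assumes "has_gauss_integral \<alpha> f I"
  shows "integrable lborel (\<lambda>r. exp (- \<alpha> * rad2 r) * f r)" "(LINT r|lborel. exp (- \<alpha> * rad2 r) * f r) = I"
  using assms by (simp_all add: has_gauss_integral_def has_bochner_integral_iff)

lemma has_gauss_integral_add:
  "has_gauss_integral \<alpha> f I \<Longrightarrow> has_gauss_integral \<alpha> g J \<Longrightarrow> has_gauss_integral \<alpha> (\<lambda>r. f r + g r) (I + J)"
  unfolding has_gauss_integral_def distrib_left by (rule has_bochner_integral_add)

lemma has_gauss_integral_diff:
  "has_gauss_integral \<alpha> f I \<Longrightarrow> has_gauss_integral \<alpha> g J \<Longrightarrow> has_gauss_integral \<alpha> (\<lambda>r. f r - g r) (I - J)"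
  unfolding has_gauss_integral_def right_diff_distrib by (rule has_bochner_integral_diff)

lemma has_gauss_integral_cmult:
  "has_gauss_integral \<alpha> f I \<Longrightarrow> has_gauss_integral \<alpha> (\<lambda>r. a * f r) (a * I)"
  unfolding has_gauss_integral_def mult.left_commute[of _ a] by (rule has_bochner_integral_mult_right)

lemma has_gauss_integral_mono:
  assumes "has_gauss_integral \<alpha> f I" "has_gauss_integral \<alpha> g J" "\<And>r. f r \<le> g r"
  shows "I \<le> J"
proof -
  note f = has_gauss_integralD[OF assms(1)] and g = has_gauss_integralD[OF assms(2)]
  show ?thesis unfolding f(2)[symmetric] g(2)[symmetric]
    using f(1) g(1) by (rule integral_mono) (simp add: assms(3))
qed

lemma has_gauss_integral_1: "\<alpha> > 0 \<Longrightarrow> has_gauss_integral \<alpha> (\<lambda>r. 1) (pi / \<alpha>)"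
  using integrable_gauss2[of \<alpha>] by (intro has_gauss_integralI) simp_all

lemma has_gauss_integral_growth:
  fixes f :: "real \<times> real \<Rightarrow> real"
  assumes "\<alpha> > 0" "f \<in> borel_measurable borel" "\<And>r. \<bar>f r\<bar> \<le> C * (1 + rad2 r) ^ k"
  shows "has_gauss_integral \<alpha> f (LINT r|lborel. exp (- \<alpha> * rad2 r) * f r)"
  using integrable_gauss_growth[OF assms(1,2), of C k] assms(3) by (intro has_gauss_integralI) simp_all

section \<open>Perturbation terms and their Gaussian integrals\<close>

context family
begin

definition g :: "real \<times> real \<Rightarrow> real" where "g r = 2 * \<beta> * Re (zc r ^ n)"
definition h :: "real \<times> real \<Rightarrow> real" where "h r = poly_P n (rad2 r) - 1"
text \<open>A common majorant of both orders of the perturbation, so that every error takes the form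
  \<epsilon>^3 times \<open>H r ^ 3\<close>; the summand 1 makes powers of \<open>H\<close> increase
  with the exponent.\<close>

definition H :: "real \<times> real \<Rightarrow> real" where "H r = 1 + \<bar>g r\<bar> + \<bar>h r\<bar>"

definition v :: "real \<Rightarrow> real \<times> real \<Rightarrow> real" where
  "v \<epsilon> r = (1 - \<delta> \<epsilon>) * (\<epsilon> * sqrt (1 - \<epsilon>\<^sup>2) * g r + \<epsilon>\<^sup>2 * h r) - \<delta> \<epsilon>"

definition t :: "real \<Rightarrow> real \<times> real \<Rightarrow> real" where
  "t \<epsilon> r = \<delta> \<epsilon> / s * exp (c * rad2 r)"

text \<open>All smallness conditions independent of \<alpha>. The bound
  \<open>\<epsilon> ^ 3\<close> on \<delta> places terms linear in \<delta> within the error of the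
  expansion.\<close>

definition good :: "real \<Rightarrow> bool" where
  "good \<epsilon> \<longleftrightarrow> 0 < \<epsilon> \<and> \<epsilon> \<le> 1 / 2 \<and> 0 < \<delta> \<epsilon> \<and> \<delta> \<epsilon> \<le> \<epsilon> ^ 3 \<and> (\<forall>r. 0 \<le> density \<epsilon> r)"

lemma density_split: "density \<epsilon> r = 1 + v \<epsilon> r + t \<epsilon> r"
  by (simp add: density_def v_def t_def g_def h_def algebra_simps)

lemma ev_good: "\<forall>\<^sub>F \<epsilon> in at_right 0. good \<epsilon>"
proof -
  have "\<forall>\<^sub>F \<epsilon> in at_right (0::real). \<epsilon> < 1 / 2"
    by (rule eventually_at_rightI[of 0 "1/2"]) auto
  then show ?thesis
    using ev_pos ev_margin ev_x_minus ev_delta[of 3]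
  proof eventually_elim
    case (elim \<epsilon>)
    have "\<epsilon> ^ 3 \<le> 1" using elim by (intro power_le_one) auto
    then show ?case using elim density_nonneg[of \<epsilon>] by (auto simp: good_def)
  qed
qed

lemma measurable_poly_P [measurable]: "poly_P n \<in> borel_measurable borel"
  unfolding poly_P_eq[abs_def] by measurable

lemma measurable_g [measurable]: "g \<in> borel_measurable borel"
  unfolding g_def[abs_def] by measurable

lemma measurable_h [measurable]: "h \<in> borel_measurable borel"
  unfolding h_def[abs_def] by measurable

lemma measurable_H [measurable]: "H \<in> borel_measurable borel"
  unfolding H_def[abs_def] by measurable

lemma measurable_v [measurable]: "v \<epsilon> \<in> borel_measurable borel"
  unfolding v_def[abs_def] by measurable

lemma measurable_t [measurable]: "t \<epsilon> \<in> borel_measurable borel"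
  unfolding t_def[abs_def] by measurable

lemma measurable_density [measurable]: "density \<epsilon> \<in> borel_measurable borel"
  unfolding density_split[abs_def] by measurable

lemma H_ge_1: "1 \<le> H r" by (simp add: H_def)

definition CH :: real where
  "CH = 2 + 2 * \<beta> + (\<Sum>k\<le>n. \<bar>(-1) ^ n * (real (n choose k) * (-2) ^ k / fact k)\<bar>)"

lemma H_growth: "H r \<le> CH * (1 + rad2 r) ^ n"
proof -
  let ?p = "(1 + rad2 r) ^ n"
  have p1: "1 \<le> ?p" by (intro one_le_power) simp
  have "\<bar>Re (zc r ^ n)\<bar> \<le> cmod (zc r) ^ n"
    using abs_Re_le_cmod[of "zc r ^ n"] by (simp add: norm_power)
  also have "\<dots> \<le> ?p" by (intro power_mono cmod_zc_le) simp
  finally have "\<bar>g r\<bar> \<le> 2 * \<beta> * ?p"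
    unfolding g_def abs_mult using beta_pos[of n] by (intro mult_mono) auto
  moreover have "\<bar>poly_P n (rad2 r)\<bar> \<le> (\<Sum>k\<le>n. \<bar>(-1) ^ n * (real (n choose k) * (-2) ^ k / fact k)\<bar>) * ?p"
    unfolding poly_P_eq sum_distrib_right
  proof (rule order_trans[OF sum_abs sum_mono])
    fix k assume k: "k \<in> {..n}"
    have "\<bar>rad2 r ^ k\<bar> \<le> (1 + rad2 r) ^ k" by (simp add: power_mono)
    also have "\<dots> \<le> ?p" using k by (intro power_increasing) auto
    finally show "\<bar>(-1) ^ n * (real (n choose k) * (-2) ^ k / fact k) * rad2 r ^ k\<bar> \<le>
       \<bar>(-1) ^ n * (real (n choose k) * (-2) ^ k / fact k)\<bar> * ?p"
      unfolding abs_mult[of _ "rad2 r ^ k"] by (intro mult_left_mono) auto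
  qed
  moreover have "\<bar>h r\<bar> \<le> \<bar>poly_P n (rad2 r)\<bar> + 1" unfolding h_def by linarith
  ultimately show ?thesis using p1 unfolding H_def CH_def distrib_right by linarith
qed

definition EH :: "real \<Rightarrow> real" where
  "EH \<alpha> = (LINT r|lborel. exp (- \<alpha> * rad2 r) * H r ^ 3)"

lemma H_power_growth: "\<bar>H r ^ k\<bar> \<le> CH ^ k * (1 + rad2 r) ^ (n * k)"
proof -
  have "\<bar>H r ^ k\<bar> = H r ^ k" using H_ge_1[of r] by simp
  also have "\<dots> \<le> (CH * (1 + rad2 r) ^ n) ^ k"
    using H_ge_1[of r] by (intro power_mono H_growth) auto
  finally show ?thesis by (simp add: power_mult_distrib power_mult)
qed

lemma has_gauss_integral_H: "\<alpha> > 0 \<Longrightarrow> has_gauss_integral \<alpha> (\<lambda>r. H r ^ 3) (EH \<alpha>)"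
  unfolding EH_def by (rule has_gauss_integral_growth[OF _ _ H_power_growth]) auto

lemma has_gauss_integral_g: "\<alpha> > 0 \<Longrightarrow> has_gauss_integral \<alpha> g 0"
  using has_gauss_integral_cmult[OF has_gauss_integralI[OF integral_Re_zc_power[of \<alpha> n]], of "2 * \<beta>"] n3
  unfolding g_def[abs_def] by simp

lemma has_gauss_integral_g_sq:
  assumes "\<alpha> > 0"
  shows "has_gauss_integral \<alpha> (\<lambda>r. (g r)\<^sup>2) (2 * pi * 2 ^ n / \<alpha> ^ Suc n)"
proof -
  have b: "\<beta>\<^sup>2 = 2 ^ n / fact n" by (simp add: beta_coeff_eq)
  have "has_gauss_integral \<alpha> (\<lambda>r. (Re (zc r ^ n))\<^sup>2) (pi * fact n / (2 * \<alpha> ^ Suc n))"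
    using integral_Re_zc_power_sq[OF assms, of n] n3 by (intro has_gauss_integralI) auto
  from has_gauss_integral_cmult[OF this, of "4 * \<beta>\<^sup>2"] show ?thesis
    unfolding b using assms by (simp add: g_def power_mult_distrib b mult.assoc)
qed

definition Eh :: "real \<Rightarrow> real" where
  "Eh \<alpha> = pi / \<alpha> * (((2 - \<alpha>) / \<alpha>) ^ n - 1)"

lemma has_gauss_integral_h:
  assumes "\<alpha> > 0"
  shows "has_gauss_integral \<alpha> h (Eh \<alpha>)"
  using has_gauss_integral_diff[OF has_gauss_integralI[OF integral_poly_P[OF assms, of n]] has_gauss_integral_1[OF assms]]
  unfolding h_def[abs_def] Eh_def by (simp add: algebra_simps)

lemma has_gauss_integral_v:
  assumes "\<alpha> > 0"
  shows "has_gauss_integral \<alpha> (v \<epsilon>) ((1 - \<delta> \<epsilon>) * (\<epsilon>\<^sup>2 * Eh \<alpha>) - \<delta> \<epsilon> * (pi / \<alpha>))"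
  using has_gauss_integral_diff[OF has_gauss_integral_cmult[OF has_gauss_integral_add[OF
     has_gauss_integral_cmult[OF has_gauss_integral_g[OF assms], of "\<epsilon> * sqrt (1 - \<epsilon>\<^sup>2)"]
     has_gauss_integral_cmult[OF has_gauss_integral_h[OF assms], of "\<epsilon>\<^sup>2"]], of "1 - \<delta> \<epsilon>"]
     has_gauss_integral_cmult[OF has_gauss_integral_1[OF assms], of "\<delta> \<epsilon>"]]
  by (simp add: v_def[abs_def])

lemma exp_t: "exp (- rad2 r) * exp (c * rad2 r) = exp (- (1 / s) * rad2 r)"
  unfolding c_eq[symmetric] exp_add[symmetric] by (simp add: algebra_simps)

text \<open>Since 1 - c = 1 / s, the growth of \<open>t\<close> leaves a Gaussian of rate \<alpha> /
  s, integrable for every positive order.\<close>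

lemma has_gauss_integral_t_powr:
  assumes "\<alpha> > 0" "0 < \<delta> \<epsilon>"
  shows "has_gauss_integral \<alpha> (\<lambda>r. t \<epsilon> r powr \<alpha>) ((\<delta> \<epsilon> / s) powr \<alpha> * (pi * s / \<alpha>))"
proof -
  have e: "exp (- \<alpha> * rad2 r) * t \<epsilon> r powr \<alpha> = (\<delta> \<epsilon> / s) powr \<alpha> * exp (- (\<alpha> / s) * rad2 r)" for r
  proof -
    have "t \<epsilon> r powr \<alpha> = (\<delta> \<epsilon> / s) powr \<alpha> * exp (c * rad2 r) powr \<alpha>"
      unfolding t_def by (rule powr_mult)
    also have "exp (c * rad2 r) powr \<alpha> = exp (\<alpha> * (c * rad2 r))" by (simp add: powr_def)
    finally have "exp (- \<alpha> * rad2 r) * t \<epsilon> r powr \<alpha> = (\<delta> \<epsilon> / s) powr \<alpha> * (exp (- \<alpha> * rad2 r) * exp (\<alpha> * (c * rad2 r)))"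
      by (simp only: mult.left_commute)
    also have "exp (- \<alpha> * rad2 r) * exp (\<alpha> * (c * rad2 r)) = exp (- \<alpha> * (1 - c) * rad2 r)"
      unfolding exp_add[symmetric] by (simp add: algebra_simps)
    also have "- \<alpha> * (1 - c) = - (\<alpha> / s)" unfolding c_eq by simp
    finally show ?thesis .
  qed
  have as: "\<alpha> / s > 0" using assms s1 by simp
  show ?thesis unfolding has_gauss_integral_def e
    using integrable_gauss2[OF as]
    by (intro has_bochner_integral_mult_right) (simp add: has_bochner_integral_iff)
qed

text \<open>The second-order coefficient of the integral: \<alpha> times the mean of
  \<open>h\<close> plus \<alpha> (\<alpha> - 1) / 2 times the second moment of \<open>g\<close>,
  both under the weight exp (-\<alpha> |r|^2).\<close>

definition coeff_Q :: "real \<Rightarrow> real" where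
  "coeff_Q \<alpha> = pi * (((2 - \<alpha>) / \<alpha>) ^ n - 1 + (\<alpha> - 1) * (2 / \<alpha>) ^ n)"

context
  fixes \<epsilon> :: real
  assumes good: "good \<epsilon>"
begin

lemma goodD: "0 < \<epsilon>" "\<epsilon> \<le> 1 / 2" "0 < \<delta> \<epsilon>" "\<delta> \<epsilon> \<le> \<epsilon> ^ 3" "0 \<le> density \<epsilon> r"
  using good by (auto simp: good_def simp del: split_paired_All)

lemma delta_le_sq: "\<delta> \<epsilon> \<le> \<epsilon>\<^sup>2"
proof -
  have "\<epsilon>\<^sup>2 * \<epsilon> \<le> \<epsilon>\<^sup>2 * 1" using goodD by (intro mult_left_mono) auto
  then show ?thesis using goodD(4) by (simp add: power3_eq_cube power2_eq_square)
qed

lemma delta_le_1: "\<delta> \<epsilon> \<le> 1"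
proof -
  have "\<epsilon>\<^sup>2 \<le> 1" using goodD by (intro power_le_one) auto
  then show ?thesis using delta_le_sq by linarith
qed

text \<open>The three summands of \<open>H\<close> match three errors: the prefactor of \<epsilon> *
  \<open>g\<close> differs from 1 by at most \<epsilon>, the second-order term is at most
  \<epsilon>^2 |\<open>h\<close>|, and the constant \<delta> is at most \<epsilon>^2.\<close>

lemma v_approx: "\<bar>v \<epsilon> r - \<epsilon> * g r\<bar> \<le> \<epsilon>\<^sup>2 * H r"
proof -
  define d where "d = \<delta> \<epsilon>"
  define q where "q = sqrt (1 - \<epsilon>\<^sup>2)"
  have e: "0 < \<epsilon>" "\<epsilon> \<le> 1 / 2" using goodD by auto
  have e2: "\<epsilon>\<^sup>2 \<le> \<epsilon> / 2" using mult_left_mono[OF e(2), of \<epsilon>] e(1) by (simp add: power2_eq_square)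
  have d: "0 < d" "d \<le> \<epsilon>\<^sup>2" "d \<le> 1" using goodD delta_le_sq delta_le_1 by (auto simp: d_def)
  have q: "1 - \<epsilon>\<^sup>2 \<le> q" "q \<le> 1" "0 \<le> q"
  proof -
    have "0 \<le> 1 - \<epsilon>\<^sup>2" "1 - \<epsilon>\<^sup>2 \<le> 1" using e2 e by auto
    then have "(1 - \<epsilon>\<^sup>2)\<^sup>2 \<le> 1 - \<epsilon>\<^sup>2" using mult_left_mono[of "1 - \<epsilon>\<^sup>2" 1 "1 - \<epsilon>\<^sup>2"] by (simp add: power2_eq_square)
    then show "1 - \<epsilon>\<^sup>2 \<le> q" unfolding q_def by (rule real_le_rsqrt)
  qed (use e e2 in \<open>auto simp: q_def\<close>)
  have dq: "\<bar>(1 - d) * q - 1\<bar> \<le> \<epsilon>"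
  proof -
    have "(1 - d) * q \<le> 1 * 1" using d q by (intro mult_mono) auto
    moreover have "(1 - d) * (1 - \<epsilon>\<^sup>2) \<le> (1 - d) * q" using d q by (intro mult_left_mono) auto
    moreover have "1 - \<epsilon> \<le> (1 - d) * (1 - \<epsilon>\<^sup>2)"
    proof -
      have "0 \<le> d * \<epsilon>\<^sup>2" using d by simp
      then show ?thesis using d(2) e2 by (simp add: algebra_simps)
    qed
    ultimately show ?thesis by linarith
  qed
  have "v \<epsilon> r - \<epsilon> * g r = ((1 - d) * q - 1) * (\<epsilon> * g r) + (1 - d) * (\<epsilon>\<^sup>2 * h r) - d"
    unfolding v_def d_def[symmetric] q_def[symmetric] by (simp add: algebra_simps)
  also have "\<bar>\<dots>\<bar> \<le> \<bar>((1 - d) * q - 1) * (\<epsilon> * g r)\<bar> + \<bar>(1 - d) * (\<epsilon>\<^sup>2 * h r)\<bar> + \<bar>d\<bar>" by linarith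
  also have "\<dots> \<le> \<epsilon> * (\<epsilon> * \<bar>g r\<bar>) + 1 * (\<epsilon>\<^sup>2 * \<bar>h r\<bar>) + \<epsilon>\<^sup>2"
  proof (intro add_mono)
    show "\<bar>((1 - d) * q - 1) * (\<epsilon> * g r)\<bar> \<le> \<epsilon> * (\<epsilon> * \<bar>g r\<bar>)"
      unfolding abs_mult[of "_ - 1"] using dq e by (intro mult_mono) (auto simp: abs_mult)
    show "\<bar>(1 - d) * (\<epsilon>\<^sup>2 * h r)\<bar> \<le> 1 * (\<epsilon>\<^sup>2 * \<bar>h r\<bar>)"
      unfolding abs_mult[of "1 - d"] using d by (intro mult_mono) (auto simp: abs_mult)
  qed (use d in auto)
  also have "\<dots> = \<epsilon>\<^sup>2 * H r" by (simp add: H_def power2_eq_square algebra_simps)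
  finally show ?thesis .
qed

lemma v_abs_le: "\<bar>v \<epsilon> r\<bar> \<le> 2 * \<epsilon> * H r"
proof -
  have "\<epsilon> * (\<epsilon> * H r) \<le> 1 * (\<epsilon> * H r)" using goodD H_ge_1[of r] by (intro mult_right_mono) auto
  moreover have "\<epsilon> * \<bar>g r\<bar> \<le> \<epsilon> * H r" using goodD(1) by (intro mult_left_mono) (auto simp: H_def)
  moreover have "\<bar>\<epsilon> * g r\<bar> = \<epsilon> * \<bar>g r\<bar>" using goodD(1) by (simp add: abs_mult)
  ultimately show ?thesis using v_approx[of r] by (simp add: power2_eq_square)
qed

text \<open>\<open>147 = 18 * 2\<^sup>3 + 3\<close>: the cubic error of the pointwise bounds, plus the error of replacing \<open>v\<^sup>2\<close> by
  \<open>\<epsilon>\<^sup>2 g\<^sup>2\<close>.\<close>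

lemma quadratic_error:
  assumes "\<bar>\<kappa>\<bar> \<le> 1"
  shows "\<bar>\<kappa> * (v \<epsilon> r)\<^sup>2 - \<kappa> * \<epsilon>\<^sup>2 * (g r)\<^sup>2\<bar> + 18 * \<bar>v \<epsilon> r\<bar> ^ 3 \<le> 147 * \<epsilon> ^ 3 * H r ^ 3"
proof -
  note H1 = H_ge_1[of r] and e = goodD(1)
  have "\<bar>v \<epsilon> r\<bar> ^ 3 \<le> (2 * \<epsilon> * H r) ^ 3" by (intro power_mono v_abs_le) simp
  then have 1: "18 * \<bar>v \<epsilon> r\<bar> ^ 3 \<le> 144 * \<epsilon> ^ 3 * H r ^ 3" by (simp add: power_mult_distrib)
  have "\<epsilon> * \<bar>g r\<bar> \<le> \<epsilon> * H r" using e by (intro mult_left_mono) (auto simp: H_def)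
  moreover have "\<bar>\<epsilon> * g r\<bar> = \<epsilon> * \<bar>g r\<bar>" using e by (simp add: abs_mult)
  ultimately have s: "\<bar>v \<epsilon> r + \<epsilon> * g r\<bar> \<le> 3 * \<epsilon> * H r" using v_abs_le[of r] by linarith
  have "\<kappa> * (v \<epsilon> r)\<^sup>2 - \<kappa> * \<epsilon>\<^sup>2 * (g r)\<^sup>2 = \<kappa> * ((v \<epsilon> r - \<epsilon> * g r) * (v \<epsilon> r + \<epsilon> * g r))"
    by (simp add: power2_eq_square algebra_simps)
  also have "\<bar>\<dots>\<bar> \<le> 1 * ((\<epsilon>\<^sup>2 * H r) * (3 * \<epsilon> * H r))"
    unfolding abs_mult using assms e H1 by (intro mult_mono v_approx s) auto
  also have "\<dots> = 3 * \<epsilon> ^ 3 * (H r)\<^sup>2" by (simp add: power2_eq_square power3_eq_cube)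
  also have "\<dots> \<le> 3 * \<epsilon> ^ 3 * H r ^ 3" using e H1 by (intro mult_left_mono power_increasing) auto
  finally show ?thesis using 1 by linarith
qed

lemma t_pos: "0 < t \<epsilon> r"
  using goodD(3) s1 by (simp add: t_def)

text \<open>The density is at most twice the larger of \<open>2 * H\<close> and \<open>t\<close>,
  and 2^\<alpha> is at most 4. The endpoint \<alpha> = 2 is included because the case \<alpha> = 1
  compares with the orders 1 / 2 and 2.\<close>

lemma integrable_density_powr:
  assumes "0 < \<alpha>" "\<alpha> \<le> 2"
  shows "integrable lborel (\<lambda>r. exp (- \<alpha> * rad2 r) * density \<epsilon> r powr \<alpha>)"
proof (rule Bochner_Integration.integrable_bound)
  define C where "C = 4 * CH\<^sup>2"
  have "has_gauss_integral \<alpha> (\<lambda>r. (2 * H r)\<^sup>2) (LINT r|lborel. exp (- \<alpha> * rad2 r) * (2 * H r)\<^sup>2)"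
    using H_power_growth[of _ 2] assms
    by (intro has_gauss_integral_growth[where C = C and k = "n * 2"]) (auto simp: C_def power_mult_distrib)
  from has_gauss_integralD(1)[OF has_gauss_integral_cmult[OF has_gauss_integral_add[OF this has_gauss_integral_t_powr[OF assms(1) goodD(3)]], of 4]]
  show "integrable lborel (\<lambda>r. exp (- \<alpha> * rad2 r) * (4 * ((2 * H r)\<^sup>2 + t \<epsilon> r powr \<alpha>)))" .
  show "AE r in lborel. norm (exp (- \<alpha> * rad2 r) * density \<epsilon> r powr \<alpha>) \<le> norm (exp (- \<alpha> * rad2 r) * (4 * ((2 * H r)\<^sup>2 + t \<epsilon> r powr \<alpha>)))"
  proof (rule AE_I2)
    fix r
    have "2 * \<epsilon> * H r \<le> 1 * H r" using goodD H_ge_1[of r] by (intro mult_right_mono) auto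
    then have v: "1 + v \<epsilon> r \<le> 2 * H r" using v_abs_le[of r] H_ge_1[of r] by linarith
    let ?m = "max (2 * H r) (t \<epsilon> r)"
    have m: "1 \<le> 2 * H r" using H_ge_1[of r] by simp
    have "density \<epsilon> r powr \<alpha> \<le> (2 * ?m) powr \<alpha>"
      using v goodD(5) assms unfolding density_split[symmetric]
      by (intro powr_mono2) (auto simp: density_split)
    also have "\<dots> = 2 powr \<alpha> * ?m powr \<alpha>" by (rule powr_mult)
    also have "\<dots> \<le> 4 * ((2 * H r)\<^sup>2 + t \<epsilon> r powr \<alpha>)"
    proof (rule mult_mono)
      have "(2::real) powr \<alpha> \<le> 2 powr 2" using assms by (intro powr_mono) auto
      then show "2 powr \<alpha> \<le> (4::real)" by simp
      have "(2 * H r) powr \<alpha> \<le> (2 * H r) powr 2" using assms m by (intro powr_mono) auto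
      also have "\<dots> = (2 * H r)\<^sup>2" using m by simp
      finally show "?m powr \<alpha> \<le> (2 * H r)\<^sup>2 + t \<epsilon> r powr \<alpha>" by (auto simp: max_def intro: add_increasing2)
    qed auto
    finally show "norm (exp (- \<alpha> * rad2 r) * density \<epsilon> r powr \<alpha>) \<le> norm (exp (- \<alpha> * rad2 r) * (4 * ((2 * H r)\<^sup>2 + t \<epsilon> r powr \<alpha>)))"
      by (simp add: abs_mult)
  qed
qed measurable

lemma has_gauss_integral_density_powr:
  assumes "0 < \<alpha>" "\<alpha> \<le> 2"
  shows "has_gauss_integral \<alpha> (\<lambda>r. density \<epsilon> r powr \<alpha>) (LINT r|lborel. exp (- \<alpha> * rad2 r) * density \<epsilon> r powr \<alpha>)"
  by (rule has_gauss_integralI[OF integrable_density_powr[OF assms] refl])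

lemma has_gauss_integral_expansion:
  assumes "\<alpha> > 0"
  shows "has_gauss_integral \<alpha> (\<lambda>r. 1 + a * v \<epsilon> r + \<kappa> * \<epsilon>\<^sup>2 * (g r)\<^sup>2 + C * H r ^ 3)
     (pi / \<alpha> + a * ((1 - \<delta> \<epsilon>) * (\<epsilon>\<^sup>2 * Eh \<alpha>) - \<delta> \<epsilon> * (pi / \<alpha>)) + \<kappa> * \<epsilon>\<^sup>2 * (2 * pi * 2 ^ n / \<alpha> ^ Suc n) + C * EH \<alpha>)"
  by (intro has_gauss_integral_add has_gauss_integral_cmult has_gauss_integral_v[OF assms]
      has_gauss_integral_1[OF assms] has_gauss_integral_g_sq[OF assms] has_gauss_integral_H[OF assms])

lemma delta_Eh: "\<bar>\<delta> \<epsilon> * (\<epsilon>\<^sup>2 * Eh \<alpha>)\<bar> \<le> \<epsilon> ^ 3 * \<bar>Eh \<alpha>\<bar>"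
proof -
  have "\<delta> \<epsilon> * \<epsilon>\<^sup>2 \<le> \<epsilon> ^ 3 * 1" using goodD by (intro mult_mono power_le_one) auto
  then have "\<delta> \<epsilon> * \<epsilon>\<^sup>2 * \<bar>Eh \<alpha>\<bar> \<le> \<epsilon> ^ 3 * 1 * \<bar>Eh \<alpha>\<bar>" by (intro mult_right_mono) auto
  then show ?thesis using goodD(3) by (simp add: abs_mult)
qed

lemma coeff_Q_eq:
  assumes "\<alpha> > 0"
  shows "\<alpha> * (\<epsilon>\<^sup>2 * Eh \<alpha>) + \<alpha> * (\<alpha> - 1) / 2 * \<epsilon>\<^sup>2 * (2 * pi * 2 ^ n / \<alpha> ^ Suc n) = \<epsilon>\<^sup>2 * coeff_Q \<alpha>"
  using assms unfolding Eh_def coeff_Q_def by (simp add: power_divide field_simps)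

text \<open>Subadditivity separates the thermal part, whose integral is of order
  \<open>\<delta> powr \<alpha>\<close>, hence the hypothesis \<open>d\<close>. The term -\<delta>
  in \<open>v\<close> only lowers the bound and is dropped.\<close>

lemma density_powr_le:
  assumes a: "0 < \<alpha>" "\<alpha> < 1" and d: "\<delta> \<epsilon> powr \<alpha> \<le> \<epsilon> ^ 3"
  shows "(LINT r|lborel. exp (- \<alpha> * rad2 r) * density \<epsilon> r powr \<alpha>) \<le>
     pi / \<alpha> + \<epsilon>\<^sup>2 * coeff_Q \<alpha> + \<epsilon> ^ 3 * (\<alpha> * \<bar>Eh \<alpha>\<bar> + 147 * EH \<alpha> + pi * s / \<alpha>)"
proof -
  let ?\<kappa> = "\<alpha> * (\<alpha> - 1) / 2"
  have k: "\<bar>?\<kappa>\<bar> \<le> 1"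
  proof -
    have "\<bar>\<alpha> * (\<alpha> - 1)\<bar> \<le> 1 * 1" unfolding abs_mult using a by (intro mult_mono) auto
    then show ?thesis by simp
  qed
  have "(LINT r|lborel. exp (- \<alpha> * rad2 r) * density \<epsilon> r powr \<alpha>) \<le>
     (pi / \<alpha> + \<alpha> * ((1 - \<delta> \<epsilon>) * (\<epsilon>\<^sup>2 * Eh \<alpha>) - \<delta> \<epsilon> * (pi / \<alpha>)) + ?\<kappa> * \<epsilon>\<^sup>2 * (2 * pi * 2 ^ n / \<alpha> ^ Suc n) + (147 * \<epsilon> ^ 3) * EH \<alpha>)
     + (\<delta> \<epsilon> / s) powr \<alpha> * (pi * s / \<alpha>)"
  proof (rule has_gauss_integral_mono[OF has_gauss_integral_density_powr
      has_gauss_integral_add[OF has_gauss_integral_expansion has_gauss_integral_t_powr]])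
    fix r
    have "density \<epsilon> r powr \<alpha> \<le> (max 0 (1 + v \<epsilon> r) + t \<epsilon> r) powr \<alpha>"
      using goodD(5)[of r] a by (intro powr_mono2) (auto simp: density_split)
    also have "\<dots> \<le> max 0 (1 + v \<epsilon> r) powr \<alpha> + t \<epsilon> r powr \<alpha>"
      using a t_pos[of r] by (intro powr_add_le) auto
    also have "max 0 (1 + v \<epsilon> r) powr \<alpha> \<le> 1 + \<alpha> * v \<epsilon> r + ?\<kappa> * (v \<epsilon> r)\<^sup>2 + 18 * \<bar>v \<epsilon> r\<bar> ^ 3"
      using a by (rule powr_le_second_order)
    finally show "density \<epsilon> r powr \<alpha> \<le> 1 + \<alpha> * v \<epsilon> r + ?\<kappa> * \<epsilon>\<^sup>2 * (g r)\<^sup>2 + (147 * \<epsilon> ^ 3) * H r ^ 3 + t \<epsilon> r powr \<alpha>"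
      using quadratic_error[OF k, of r] by linarith
  qed (use a goodD(3) in auto)
  also have "(\<delta> \<epsilon> / s) powr \<alpha> * (pi * s / \<alpha>) \<le> \<epsilon> ^ 3 * (pi * s / \<alpha>)"
  proof (rule mult_right_mono)
    have "\<delta> \<epsilon> / s \<le> \<delta> \<epsilon> / 1" using s1 goodD(3) by (intro divide_left_mono) auto
    then have "(\<delta> \<epsilon> / s) powr \<alpha> \<le> \<delta> \<epsilon> powr \<alpha>" using a s1 goodD(3) by (intro powr_mono2) auto
    then show "(\<delta> \<epsilon> / s) powr \<alpha> \<le> \<epsilon> ^ 3" using d by linarith
  qed (use a s1 in auto)
  also have "pi / \<alpha> + \<alpha> * ((1 - \<delta> \<epsilon>) * (\<epsilon>\<^sup>2 * Eh \<alpha>) - \<delta> \<epsilon> * (pi / \<alpha>)) + ?\<kappa> * \<epsilon>\<^sup>2 * (2 * pi * 2 ^ n / \<alpha> ^ Suc n) + (147 * \<epsilon> ^ 3) * EH \<alpha>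
    \<le> pi / \<alpha> + \<epsilon>\<^sup>2 * coeff_Q \<alpha> + \<epsilon> ^ 3 * (\<alpha> * \<bar>Eh \<alpha>\<bar>) + (147 * \<epsilon> ^ 3) * EH \<alpha>"
  proof -
    have "0 \<le> \<alpha> * (\<delta> \<epsilon> * (pi / \<alpha>))" using a goodD(3) by simp
    moreover have "\<alpha> * - (\<delta> \<epsilon> * (\<epsilon>\<^sup>2 * Eh \<alpha>)) \<le> \<alpha> * (\<epsilon> ^ 3 * \<bar>Eh \<alpha>\<bar>)"
      using a delta_Eh[of \<alpha>] by (intro mult_left_mono) auto
    ultimately show ?thesis unfolding coeff_Q_eq[OF a(1), symmetric] by (simp add: algebra_simps)
  qed
  finally show ?thesis by (simp add: algebra_simps)
qed

text \<open>The thermal part is discarded by monotonicity. The term -\<delta> in \<open>v\<close> is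
  then left uncompensated; it costs \<delta> * pi, which is where the last summand of the error
  constant comes from.\<close>

lemma density_powr_ge:
  assumes a: "1 < \<alpha>" "\<alpha> < 2"
  shows "pi / \<alpha> + \<epsilon>\<^sup>2 * coeff_Q \<alpha> - \<epsilon> ^ 3 * (\<alpha> * \<bar>Eh \<alpha>\<bar> + 147 * EH \<alpha> + pi)
     \<le> (LINT r|lborel. exp (- \<alpha> * rad2 r) * density \<epsilon> r powr \<alpha>)"
proof -
  let ?\<kappa> = "\<alpha> * (\<alpha> - 1) / 2"
  have a0: "\<alpha> > 0" using a by simp
  have k: "\<bar>?\<kappa>\<bar> \<le> 1"
  proof -
    have "\<bar>\<alpha> * (\<alpha> - 1)\<bar> \<le> 2 * 1" unfolding abs_mult using a by (intro mult_mono) auto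
    then show ?thesis by simp
  qed
  have "pi / \<alpha> + \<epsilon>\<^sup>2 * coeff_Q \<alpha> - \<epsilon> ^ 3 * (\<alpha> * \<bar>Eh \<alpha>\<bar> + 147 * EH \<alpha> + pi) \<le>
     pi / \<alpha> + \<alpha> * ((1 - \<delta> \<epsilon>) * (\<epsilon>\<^sup>2 * Eh \<alpha>) - \<delta> \<epsilon> * (pi / \<alpha>)) + ?\<kappa> * \<epsilon>\<^sup>2 * (2 * pi * 2 ^ n / \<alpha> ^ Suc n) + (- (147 * \<epsilon> ^ 3)) * EH \<alpha>"
  proof -
    have e: "\<alpha> * ((1 - \<delta> \<epsilon>) * (\<epsilon>\<^sup>2 * Eh \<alpha>) - \<delta> \<epsilon> * (pi / \<alpha>)) = \<alpha> * (\<epsilon>\<^sup>2 * Eh \<alpha>) - \<alpha> * (\<delta> \<epsilon> * (\<epsilon>\<^sup>2 * Eh \<alpha>)) - \<delta> \<epsilon> * pi"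
      using a by (simp add: algebra_simps)
    have e': "\<epsilon> ^ 3 * (\<alpha> * \<bar>Eh \<alpha>\<bar> + 147 * EH \<alpha> + pi) = \<alpha> * (\<epsilon> ^ 3 * \<bar>Eh \<alpha>\<bar>) + 147 * \<epsilon> ^ 3 * EH \<alpha> + \<epsilon> ^ 3 * pi"
      by (simp add: algebra_simps)
    have "\<delta> \<epsilon> * pi \<le> \<epsilon> ^ 3 * pi" using goodD(4) by (intro mult_right_mono) auto
    moreover have "\<alpha> * (\<delta> \<epsilon> * (\<epsilon>\<^sup>2 * Eh \<alpha>)) \<le> \<alpha> * (\<epsilon> ^ 3 * \<bar>Eh \<alpha>\<bar>)"
      using a delta_Eh[of \<alpha>] by (intro mult_left_mono) auto
    ultimately show ?thesis unfolding coeff_Q_eq[OF a0, symmetric] e e' by linarith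
  qed
  also have "\<dots> \<le> (LINT r|lborel. exp (- \<alpha> * rad2 r) * density \<epsilon> r powr \<alpha>)"
  proof (rule has_gauss_integral_mono[OF has_gauss_integral_expansion has_gauss_integral_density_powr])
    fix r
    have "1 + \<alpha> * v \<epsilon> r + ?\<kappa> * (v \<epsilon> r)\<^sup>2 - 18 * \<bar>v \<epsilon> r\<bar> ^ 3 \<le> density \<epsilon> r powr \<alpha>"
      using t_pos[of r] goodD(5)[of r] by (intro powr_ge_second_order a) (auto simp: density_split)
    then show "1 + \<alpha> * v \<epsilon> r + ?\<kappa> * \<epsilon>\<^sup>2 * (g r)\<^sup>2 + (- (147 * \<epsilon> ^ 3)) * H r ^ 3 \<le> density \<epsilon> r powr \<alpha>"
      using quadratic_error[OF k, of r] by linarith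
  qed (use a in auto)
  finally show ?thesis .
qed

end

end

section \<open>The case of order one and the comparison with the vacuum\<close>

context family
begin

abbreviation "W \<epsilon> \<equiv> (\<lambda>r. Re (wigner (rho n \<nu> K \<epsilon>) r))"
abbreviation "W\<^sub>0 \<equiv> (\<lambda>r. Re (wigner (projector (fock 0)) r))"

lemma has_gauss_integral_rad2: "has_gauss_integral 1 rad2 pi"
  using integral_rad2_power[of 1 1] by (intro has_gauss_integralI) simp_all

lemma has_gauss_integral_rad2_g: "has_gauss_integral 1 (\<lambda>r. rad2 r * g r) 0"
  using has_gauss_integral_cmult[OF has_gauss_integralI[OF integral_rad2_Re_zc_power[of 1 n]], of "2 * \<beta>"] n3
  unfolding g_def by (simp add: mult_ac)

lemma has_gauss_integral_rad2_h: "has_gauss_integral 1 (\<lambda>r. rad2 r * h r) (2 * real n * pi)"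
proof -
  have "has_gauss_integral 1 (\<lambda>r. rad2 r * poly_P n (rad2 r)) (pi * (1 + 2 * real n))"
    using integral_rad2_poly_P[of n] by (intro has_gauss_integralI) simp_all
  from has_gauss_integral_diff[OF this has_gauss_integral_rad2] show ?thesis
    by (simp add: h_def algebra_simps)
qed

lemma has_gauss_integral_t: "has_gauss_integral 1 (t \<epsilon>) (\<delta> \<epsilon> * pi)"
  and has_gauss_integral_rad2_t: "has_gauss_integral 1 (\<lambda>r. rad2 r * t \<epsilon> r) (\<delta> \<epsilon> * pi * s)"
proof -
  have e: "exp (- 1 * rad2 r) * (rad2 r ^ k * t \<epsilon> r) = \<delta> \<epsilon> / s * (exp (- (1 / s) * rad2 r) * rad2 r ^ k)" for r k
    unfolding t_def exp_t[symmetric] by simp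
  have s0: "1 / s > 0" using s1 by simp
  have "has_bochner_integral lborel (\<lambda>r. \<delta> \<epsilon> / s * (exp (- (1 / s) * rad2 r) * rad2 r ^ k)) (\<delta> \<epsilon> / s * (pi * fact k / (1 / s) ^ Suc k))" for k
    using integral_rad2_power[OF s0, of k] by (intro has_bochner_integral_mult_right) (simp add: has_bochner_integral_iff)
  then have "has_gauss_integral 1 (\<lambda>r. rad2 r ^ k * t \<epsilon> r) (\<delta> \<epsilon> / s * (pi * fact k / (1 / s) ^ Suc k))" for k
    unfolding has_gauss_integral_def e .
  from this[of 0] this[of 1] show "has_gauss_integral 1 (t \<epsilon>) (\<delta> \<epsilon> * pi)" "has_gauss_integral 1 (\<lambda>r. rad2 r * t \<epsilon> r) (\<delta> \<epsilon> * pi * s)"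
    using s1 by (simp_all add: power_divide power2_eq_square mult.assoc)
qed

lemma Eh_1: "Eh 1 = 0" by (simp add: Eh_def)

text \<open>The loss \<delta> * pi in \<open>v\<close> is exactly the mass of \<open>t\<close>, and
  \<open>g\<close> and \<open>h\<close> have mean zero at \<alpha> = 1.\<close>

lemma has_gauss_integral_density: "has_gauss_integral 1 (density \<epsilon>) pi"
  using has_gauss_integral_add[OF has_gauss_integral_add[OF has_gauss_integral_1[of 1] has_gauss_integral_v[of 1 \<epsilon>]] has_gauss_integral_t[of \<epsilon>]]
  by (simp add: density_split[abs_def] Eh_1 algebra_simps)

lemma has_gauss_integral_rad2_v: "has_gauss_integral 1 (\<lambda>r. rad2 r * v \<epsilon> r) ((1 - \<delta> \<epsilon>) * \<epsilon>\<^sup>2 * (2 * real n * pi) - \<delta> \<epsilon> * pi)"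
proof -
  have e: "rad2 r * v \<epsilon> r = (1 - \<delta> \<epsilon>) * (\<epsilon> * sqrt (1 - \<epsilon>\<^sup>2)) * (rad2 r * g r) + (1 - \<delta> \<epsilon>) * \<epsilon>\<^sup>2 * (rad2 r * h r) - \<delta> \<epsilon> * rad2 r" for r
    by (simp add: v_def algebra_simps)
  show ?thesis unfolding e
    using has_gauss_integral_diff[OF has_gauss_integral_add[OF has_gauss_integral_cmult[OF has_gauss_integral_rad2_g, of "(1 - \<delta> \<epsilon>) * (\<epsilon> * sqrt (1 - \<epsilon>\<^sup>2))"]
      has_gauss_integral_cmult[OF has_gauss_integral_rad2_h, of "(1 - \<delta> \<epsilon>) * \<epsilon>\<^sup>2"]] has_gauss_integral_cmult[OF has_gauss_integral_rad2, of "\<delta> \<epsilon>"]]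
    by simp
qed

lemma has_gauss_integral_rad2_density:
  "has_gauss_integral 1 (\<lambda>r. rad2 r * density \<epsilon> r) (pi + ((1 - \<delta> \<epsilon>) * \<epsilon>\<^sup>2 * (2 * real n * pi) - \<delta> \<epsilon> * pi) + \<delta> \<epsilon> * pi * s)"
proof -
  have e: "rad2 r * density \<epsilon> r = rad2 r + rad2 r * v \<epsilon> r + rad2 r * t \<epsilon> r" for r
    by (simp add: density_split algebra_simps)
  show ?thesis unfolding e
    by (intro has_gauss_integral_add has_gauss_integral_rad2 has_gauss_integral_rad2_v has_gauss_integral_rad2_t)
qed

context
  fixes \<epsilon> :: real
  assumes good: "good \<epsilon>"
begin

text \<open>The logarithm of the Gaussian contributes -\<open>rad2 r\<close>. Where the density
  vanishes both sides are 0.\<close>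

lemma weighted_ln:
  "exp (- rad2 r) * density \<epsilon> r * ln (exp (- rad2 r) * density \<epsilon> r) =
     exp (- 1 * rad2 r) * (density \<epsilon> r * ln (density \<epsilon> r) - rad2 r * density \<epsilon> r)"
proof (cases "density \<epsilon> r = 0")
  case False
  then have "density \<epsilon> r > 0" using goodD(5)[OF good, of r] by simp
  then show ?thesis by (simp add: ln_mult algebra_simps)
qed simp

lemma weighted_powr: "(exp (- rad2 r) * density \<epsilon> r) powr \<alpha> = exp (- \<alpha> * rad2 r) * density \<epsilon> r powr \<alpha>"
  unfolding powr_mult by (simp add: powr_def mult.commute)

lemma integrable_weighted_ln:
  "integrable lborel (\<lambda>r. exp (- rad2 r) * density \<epsilon> r * ln (exp (- rad2 r) * density \<epsilon> r))"
proof (rule Bochner_Integration.integrable_bound)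
  let ?w = "\<lambda>r. exp (- rad2 r) * density \<epsilon> r"
  show "integrable lborel (\<lambda>r. 2 * ?w r powr (1 / 2) + ?w r powr 2)"
    unfolding weighted_powr
    by (intro Bochner_Integration.integrable_add integrable_mult_right integrable_density_powr[OF good]) auto
  show "AE r in lborel. norm (?w r * ln (?w r)) \<le> norm (2 * ?w r powr (1 / 2) + ?w r powr 2)"
    using order_trans[OF abs_mult_ln_le abs_ge_self] goodD(5)[OF good] by (intro AE_I2) (simp add: real_norm_def)
qed measurable

text \<open>The quadratic term of x ln x contributes 2^n through the second moment of
  \<open>g\<close>, and the logarithm of the Gaussian subtracts the excess 2 n of the mean of
  \<open>rad2\<close>. The two terms \<delta> * pi without the factor s cancel, which leaves
  -\<delta> * pi * s from the thermal tail as the only loss of first order in \<delta>.\<close>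

lemma integral_weighted_ln_ge:
  "- pi + \<epsilon>\<^sup>2 * (pi * (2 ^ n - 2 * real n)) - \<epsilon> ^ 3 * (pi * s + 147 * EH 1) \<le>
     (LINT r|lborel. exp (- rad2 r) * density \<epsilon> r * ln (exp (- rad2 r) * density \<epsilon> r))"
proof -
  note gd = goodD[OF good]
  have ex: "has_gauss_integral 1 (\<lambda>r. (1 + 1 * v \<epsilon> r + 1 / 2 * \<epsilon>\<^sup>2 * (g r)\<^sup>2 + (- (147 * \<epsilon> ^ 3)) * H r ^ 3) - 1 - rad2 r * density \<epsilon> r)
    ((pi / 1 + 1 * ((1 - \<delta> \<epsilon>) * (\<epsilon>\<^sup>2 * Eh 1) - \<delta> \<epsilon> * (pi / 1)) + 1 / 2 * \<epsilon>\<^sup>2 * (2 * pi * 2 ^ n / 1 ^ Suc n) + (- (147 * \<epsilon> ^ 3)) * EH 1) - pi / 1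
      - (pi + ((1 - \<delta> \<epsilon>) * \<epsilon>\<^sup>2 * (2 * real n * pi) - \<delta> \<epsilon> * pi) + \<delta> \<epsilon> * pi * s))"
    by (intro has_gauss_integral_diff has_gauss_integral_expansion[OF good] has_gauss_integral_1 has_gauss_integral_rad2_density) auto
  have "- pi + \<epsilon>\<^sup>2 * (pi * (2 ^ n - 2 * real n)) - \<epsilon> ^ 3 * (pi * s + 147 * EH 1) \<le>
    (pi / 1 + 1 * ((1 - \<delta> \<epsilon>) * (\<epsilon>\<^sup>2 * Eh 1) - \<delta> \<epsilon> * (pi / 1)) + 1 / 2 * \<epsilon>\<^sup>2 * (2 * pi * 2 ^ n / 1 ^ Suc n) + (- (147 * \<epsilon> ^ 3)) * EH 1) - pi / 1
      - (pi + ((1 - \<delta> \<epsilon>) * \<epsilon>\<^sup>2 * (2 * real n * pi) - \<delta> \<epsilon> * pi) + \<delta> \<epsilon> * pi * s)"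
  proof -
    have "\<delta> \<epsilon> * (pi * s) \<le> \<epsilon> ^ 3 * (pi * s)" using gd s1 by (intro mult_right_mono) auto
    moreover have "0 \<le> \<delta> \<epsilon> * (\<epsilon>\<^sup>2 * (2 * real n * pi))" using gd by simp
    moreover have "(pi / 1 + 1 * ((1 - \<delta> \<epsilon>) * (\<epsilon>\<^sup>2 * Eh 1) - \<delta> \<epsilon> * (pi / 1)) + 1 / 2 * \<epsilon>\<^sup>2 * (2 * pi * 2 ^ n / 1 ^ Suc n) + (- (147 * \<epsilon> ^ 3)) * EH 1) - pi / 1
      - (pi + ((1 - \<delta> \<epsilon>) * \<epsilon>\<^sup>2 * (2 * real n * pi) - \<delta> \<epsilon> * pi) + \<delta> \<epsilon> * pi * s) =
      - pi + \<epsilon>\<^sup>2 * (pi * (2 ^ n - 2 * real n)) - \<epsilon> ^ 3 * (pi * s + 147 * EH 1)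
      + (\<epsilon> ^ 3 * (pi * s) - \<delta> \<epsilon> * (pi * s)) + \<delta> \<epsilon> * (\<epsilon>\<^sup>2 * (2 * real n * pi))"
      unfolding Eh_1 by (simp add: algebra_simps)
    ultimately show ?thesis by linarith
  qed
  also have "\<dots> \<le> (LINT r|lborel. exp (- rad2 r) * density \<epsilon> r * ln (exp (- rad2 r) * density \<epsilon> r))"
  proof (rule has_gauss_integral_mono[OF ex])
    show "has_gauss_integral 1 (\<lambda>r. density \<epsilon> r * ln (density \<epsilon> r) - rad2 r * density \<epsilon> r)
       (LINT r|lborel. exp (- rad2 r) * density \<epsilon> r * ln (exp (- rad2 r) * density \<epsilon> r))"
      using integrable_weighted_ln unfolding weighted_ln by (intro has_gauss_integralI) auto
    fix r
    have "v \<epsilon> r + (v \<epsilon> r)\<^sup>2 / 2 - 18 * \<bar>v \<epsilon> r\<bar> ^ 3 \<le> density \<epsilon> r * ln (density \<epsilon> r)"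
      using t_pos[OF good, of r] gd(5)[of r] by (intro mult_ln_ge_second_order) (auto simp: density_split)
    then show "(1 + 1 * v \<epsilon> r + 1 / 2 * \<epsilon>\<^sup>2 * (g r)\<^sup>2 + (- (147 * \<epsilon> ^ 3)) * H r ^ 3) - 1 - rad2 r * density \<epsilon> r
       \<le> density \<epsilon> r * ln (density \<epsilon> r) - rad2 r * density \<epsilon> r"
      using quadratic_error[OF good, of "1/2" r] by simp
  qed
  finally show ?thesis .
qed

text \<open>A zero integral would force the density to vanish almost everywhere, against its total
  mass pi.\<close>

lemma integral_density_powr_pos:
  assumes "0 < \<alpha>" "\<alpha> \<le> 2"
  shows "0 < (LINT r|lborel. exp (- \<alpha> * rad2 r) * density \<epsilon> r powr \<alpha>)"
proof (rule ccontr)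
  let ?f = "\<lambda>r. exp (- \<alpha> * rad2 r) * density \<epsilon> r powr \<alpha>"
  have n: "AE r in lborel. 0 \<le> ?f r" by simp
  assume "\<not> ?thesis"
  then have "(LINT r|lborel. ?f r) = 0" using integral_nonneg_AE[OF n] by linarith
  then have "AE r in lborel. ?f r = 0"
    using integral_nonneg_eq_0_iff_AE[OF integrable_density_powr[OF good assms] n] by blast
  then have "AE r in lborel. exp (- 1 * rad2 r) * density \<epsilon> r = 0" by eventually_elim simp
  then have "(LINT r|lborel. exp (- 1 * rad2 r) * density \<epsilon> r) = 0" by (rule integral_eq_zero_AE)
  then show False using has_gauss_integralD(2)[OF has_gauss_integral_density[of \<epsilon>]] by simp
qed

lemma wigner_eq: "Re (wigner (rho n \<nu> K \<epsilon>) r) = exp (- rad2 r) / pi * density \<epsilon> r"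
  and wigner_nonneg: "wigner (rho n \<nu> K \<epsilon>) r \<in> \<real>\<^sub>\<ge>\<^sub>0"
proof -
  have "wigner (rho n \<nu> K \<epsilon>) r = complex_of_real (exp (- rad2 r) / pi * density \<epsilon> r)"
    using goodD[OF good] delta_le_1[OF good] by (intro wigner_rho_density) auto
  then show "Re (wigner (rho n \<nu> K \<epsilon>) r) = exp (- rad2 r) / pi * density \<epsilon> r" "wigner (rho n \<nu> K \<epsilon>) r \<in> \<real>\<^sub>\<ge>\<^sub>0"
    using goodD(5)[OF good, of r] by (simp_all add: complex_nonneg_Reals_iff)
qed

end

text \<open>After division by \<epsilon>^2 the error is linear in \<epsilon>, so a strictly positive
  coefficient settles the comparison.\<close>

lemma ev_less:
  fixes Q D :: real
  assumes "Q > 0"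
  shows "\<forall>\<^sub>F \<epsilon> in at_right 0. 0 < \<epsilon>\<^sup>2 * Q - \<epsilon> ^ 3 * D"
proof -
  have "((\<lambda>\<epsilon>. Q - \<epsilon> * D) \<longlongrightarrow> Q - 0 * D) (at_right (0::real))" by (intro tendsto_intros)
  then have "\<forall>\<^sub>F \<epsilon> in at_right 0. 0 < Q - \<epsilon> * D" by (rule order_tendstoD) (use assms in simp)
  then show ?thesis using ev_pos
  proof eventually_elim
    case (elim \<epsilon>)
    then have "0 < \<epsilon>\<^sup>2 * (Q - \<epsilon> * D)" by simp
    then show ?case by (simp add: algebra_simps power2_eq_square power3_eq_cube)
  qed
qed

lemma wigner_vacuum: "Re (wigner (projector (fock 0)) r) = exp (- rad2 r) / pi"
  using wigner_fock[of 0 "fst r" "snd r"] by (simp add: poly_P_def laguerre_def rad2_def)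

lemma powr_scale:
  assumes "0 \<le> y"
  shows "(exp (- x) / pi * y) powr \<alpha> = pi powr - \<alpha> * (exp (- \<alpha> * x) * y powr \<alpha>)"
proof -
  have "(exp (- x) / pi * y) powr \<alpha> = exp (- x) powr \<alpha> / pi powr \<alpha> * y powr \<alpha>"
    using assms by (simp add: powr_mult powr_divide)
  also have "exp (- x) powr \<alpha> = exp (- \<alpha> * x)" by (simp add: powr_def)
  finally show ?thesis by (simp add: powr_minus field_simps)
qed

lemma integral_wigner_powr:
  assumes "good \<epsilon>"
  shows "(LINT r|lborel. Re (wigner (rho n \<nu> K \<epsilon>) r) powr \<alpha>) =
     pi powr - \<alpha> * (LINT r|lborel. exp (- \<alpha> * rad2 r) * density \<epsilon> r powr \<alpha>)"
  unfolding wigner_eq[OF assms] powr_scale[OF goodD(5)[OF assms]] by simp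

lemma integral_vacuum_powr:
  assumes "\<alpha> > 0"
  shows "(LINT r|lborel. Re (wigner (projector (fock 0)) r) powr \<alpha>) = pi powr - \<alpha> * (pi / \<alpha>)"
  unfolding wigner_vacuum using powr_scale[of 1 _ \<alpha>] integrable_gauss2(2)[OF assms] by simp

lemma renyi_well_defined_rho:
  assumes "good \<epsilon>" "0 < \<alpha>" "\<alpha> < 2" "\<alpha> \<noteq> 1"
  shows "renyi_well_defined \<alpha> (W \<epsilon>)"
proof -
  have "integrable lborel (\<lambda>r. Re (wigner (rho n \<nu> K \<epsilon>) r) powr \<alpha>)"
    unfolding wigner_eq[OF assms(1)] powr_scale[OF goodD(5)[OF assms(1)]]
    using assms by (intro integrable_mult_right integrable_density_powr) auto
  then show ?thesis
    using integral_density_powr_pos[OF assms(1), of \<alpha>] assms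
    by (simp add: renyi_well_defined_def integral_wigner_powr[OF assms(1)])
qed

lemma renyi_less_small:
  assumes a: "0 < \<alpha>" "\<alpha> < 1"
  shows "\<forall>\<^sub>F \<epsilon> in at_right 0. renyi_well_defined \<alpha> (W \<epsilon>) \<and>
     renyi_entropy \<alpha> (W \<epsilon>) < renyi_entropy \<alpha> W\<^sub>0"
proof -
  have Q: "- coeff_Q \<alpha> > 0"
    using entropy_coefficient(1)[of \<alpha> n] a n3 unfolding coeff_Q_def by (simp add: mult_pos_neg)
  \<comment> \<open>With \<delta> <= \<epsilon>^m, the choice m * \<alpha> >= 3 makes
    \<open>\<delta> powr \<alpha>\<close> at most \<epsilon>^3, as \<epsilon> <= 1.\<close>
  obtain m :: nat where m: "3 / \<alpha> \<le> real m" using real_arch_simple by blast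
  show ?thesis
    using ev_good ev_delta[of m] ev_less[OF Q, of "\<alpha> * \<bar>Eh \<alpha>\<bar> + 147 * EH \<alpha> + pi * s / \<alpha>"]
  proof eventually_elim
    case (elim \<epsilon>)
    note gd = goodD[OF elim(1)]
    have "\<delta> \<epsilon> powr \<alpha> \<le> (\<epsilon> ^ m) powr \<alpha>" using elim(2) a by (intro powr_mono2) auto
    also have "\<dots> = \<epsilon> powr (real m * \<alpha>)" using gd(1) by (simp add: powr_powr flip: powr_realpow)
    also have "\<dots> \<le> \<epsilon> powr 3" using gd m a by (intro powr_mono') (auto simp: field_simps)
    also have "\<dots> = \<epsilon> ^ 3" using gd by simp
    finally have d: "\<delta> \<epsilon> powr \<alpha> \<le> \<epsilon> ^ 3" .
    let ?I = "LINT r|lborel. exp (- \<alpha> * rad2 r) * density \<epsilon> r powr \<alpha>"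
    have I: "?I < pi / \<alpha>" using density_powr_le[OF elim(1) a d] elim(3) by linarith
    have I0: "?I > 0" using integral_density_powr_pos[OF elim(1), of \<alpha>] a by simp
    have "ln (pi powr - \<alpha> * ?I) < ln (pi powr - \<alpha> * (pi / \<alpha>))"
      by (intro ln_less_cancel_iff[THEN iffD2] mult_strict_left_mono mult_pos_pos) (use I I0 a in auto)
    then have "1 / (1 - \<alpha>) * ln (pi powr - \<alpha> * ?I) < 1 / (1 - \<alpha>) * ln (pi powr - \<alpha> * (pi / \<alpha>))"
      using a by (intro mult_strict_left_mono) auto
    then show ?case
      using renyi_well_defined_rho[OF elim(1), of \<alpha>] a
      by (simp add: renyi_entropy_def integral_wigner_powr[OF elim(1)] integral_vacuum_powr)
  qed
qed

lemma renyi_less_large: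
  assumes a: "1 < \<alpha>" "\<alpha> < 2"
  shows "\<forall>\<^sub>F \<epsilon> in at_right 0. renyi_well_defined \<alpha> (W \<epsilon>) \<and>
     renyi_entropy \<alpha> (W \<epsilon>) < renyi_entropy \<alpha> W\<^sub>0"
proof -
  have Q: "coeff_Q \<alpha> > 0"
    using entropy_coefficient(2)[of \<alpha> n] a n3 unfolding coeff_Q_def by simp
  show ?thesis
    using ev_good ev_less[OF Q, of "\<alpha> * \<bar>Eh \<alpha>\<bar> + 147 * EH \<alpha> + pi"]
  proof eventually_elim
    case (elim \<epsilon>)
    let ?I = "LINT r|lborel. exp (- \<alpha> * rad2 r) * density \<epsilon> r powr \<alpha>"
    have I: "pi / \<alpha> < ?I" using density_powr_ge[OF elim(1) a] elim(2) by linarith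
    have p: "pi / \<alpha> > 0" using a by simp
    have I0: "?I > 0" using I p by linarith
    have "ln (pi powr - \<alpha> * (pi / \<alpha>)) < ln (pi powr - \<alpha> * ?I)"
      by (intro ln_less_cancel_iff[THEN iffD2] mult_strict_left_mono mult_pos_pos) (use I I0 p in auto)
    \<comment> \<open>The prefactor is negative for \<alpha> > 1, so the larger integral gives the
      smaller entropy.\<close>
    then have "1 / (1 - \<alpha>) * ln (pi powr - \<alpha> * ?I) < 1 / (1 - \<alpha>) * ln (pi powr - \<alpha> * (pi / \<alpha>))"
      using a by (intro mult_strict_left_mono_neg) auto
    then show ?case
      using renyi_well_defined_rho[OF elim(1), of \<alpha>] a
      by (simp add: renyi_entropy_def integral_wigner_powr[OF elim(1)] integral_vacuum_powr)
  qed
qed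

lemma mult_ln_scale:
  assumes "0 \<le> w"
  shows "w / pi * ln (w / pi) = 1 / pi * (w * ln w) - ln pi / pi * w"
  using assms by (cases "w = 0") (simp_all add: ln_div algebra_simps)

lemma renyi_1_vacuum: "renyi_entropy 1 W\<^sub>0 = 1 + ln pi"
proof -
  have e: "exp (- rad2 r) / pi * ln (exp (- rad2 r) / pi) = - (1 / pi) * (exp (- 1 * rad2 r) * rad2 r) + - (ln pi / pi) * (exp (- 1 * rad2 r) * 1)" for r
    using mult_ln_scale[of "exp (- rad2 r)"] by (simp add: algebra_simps)
  have "(LINT r|lborel. exp (- rad2 r) / pi * ln (exp (- rad2 r) / pi)) = - (1 / pi) * pi + - (ln pi / pi) * (pi / 1)"
    unfolding e
    using has_gauss_integralD[OF has_gauss_integral_add[OF has_gauss_integral_cmult[OF has_gauss_integral_rad2, of "- (1 / pi)"]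
      has_gauss_integral_cmult[OF has_gauss_integral_1[of 1], of "- (ln pi / pi)"]]]
    by (simp only: distrib_left mult.left_commute[of "exp _"] zero_less_one)
  then show ?thesis by (simp add: renyi_entropy_def wigner_vacuum)
qed

lemma renyi_less_1:
  "\<forall>\<^sub>F \<epsilon> in at_right 0. renyi_well_defined 1 (W \<epsilon>) \<and>
     renyi_entropy 1 (W \<epsilon>) < renyi_entropy 1 W\<^sub>0"
proof -
  have Q: "pi * (2 ^ n - 2 * real n) > 0" using two_mult_less_power[OF n3] by simp
  show ?thesis
    using ev_good ev_less[OF Q, of "pi * s + 147 * EH 1"]
  proof eventually_elim
    case (elim \<epsilon>)
    let ?w = "\<lambda>r. exp (- rad2 r) * density \<epsilon> r"
    let ?J = "LINT r|lborel. ?w r * ln (?w r)"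
    have e: "Re (wigner (rho n \<nu> K \<epsilon>) r) * ln (Re (wigner (rho n \<nu> K \<epsilon>) r)) = 1 / pi * (?w r * ln (?w r)) - ln pi / pi * ?w r" for r
    proof -
      have "exp (- rad2 r) / pi * density \<epsilon> r = ?w r / pi" by simp
      then show ?thesis
        unfolding wigner_eq[OF elim(1)] using goodD(5)[OF elim(1), of r] by (simp only:) (rule mult_ln_scale, simp)
    qed
    have w: "integrable lborel ?w" "(LINT r|lborel. ?w r) = pi"
      using has_gauss_integralD[OF has_gauss_integral_density[of \<epsilon>]] by simp_all
    note i = integrable_weighted_ln[OF elim(1)]
    have wd: "renyi_well_defined 1 (W \<epsilon>)"
      unfolding renyi_well_defined_def e
      using Bochner_Integration.integrable_diff[OF integrable_mult_right[OF i, of "1 / pi"] integrable_mult_right[OF w(1), of "ln pi / pi"]]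
      by simp
    have "renyi_entropy 1 (W \<epsilon>) = - (1 / pi * ?J - ln pi / pi * pi)"
      unfolding renyi_entropy_def e
      using Bochner_Integration.integral_diff[OF integrable_mult_right[OF i, of "1 / pi"] integrable_mult_right[OF w(1), of "ln pi / pi"]]
      unfolding integral_mult_right_zero w(2) by simp
    also have "\<dots> = ln pi - ?J / pi" by simp
    also have "\<dots> < ln pi + 1"
    proof -
      have "- pi < ?J" using integral_weighted_ln_ge[OF elim(1)] elim(2) by linarith
      then have "- 1 < ?J / pi" by (simp add: field_simps)
      then show ?thesis by simp
    qed
    finally show ?case using wd unfolding renyi_1_vacuum by simp
  qed
qed

end

lemma eventually_at_rightD:
  fixes P :: "real \<Rightarrow> bool"
  assumes "\<forall>\<^sub>F x in at_right 0. P x"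
  shows "\<exists>b>0. \<forall>x. 0 < x \<and> x < b \<longrightarrow> P x"
  using assms unfolding eventually_at_right_field by auto

theorem mainTheorem4:
  fixes n :: nat and \<nu> K :: real
  assumes "n \<ge> 3" and "\<nu> > 0" and "K > 1"
  shows "(\<exists>\<epsilon>\<^sub>1>0. \<forall>\<epsilon>. 0 < \<epsilon> \<and> \<epsilon> < \<epsilon>\<^sub>1 \<longrightarrow>
            0 < delta n \<nu> K \<epsilon> \<and> delta n \<nu> K \<epsilon> < 1 \<and>
            quantum_state (rho n \<nu> K \<epsilon>) \<and>
            (\<forall>r. wigner (rho n \<nu> K \<epsilon>) r \<in> \<real>\<^sub>\<ge>\<^sub>0)) \<and>
         (\<forall>\<alpha>. 0 < \<alpha> \<and> \<alpha> < 2 \<longrightarrow>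
            (\<exists>\<epsilon>\<^sub>0>0. \<forall>\<epsilon>. 0 < \<epsilon> \<and> \<epsilon> < \<epsilon>\<^sub>0 \<longrightarrow>
               renyi_well_defined \<alpha> (\<lambda>r. Re (wigner (rho n \<nu> K \<epsilon>) r)) \<and>
               renyi_entropy \<alpha> (\<lambda>r. Re (wigner (rho n \<nu> K \<epsilon>) r))
                 < renyi_entropy \<alpha> (\<lambda>r. Re (wigner (projector (fock 0)) r))))"
proof -
  interpret family n \<nu> K by unfold_locales (fact assms)+
  have 1: "\<forall>\<^sub>F \<epsilon> in at_right 0. 0 < \<delta> \<epsilon> \<and> \<delta> \<epsilon> < 1 \<and>
            quantum_state (rho n \<nu> K \<epsilon>) \<and> (\<forall>r. wigner (rho n \<nu> K \<epsilon>) r \<in> \<real>\<^sub>\<ge>\<^sub>0)"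
    using ev_good
  proof eventually_elim
    case (elim \<epsilon>)
    note gd = goodD[OF elim]
    have "\<epsilon>\<^sup>2 \<le> (1 / 2)\<^sup>2" using gd by (intro power_mono) auto
    then have "\<delta> \<epsilon> < 1" using delta_le_sq[OF elim] by (simp add: power2_eq_square)
    then show ?case
      using gd(1-3) wigner_nonneg[OF elim] quantum_state_rho[of \<nu> n \<epsilon> K] assms by auto
  qed
  have 2: "\<forall>\<^sub>F \<epsilon> in at_right 0. renyi_well_defined \<alpha> (W \<epsilon>) \<and>
     renyi_entropy \<alpha> (W \<epsilon>) < renyi_entropy \<alpha> W\<^sub>0"
    if "0 < \<alpha>" "\<alpha> < 2" for \<alpha>
    using renyi_less_small[of \<alpha>] renyi_less_large[of \<alpha>] renyi_less_1 that
    by (cases \<alpha> "1::real" rule: linorder_cases) auto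
  show ?thesis by (intro conjI allI impI eventually_at_rightD 1 2) auto
qed

end
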